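(* Let $k$ be a field, $S=k[x_1,\ldots,x_n]$, and let $M$ be a nonzero proper monomial ideal of $S$ with minimal monomial generating set $G$. The following are equivalent: (i) $\operatorname{pd}(S/M)=n$. (ii) $b_i(S/M)\ge \binom{n}{i}$ for all $i$. (iii) $G$ contains a dominant set $D$ of cardinality $n$ such that no monomial of $G$ strongly divides $\operatorname{lcm}(D)$. (iv) $\operatorname{odom}(S/M)=n$. (v) There is a minimal net of $M_{\mathrm{pol}}$ of cardinality $n$.
   Context: $\operatorname{pd}(S/M)$ is the projective dimension of the $S$-module $S/M$, and $b_i(S/M)$ is its $i$-th Betti number (the rank of the $i$-th free module in the minimal free resolution of $S/M$). Dominance: if $L$ is a finite set of monomials, $m\in L$ is dominant (in $L$) in the variable $x$ if for every $m'\in L\setminus\{m\}$ the exponent of $x$ in $m$ is strictly larger than the exponent of $x$ in $m'$. $L$ is a dominant set if each of its elements is dominant in some variable. Strong divisibility: $x_1^{\alpha_1}\cdots x_n^{\alpha_n}$ strongly divides $x_1^{\beta_1}\cdots x_n^{\beta_n}$ if $\alpha_i<\beta_i$ for every $i$ with $\alpha_i\ne 0$. Order of dominance: let $\mathscr{I}$ be the class of all sequences $1\le i_1<\cdots<i_q\le n$ with $q\ge 1$ for which $G$ contains a dominant set $D=\{d_1,\ldots,d_q\}$ of cardinality $q$ such that (1) each $d_j$ is dominant (in $D$) in $x_{i_j}$, and (2) writing $\operatorname{lcm}(D)=x_1^{\alpha_1}\cdots x_n^{\alpha_n}$, every $m\in G$ dividing $\operatorname{lcm}(D)$ is divisible by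 at least one of $x_{i_1}^{\alpha_{i_1}},\ldots,x_{i_q}^{\alpha_{i_q}}$. Then $\operatorname{odom}(S/M)$ is the maximum length $q$ of a sequence in $\mathscr{I}$. Polarization: the polarization of $m=x_1^{\alpha_1}\cdots x_n^{\alpha_n}$ is $m'=x_{1,1}\cdots x_{1,\alpha_1}\cdots x_{n,1}\cdots x_{n,\alpha_n}$. $M_{\mathrm{pol}}$ is the ideal minimally generated by the polarizations of the elements of $G$, in the polynomial ring $S_{\mathrm{pol}}$ over $k$ whose variables are those $x_{i,j}$ appearing in these generators. Nets: a net of a monomial ideal is a set $X$ of variables of its ambient ring such that every minimal generator of the ideal is divisible by at least one element of $X$; a minimal net is a net no proper subset of which is a net. *)

theory Defs
  imports
    "HOL-Algebra.QuotRing"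
    "HOL-Algebra.Module"
    "HOL-Library.Poly_Mapping"
    "HOL-Library.Extended_Nat"
    "HOL-Library.Cardinality"
begin

definition mod_hom ::
  "('a, 'r) ring_scheme \<Rightarrow> ('a, 'b, 'm) module_scheme \<Rightarrow> ('a, 'c, 'l) module_scheme \<Rightarrow> ('b \<Rightarrow> 'c) set"
  where "mod_hom R A B = {f \<in> carrier A \<rightarrow> carrier B.
     (\<forall>x\<in>carrier A. \<forall>y\<in>carrier A. f (x \<oplus>\<^bsub>A\<^esub> y) = f x \<oplus>\<^bsub>B\<^esub> f y) \<and>
     (\<forall>r\<in>carrier R. \<forall>x\<in>carrier A. f (r \<odot>\<^bsub>A\<^esub> x) = r \<odot>\<^bsub>B\<^esub> f x)}"

definition mod_kernel :: "('a, 'b, 'm) module_scheme \<Rightarrow> ('a, 'c, 'l) module_scheme \<Rightarrow> ('b \<Rightarrow> 'c) \<Rightarrow> 'b set"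
  where "mod_kernel A B f = {x \<in> carrier A. f x = \<zero>\<^bsub>B\<^esub>}"

text \<open>The module structure on \<open>R Quot I\<close>: a scalar acts as multiplication by its residue class.\<close>

definition quot_module :: "('a, 'r) ring_scheme \<Rightarrow> 'a set \<Rightarrow> ('a, 'a set) module"
  where "quot_module R I =
    \<lparr>carrier = carrier (R Quot I), mult = mult (R Quot I), one = one (R Quot I),
     zero = zero (R Quot I), add = add (R Quot I),
     smult = (\<lambda>r X. (I +>\<^bsub>R\<^esub> r) \<otimes>\<^bsub>R Quot I\<^esub> X)\<rparr>"

text \<open>
  The free module \<open>R\<^sup>r\<close>: vectors indexed by \<open>{..<r}\<close> and padded by zeros. The ring fields
  \<open>mult\<close> and \<open>one\<close> of the record are irrelevant for modules.
\<close>

definition free_module :: "('a, 'r) ring_scheme \<Rightarrow> nat \<Rightarrow> ('a, nat \<Rightarrow> 'a) module"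
  where "free_module R r =
    \<lparr>carrier = {v. (\<forall>i<r. v i \<in> carrier R) \<and> (\<forall>i\<ge>r. v i = \<zero>\<^bsub>R\<^esub>)},
     mult = undefined, one = undefined,
     zero = (\<lambda>_. \<zero>\<^bsub>R\<^esub>), add = (\<lambda>v w i. v i \<oplus>\<^bsub>R\<^esub> w i),
     smult = (\<lambda>a v i. a \<otimes>\<^bsub>R\<^esub> v i)\<rparr>"

definition unit_vector :: "('a, 'r) ring_scheme \<Rightarrow> nat \<Rightarrow> nat \<Rightarrow> 'a"
  where "unit_vector R j = (\<lambda>i. if i = j then \<one>\<^bsub>R\<^esub> else \<zero>\<^bsub>R\<^esub>)"

text \<open>
  Lifting property of projective modules. HOL cannot quantify over the types of \<open>A\<close> and \<open>B\<close>;
  they range over all modules on the type \<open>'b\<close> of \<open>P\<close>. If \<open>'b\<close> is infinite and at least as large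
  as \<open>R\<close>, this is projectivity in the usual sense, since then the free module on the elements of
  \<open>P\<close> has an isomorphic copy on \<open>'b\<close>.
\<close>

definition projective_module :: "('a, 'r) ring_scheme \<Rightarrow> ('a, 'b) module \<Rightarrow> bool"
  where "projective_module R P \<longleftrightarrow> Module.module R P \<and>
    (\<forall>(A :: ('a, 'b) module) (B :: ('a, 'b) module) f g.
       Module.module R A \<longrightarrow> Module.module R B \<longrightarrow>
       f \<in> mod_hom R A B \<longrightarrow> f ` carrier A = carrier B \<longrightarrow> g \<in> mod_hom R P B \<longrightarrow>
       (\<exists>h\<in>mod_hom R P A. \<forall>x\<in>carrier P. f (h x) = g x))"

text \<open>Exactness of \<open>\<dots> \<rightarrow> P 2 \<rightarrow> P 1 \<rightarrow> P 0 \<rightarrow> N \<rightarrow> 0\<close>, with \<open>d i\<close> mapping \<open>P (i + 1)\<close> to \<open>P i\<close>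
  and \<open>\<epsilon>\<close> mapping \<open>P 0\<close> to \<open>N\<close>.\<close>

definition resolution ::
  "('a, 'r) ring_scheme \<Rightarrow> ('a, 'c) module \<Rightarrow> (nat \<Rightarrow> ('a, 'b) module) \<Rightarrow>
    (nat \<Rightarrow> 'b \<Rightarrow> 'b) \<Rightarrow> ('b \<Rightarrow> 'c) \<Rightarrow> bool"
  where "resolution R N P d \<epsilon> \<longleftrightarrow>
    (\<forall>i. Module.module R (P i)) \<and>
    (\<forall>i. d i \<in> mod_hom R (P (Suc i)) (P i)) \<and>
    \<epsilon> \<in> mod_hom R (P 0) N \<and>
    \<epsilon> ` carrier (P 0) = carrier N \<and>
    d 0 ` carrier (P 1) = mod_kernel (P 0) N \<epsilon> \<and>
    (\<forall>i. d (Suc i) ` carrier (P (Suc (Suc i))) = mod_kernel (P (Suc i)) (P i) (d i))"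

text \<open>
  The least length of a projective resolution (\<open>\<infinity>\<close> if there is no finite one). The modules in the
  resolution live on \<open>nat \<Rightarrow> 'a\<close>, which contains a copy of every countably generated
  \<open>R\<close>-module; for a finitely generated module over a Noetherian ring this does not affect the
  minimum, as a resolution of minimal length by finitely generated modules exists.
\<close>

definition proj_dim :: "('a, 'r) ring_scheme \<Rightarrow> ('a, 'c) module \<Rightarrow> enat"
  where "proj_dim R N = Inf {enat l | l.
    \<exists>(P :: nat \<Rightarrow> ('a, nat \<Rightarrow> 'a) module) d \<epsilon>.
      resolution R N P d \<epsilon> \<and> (\<forall>i. projective_module R (P i)) \<and>
      (\<forall>i>l. carrier (P i) = {\<zero>\<^bsub>P i\<^esub>})}"

text \<open>A monomial is represented by its exponent vector, of type \<open>'v \<Rightarrow>\<^sub>0 nat\<close>.\<close>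

definition mpoly_ring :: "'v set \<Rightarrow> (('v \<Rightarrow>\<^sub>0 nat) \<Rightarrow>\<^sub>0 'k::field) ring"
  where "mpoly_ring V =
    \<lparr>carrier = {p. \<forall>m\<in>Poly_Mapping.keys p. Poly_Mapping.keys m \<subseteq> V},
     mult = (*), one = 1, zero = 0, add = (+)\<rparr>"

definition mono_poly :: "('v \<Rightarrow>\<^sub>0 nat) \<Rightarrow> (('v \<Rightarrow>\<^sub>0 nat) \<Rightarrow>\<^sub>0 'k::field)"
  where "mono_poly m = Poly_Mapping.single m 1"

definition generated_by_monomials ::
  "'v set \<Rightarrow> ('v \<Rightarrow>\<^sub>0 nat) set \<Rightarrow> (('v \<Rightarrow>\<^sub>0 nat) \<Rightarrow>\<^sub>0 'k::field) set"
  where "generated_by_monomials V A = genideal (mpoly_ring V) (mono_poly ` A)"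

definition monomials_in :: "'v set \<Rightarrow> ('v \<Rightarrow>\<^sub>0 nat) set"
  where "monomials_in V = {m. Poly_Mapping.keys m \<subseteq> V}"

definition monomial_ideal :: "'v set \<Rightarrow> (('v \<Rightarrow>\<^sub>0 nat) \<Rightarrow>\<^sub>0 'k::field) set \<Rightarrow> bool"
  where "monomial_ideal V I \<longleftrightarrow> (\<exists>A \<subseteq> monomials_in V. I = generated_by_monomials V A)"

text \<open>The minimal monomial generating set, which is unique for a monomial ideal.\<close>

definition min_gens :: "'v set \<Rightarrow> (('v \<Rightarrow>\<^sub>0 nat) \<Rightarrow>\<^sub>0 'k::field) set \<Rightarrow> ('v \<Rightarrow>\<^sub>0 nat) set"
  where "min_gens V I = (THE G. G \<subseteq> monomials_in V \<and> generated_by_monomials V G = I \<and>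
    (\<forall>H. H \<subset> G \<longrightarrow> generated_by_monomials V H \<noteq> I))"

definition mono_dvd :: "('v \<Rightarrow>\<^sub>0 nat) \<Rightarrow> ('v \<Rightarrow>\<^sub>0 nat) \<Rightarrow> bool"
  where "mono_dvd a b \<longleftrightarrow> (\<forall>i. Poly_Mapping.lookup a i \<le> Poly_Mapping.lookup b i)"

definition mono_strongly_dvd :: "('v \<Rightarrow>\<^sub>0 nat) \<Rightarrow> ('v \<Rightarrow>\<^sub>0 nat) \<Rightarrow> bool"
  where "mono_strongly_dvd a b \<longleftrightarrow>
    (\<forall>i. Poly_Mapping.lookup a i \<noteq> 0 \<longrightarrow> Poly_Mapping.lookup a i < Poly_Mapping.lookup b i)"

text \<open>Intended for finite \<open>D\<close> (on \<open>nat\<close>, the supremum of the empty set is \<open>0\<close>).\<close>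

definition mono_lcm :: "('v \<Rightarrow>\<^sub>0 nat) set \<Rightarrow> ('v \<Rightarrow>\<^sub>0 nat)"
  where "mono_lcm D = Abs_poly_mapping (\<lambda>i. SUP m\<in>D. Poly_Mapping.lookup m i)"

definition irrelevant_ideal :: "(('n \<Rightarrow>\<^sub>0 nat) \<Rightarrow>\<^sub>0 'k::field) set"
  where "irrelevant_ideal = generated_by_monomials UNIV (range (\<lambda>i. Poly_Mapping.single i 1))"

text \<open>
  A minimal (multigraded) free resolution of \<open>S/M\<close> by the modules \<open>S\<^bsup>b i\<^esup>\<close>, where \<open>S\<close> is the
  polynomial ring in the variables \<open>UNIV\<close>. The \<open>j\<close>-th basis element of \<open>S\<^bsup>b i\<^esup>\<close> has multidegree
  \<open>deg i j\<close>, all maps are homogeneous of degree \<open>0\<close>, and minimality says that the image of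
  each differential lies in the irrelevant ideal times its codomain.
\<close>

definition minimal_free_resolution ::
  "(('n \<Rightarrow>\<^sub>0 nat) \<Rightarrow>\<^sub>0 'k::field) set \<Rightarrow> (nat \<Rightarrow> nat) \<Rightarrow> (nat \<Rightarrow> nat \<Rightarrow> ('n \<Rightarrow>\<^sub>0 nat)) \<Rightarrow>
    (nat \<Rightarrow> (nat \<Rightarrow> (('n \<Rightarrow>\<^sub>0 nat) \<Rightarrow>\<^sub>0 'k)) \<Rightarrow> (nat \<Rightarrow> (('n \<Rightarrow>\<^sub>0 nat) \<Rightarrow>\<^sub>0 'k))) \<Rightarrow>
    ((nat \<Rightarrow> (('n \<Rightarrow>\<^sub>0 nat) \<Rightarrow>\<^sub>0 'k)) \<Rightarrow> (('n \<Rightarrow>\<^sub>0 nat) \<Rightarrow>\<^sub>0 'k) set) \<Rightarrow> bool"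
  where "minimal_free_resolution M b deg d \<epsilon> \<longleftrightarrow>
    (let S = mpoly_ring UNIV; F = (\<lambda>i. free_module S (b i)); e = unit_vector S in
      resolution S (quot_module S M) F d \<epsilon> \<and>
      (\<forall>j<b 0. \<exists>c. \<epsilon> (e j) = M +>\<^bsub>S\<^esub> Poly_Mapping.single (deg 0 j) c) \<and>
      (\<forall>i. \<forall>j<b (Suc i). \<forall>l<b i. \<forall>a\<in>Poly_Mapping.keys (d i (e j) l). a + deg i l = deg (Suc i) j) \<and>
      (\<forall>i. \<forall>v\<in>carrier (F (Suc i)). \<forall>l<b i. d i v l \<in> irrelevant_ideal))"

definition betti :: "(('n \<Rightarrow>\<^sub>0 nat) \<Rightarrow>\<^sub>0 'k::field) set \<Rightarrow> nat \<Rightarrow> nat"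
  where "betti M i = (THE r. \<exists>b deg d \<epsilon>. minimal_free_resolution M b deg d \<epsilon> \<and> b i = r)"

definition dominant_in :: "('v \<Rightarrow>\<^sub>0 nat) set \<Rightarrow> ('v \<Rightarrow>\<^sub>0 nat) \<Rightarrow> 'v \<Rightarrow> bool"
  where "dominant_in L m x \<longleftrightarrow>
    m \<in> L \<and> (\<forall>m'\<in>L - {m}. Poly_Mapping.lookup m' x < Poly_Mapping.lookup m x)"

definition dominant_set :: "('v \<Rightarrow>\<^sub>0 nat) set \<Rightarrow> bool"
  where "dominant_set L \<longleftrightarrow> finite L \<and> (\<forall>m\<in>L. \<exists>x. dominant_in L m x)"

text \<open>The sequences \<open>i\<^sub>1 < \<dots> < i\<^sub>q\<close> are lists \<open>xs\<close> of variables, and \<open>ds\<close> lists the matching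
  elements of \<open>D\<close>.\<close>

definition odom_class ::
  "(('n::{finite,linorder} \<Rightarrow>\<^sub>0 nat) \<Rightarrow>\<^sub>0 'k::field) set \<Rightarrow> 'n list set"
  where "odom_class M = {xs. xs \<noteq> [] \<and> sorted_wrt (<) xs \<and>
    (\<exists>D ds. D \<subseteq> min_gens UNIV M \<and> dominant_set D \<and> card D = length xs \<and>
       D = set ds \<and> length ds = length xs \<and>
       (\<forall>j<length xs. dominant_in D (ds ! j) (xs ! j)) \<and>
       (\<forall>m\<in>min_gens UNIV M. mono_dvd m (mono_lcm D) \<longrightarrow>
          (\<exists>x\<in>set xs. mono_dvd (Poly_Mapping.single x (Poly_Mapping.lookup (mono_lcm D) x)) m)))}"

definition odom :: "(('n::{finite,linorder} \<Rightarrow>\<^sub>0 nat) \<Rightarrow>\<^sub>0 'k::field) set \<Rightarrow> nat"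
  where "odom M = Max (length ` odom_class M)"

text \<open>The variable \<open>x\<^bsub>i,j\<^esub>\<close> is represented by the pair \<open>(i, j)\<close>, with \<open>j \<ge> 1\<close>.\<close>

definition polarize :: "('n \<Rightarrow>\<^sub>0 nat) \<Rightarrow> ('n \<times> nat \<Rightarrow>\<^sub>0 nat)"
  where "polarize m =
    (\<Sum>i\<in>Poly_Mapping.keys m. \<Sum>j=1..Poly_Mapping.lookup m i. Poly_Mapping.single (i, j) 1)"

definition pol_vars :: "(('n \<Rightarrow>\<^sub>0 nat) \<Rightarrow>\<^sub>0 'k::field) set \<Rightarrow> ('n \<times> nat) set"
  where "pol_vars M = (\<Union>m\<in>min_gens UNIV M. Poly_Mapping.keys (polarize m))"

definition pol_ideal ::
  "(('n \<Rightarrow>\<^sub>0 nat) \<Rightarrow>\<^sub>0 'k::field) set \<Rightarrow> (('n \<times> nat \<Rightarrow>\<^sub>0 nat) \<Rightarrow>\<^sub>0 'k) set"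
  where "pol_ideal M = generated_by_monomials (pol_vars M) (polarize ` min_gens UNIV M)"

text \<open>Here \<open>I\<close> is a monomial ideal of the polynomial ring in the variables \<open>V\<close>.\<close>

definition is_net :: "'v set \<Rightarrow> (('v \<Rightarrow>\<^sub>0 nat) \<Rightarrow>\<^sub>0 'k::field) set \<Rightarrow> 'v set \<Rightarrow> bool"
  where "is_net V I X \<longleftrightarrow>
    X \<subseteq> V \<and> (\<forall>m\<in>min_gens V I. \<exists>x\<in>X. mono_dvd (Poly_Mapping.single x 1) m)"

definition is_minimal_net :: "'v set \<Rightarrow> (('v \<Rightarrow>\<^sub>0 nat) \<Rightarrow>\<^sub>0 'k::field) set \<Rightarrow> 'v set \<Rightarrow> bool"
  where "is_minimal_net V I X \<longleftrightarrow> is_net V I X \<and> (\<forall>Y. Y \<subset> X \<longrightarrow> \<not> is_net V I Y)"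

end

theory Submission
  imports Defs "HOL-Library.Function_Algebras"
begin

text \<open>
  All five conditions say that there is a monomial \<open>x\<^sup>u\<close> outside \<open>M\<close> all of whose products with a
  variable lie in \<open>M\<close>, that is, a monomial in the socle of \<open>S/M\<close>. For (iii) and (iv), one generator
  dividing each \<open>x\<^sub>j x\<^sup>u\<close> gives the dominant set \<open>D\<close>, and \<open>lcm D\<close> has exponent vector \<open>u + (1,\<dots>,1)\<close>; for (v),
  the net consists of the variables \<open>x\<^bsub>j,u\<^sub>j+1\<^esub>\<close>.

  In a minimal multigraded resolution \<open>F\<close>, let \<open>F\<^sup>T = F/(x\<^sub>t : t \<in> T)F\<close>. The sequences
  \<open>0 \<rightarrow> F\<^sup>T \<rightarrow> F\<^sup>T \<rightarrow> F\<^bsup>T+l\<^esup> \<rightarrow> 0\<close> given by multiplication with \<open>x\<^sub>l\<close> show by induction on \<open>T\<close> that the homology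
  of \<open>F\<^sup>T\<close> vanishes above degree \<open>|T|\<close>, and that the connecting map identifies the socle elements of degree
  \<open>a + e\<^sub>l\<close> in the homology of \<open>F\<^bsup>T+l\<^esup>\<close> in degree \<open>|T|+1\<close> with those of degree \<open>a\<close> in the homology of \<open>F\<^sup>T\<close>
  in degree \<open>|T|\<close>. For \<open>T\<close> the set of all variables the differential of \<open>F\<^sup>T\<close> is zero, so \<open>b\<^sub>n \<noteq> 0\<close>
  exactly if \<open>S/M\<close> has a socle monomial \<open>x\<^sup>u\<close>. In that case every \<open>T\<close> yields a generator of
  \<open>F\<^bsub>|T|\<^esub>\<close> whose degree equals \<open>u + 1\<close> on \<open>T\<close> and is at most \<open>u\<close> elsewhere; these degrees determine
  \<open>T\<close>, whence \<open>b\<^sub>i \<ge> binomial n i\<close>. Finally, \<open>F\<close> is a retract modulo the irrelevant ideal of every projective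
  resolution, which makes \<open>b\<^sub>i\<close> well defined and shows that the projective dimension is the last
  \<open>i\<close> with \<open>b\<^sub>i \<noteq> 0\<close>.
\<close>

section \<open>The multigraded chase\<close>

text \<open>As the homology of \<open>F^T\<close> at index \<open>|T|+1\<close> vanishes, the
  connecting map from index \<open>|T|+1\<close> of \<open>F^(T+l)\<close> to index
  \<open>|T|\<close> of \<open>F^T\<close> is injective with image the kernel of \<open>x_l\<close>.
  So a class passes from \<open>T\<close> to \<open>T+l\<close> exactly if \<open>x_l\<close> kills
  it, and annihilation by the variables not yet used has to be carried along. At the end this is the
  isomorphism of the top Tor of \<open>S/M\<close> and \<open>k\<close> with the socle, shifted by
  \<open>(1,...,1)\<close>.

  The chase runs on coordinates. Within one multidegree every multiplication by a monomial is an
  inclusion of coordinate spaces, so the exact sequences are partitions of sets of generator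
  degrees, and no homology module is ever formed. The differential respects the partition in one
  direction only; its spill in the other direction is the connecting map.

  Betti numbers are given by a definite description, so a minimal resolution must be exhibited. It
  is built as an infinite sequence of minimal presentations, with Dickson's lemma behind the finite
  generation of each syzygy module; its finite length is a result of the chase.\<close>

text \<open>
  A multigraded complex of free modules is represented by scalars: the \<open>j\<close>-th generator of the
  \<open>i\<close>-th module has degree \<open>dg i j\<close>, and \<open>D i l j\<close> is the coefficient of the monomial with which the
  \<open>l\<close>-th generator of the \<open>i\<close>-th module occurs in the image of the \<open>j\<close>-th generator of the next one.
  The part of degree \<open>a\<close> of the \<open>i\<close>-th module is then \<open>vecs i {..a}\<close> (defined below), multiplication by a
  monomial is the inclusion of such spaces, and \<open>layer T a\<close> cuts out the part of degree \<open>a\<close> of the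
  quotient by the variables in \<open>T\<close>.
\<close>

locale multigraded_complex =
  fixes b :: "nat \<Rightarrow> nat" and dg :: "nat \<Rightarrow> nat \<Rightarrow> 'n \<Rightarrow> nat" and D :: "nat \<Rightarrow> nat \<Rightarrow> nat \<Rightarrow> 'k::field"
  assumes D_deg: "l < b i \<Longrightarrow> j < b (Suc i) \<Longrightarrow> D i l j \<noteq> 0 \<Longrightarrow> dg i l \<le> dg (Suc i) j"
begin

definition vecs :: "nat \<Rightarrow> ('n \<Rightarrow> nat) set \<Rightarrow> (nat \<Rightarrow> 'k) set"
  where "vecs i J = {v. \<forall>j. v j \<noteq> 0 \<longrightarrow> j < b i \<and> dg i j \<in> J}"

definition restr :: "nat \<Rightarrow> ('n \<Rightarrow> nat) set \<Rightarrow> (nat \<Rightarrow> 'k) \<Rightarrow> nat \<Rightarrow> 'k"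
  where "restr i J v = (\<lambda>j. if dg i j \<in> J then v j else 0)"

text \<open>Indexed by its source. The zero map at index \<open>0\<close> makes every vector there a
  cycle, so that the homology at \<open>0\<close> is the cokernel.\<close>

definition bdy :: "nat \<Rightarrow> (nat \<Rightarrow> 'k) \<Rightarrow> nat \<Rightarrow> 'k"
  where "bdy i v = (case i of 0 \<Rightarrow> 0
    | Suc i' \<Rightarrow> (\<lambda>l. if l < b i' then \<Sum>j<b i. D i' l j * v j else 0))"

text \<open>In degree \<open>a\<close> a generator of degree \<open>c\<close> carries the monomial
  with exponent \<open>a - c\<close>, which is nonzero modulo the variables in \<open>T\<close>
  exactly if \<open>c\<close> and \<open>a\<close> agree on \<open>T\<close>.\<close>

definition layer :: "'n set \<Rightarrow> ('n \<Rightarrow> nat) \<Rightarrow> ('n \<Rightarrow> nat) set"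
  where "layer T a = {c. c \<le> a \<and> (\<forall>t\<in>T. c t = a t)}"

lemma bdy_Suc: "bdy (Suc i) v = (\<lambda>l. if l < b i then \<Sum>j<b (Suc i). D i l j * v j else 0)"
  by (simp add: bdy_def)

lemma bdy_0 [simp]: "bdy 0 v = 0"
  by (simp add: bdy_def)

lemma bdy_diff: "bdy i (v - w) = bdy i v - bdy i w"
  by (cases i) (auto simp: bdy_Suc fun_eq_iff right_diff_distrib sum_subtractf)

lemma bdy_zero [simp]: "bdy i 0 = 0"
  by (cases i) (auto simp: bdy_Suc fun_eq_iff)

lemma restr_diff: "restr i J (v - w) = restr i J v - restr i J w"
  by (auto simp: restr_def fun_eq_iff)

lemma restr_zero [simp]: "restr i J 0 = 0"
  by (auto simp: restr_def fun_eq_iff)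

lemma restr_id: "v \<in> vecs i J \<Longrightarrow> J \<subseteq> J' \<Longrightarrow> restr i J' v = v"
  by (force simp: restr_def vecs_def fun_eq_iff)

lemma restr_disjoint: "v \<in> vecs i J \<Longrightarrow> J \<inter> J' = {} \<Longrightarrow> restr i J' v = 0"
  by (fastforce simp: restr_def vecs_def fun_eq_iff)

lemma restr_restr: "restr i J (restr i J' v) = restr i (J \<inter> J') v"
  by (auto simp: restr_def fun_eq_iff)

lemma vecs_diff: "v \<in> vecs i J \<Longrightarrow> w \<in> vecs i J \<Longrightarrow> v - w \<in> vecs i J"
  unfolding vecs_def by simp (metis diff_zero)

lemma vecs_mono: "v \<in> vecs i J \<Longrightarrow> J \<subseteq> J' \<Longrightarrow> v \<in> vecs i J'"
  by (auto simp: vecs_def)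

lemma restr_vecs: "v \<in> vecs i J \<Longrightarrow> restr i J' v \<in> vecs i (J \<inter> J')"
  by (auto simp: vecs_def restr_def)

lemma diff_restr_vecs: "v \<in> vecs i J \<Longrightarrow> v - restr i J' v \<in> vecs i (J - J')"
  by (auto simp: vecs_def restr_def)

lemma vecs_diff_restrict:
  "v \<in> vecs i J \<Longrightarrow> w \<in> vecs i J \<Longrightarrow> restr i J' v = restr i J' w \<Longrightarrow> v - w \<in> vecs i (J - J')"
  by (metis diff_restr_vecs vecs_diff restr_diff diff_self diff_zero)

lemma bdy_vecs:
  assumes "v \<in> vecs (Suc i) {..a}" shows "bdy (Suc i) v \<in> vecs i {..a}"
proof -
  have "dg i l \<le> a" if l: "l < b i" and s: "(\<Sum>j<b (Suc i). D i l j * v j) \<noteq> 0" for l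
  proof -
    obtain j where j: "j < b (Suc i)" "D i l j \<noteq> 0" "v j \<noteq> 0"
      using sum.not_neutral_contains_not_neutral[OF s] by (auto simp: lessThan_iff)
    have "dg (Suc i) j \<le> a" using assms j(3) by (simp add: vecs_def)
    with D_deg[OF l j(1,2)] show ?thesis by (rule order_trans)
  qed
  then show ?thesis by (auto simp: vecs_def bdy_Suc)
qed

text \<open>A nonzero coefficient needs the target degree below the source degree, which is excluded
  for every pair from \<open>U\<close> and \<open>J\<close>.\<close>

lemma restr_bdy_eq_0:
  assumes v: "v \<in> vecs i U" and J: "\<And>c c'. c \<in> U \<Longrightarrow> c' \<in> J \<Longrightarrow> \<not> c' \<le> c"
  shows "restr (i - Suc 0) J (bdy i v) = 0"
proof (cases i)
  case (Suc i')
  have "(\<Sum>j<b i. D i' l j * v j) = 0" if "l < b i'" "dg i' l \<in> J" for l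
  proof (rule sum.neutral, rule ballI)
    fix j assume "j \<in> {..<b i}"
    then show "D i' l j * v j = 0"
      using J[of "dg i j" "dg i' l"] that v D_deg[of l i' j] Suc by (auto simp: vecs_def)
  qed
  then show ?thesis by (auto simp: Suc restr_def bdy_Suc fun_eq_iff)
qed simp

lemma layer_le: "layer T a \<subseteq> {..a}"
  by (auto simp: layer_def)

text \<open>Generators outside the layer are strictly below \<open>a\<close> at some
  \<open>t\<close> in \<open>T\<close>, and the differential only lowers degrees, so they never
  reach the layer: multiples of the variables in \<open>T\<close> form a subcomplex.\<close>

lemma restr_bdy_restr:
  assumes "v \<in> vecs i {..a}"
  shows "restr (i - Suc 0) (layer T a) (bdy i (restr i (layer T a) v)) = restr (i - Suc 0) (layer T a) (bdy i v)"
proof -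
  have "restr (i - Suc 0) (layer T a) (bdy i (v - restr i (layer T a) v)) = 0"
  proof (rule restr_bdy_eq_0[OF diff_restr_vecs[OF assms]])
    fix c c' assume c: "c \<in> {..a} - layer T a" "c' \<in> layer T a"
    then obtain t where t: "t \<in> T" "c t \<noteq> a t" by (auto simp: layer_def)
    have "c t \<le> a t" "c' t = a t" using c t by (auto simp: layer_def le_fun_def)
    then show "\<not> c' \<le> c" using t(2) le_funD[of c' c t] by auto
  qed
  then show ?thesis unfolding bdy_diff restr_diff right_minus_eq by (rule sym)
qed

end

text \<open>Exactness is asked at positive indices only, as the homology at \<open>0\<close> is the
  resolved module. Between generators of equal degree a coefficient multiplies the monomial
  \<open>1\<close>, so \<open>minimal\<close> excludes unit entries from the matrices.\<close>

locale multigraded_exact_complex = multigraded_complex b dg D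
  for b :: "nat \<Rightarrow> nat" and dg :: "nat \<Rightarrow> nat \<Rightarrow> 'n::finite \<Rightarrow> nat" and D :: "nat \<Rightarrow> nat \<Rightarrow> nat \<Rightarrow> 'k::field" +
  assumes bdy_bdy: "w \<in> vecs (Suc i) {..a} \<Longrightarrow> bdy i (bdy (Suc i) w) = 0"
    and exact: "v \<in> vecs (Suc i) {..a} \<Longrightarrow> bdy (Suc i) v = 0 \<Longrightarrow>
      \<exists>w\<in>vecs (Suc (Suc i)) {..a}. bdy (Suc (Suc i)) w = v"
    and minimal: "l < b i \<Longrightarrow> j < b (Suc i) \<Longrightarrow> dg i l = dg (Suc i) j \<Longrightarrow> D i l j = 0"
begin

definition cycles :: "'n set \<Rightarrow> ('n \<Rightarrow> nat) \<Rightarrow> nat \<Rightarrow> (nat \<Rightarrow> 'k) set"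
  where "cycles T a i = {z \<in> vecs i (layer T a). restr (i - Suc 0) (layer T a) (bdy i z) = 0}"

definition boundaries :: "'n set \<Rightarrow> ('n \<Rightarrow> nat) \<Rightarrow> nat \<Rightarrow> (nat \<Rightarrow> 'k) set"
  where "boundaries T a i = (\<lambda>w. restr i (layer T a) (bdy (Suc i) w)) ` vecs (Suc i) (layer T a)"

lemma layer_vecs_le: "v \<in> vecs i (layer T a) \<Longrightarrow> v \<in> vecs i {..a}"
  by (rule vecs_mono[OF _ layer_le])

lemma boundary_cycle:
  assumes "w \<in> vecs (Suc i) (layer T a)"
  shows "restr (i - Suc 0) (layer T a) (bdy i (restr i (layer T a) (bdy (Suc i) w))) = 0"
  using restr_bdy_restr[OF bdy_vecs[OF layer_vecs_le[OF assms]], of T]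
  by (simp only: bdy_bdy[OF layer_vecs_le[OF assms]] restr_zero)

lemma restr_bdy_vecs:
  "w \<in> vecs (Suc i) (layer T a) \<Longrightarrow> restr i (layer T a) (bdy (Suc i) w) \<in> vecs i (layer T a)"
  using restr_vecs[OF bdy_vecs[OF layer_vecs_le]] layer_le by (metis inf.absorb2)

lemma boundaries_sub_cycles:
  "w \<in> vecs (Suc i) (layer T a) \<Longrightarrow> restr i (layer T a) (bdy (Suc i) w) \<in> cycles T a i"
  by (simp add: cycles_def restr_bdy_vecs boundary_cycle)

lemma layer_insert: "layer (insert l T) a = {c \<in> layer T a. c l = a l}"
  by (auto simp: layer_def)

lemma layer_shift:
  assumes "l \<notin> T"
  shows "c \<in> layer T a \<longleftrightarrow> c \<in> layer T (a(l := Suc (a l))) \<and> c l < Suc (a l)"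
proof -
  have 1: "c x \<le> a x \<longleftrightarrow> c x \<le> (a(l := Suc (a l))) x \<and> (x = l \<longrightarrow> c l < Suc (a l))" for x
    by (cases "x = l") auto
  have "(\<forall>x. c x \<le> a x) \<longleftrightarrow> (\<forall>x. c x \<le> (a(l := Suc (a l))) x) \<and> c l < Suc (a l)"
    unfolding 1 by blast
  moreover have "(\<forall>t\<in>T. c t = (a(l := Suc (a l))) t) \<longleftrightarrow> (\<forall>t\<in>T. c t = a t)"
    using assms by auto
  ultimately show ?thesis unfolding layer_def le_fun_def mem_Collect_eq by blast
qed

text \<open>The exact sequence of multiplication by \<open>x_l\<close> in one degree: the generators
  visible in \<open>F^T\<close> at \<open>a + e_l\<close> split into \<open>layer T a\<close>, the
  multiples of \<open>x_l\<close>, and the layer of \<open>insert l T\<close>, the quotient.\<close>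

lemma layer_split:
  assumes "l \<notin> T"
  shows "layer T (a(l := Suc (a l))) - layer (insert l T) (a(l := Suc (a l))) = layer T a"
    and "layer (insert l T) (a(l := Suc (a l))) \<subseteq> layer T (a(l := Suc (a l)))"
    and "layer T a \<subseteq> layer T (a(l := Suc (a l)))"
proof -
  have "c \<in> layer (insert l T) (a(l := Suc (a l))) \<longleftrightarrow>
      c \<in> layer T (a(l := Suc (a l))) \<and> \<not> c l < Suc (a l)" for c
    using le_funD[of c "a(l := Suc (a l))" l] by (auto simp: layer_def)
  then show "layer T (a(l := Suc (a l))) - layer (insert l T) (a(l := Suc (a l))) = layer T a"
    unfolding set_eq_iff Diff_iff layer_shift[OF assms, of _ a] by blast
  show "layer (insert l T) (a(l := Suc (a l))) \<subseteq> layer T (a(l := Suc (a l)))"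
    by (auto simp: layer_insert)
  show "layer T a \<subseteq> layer T (a(l := Suc (a l)))"
    by (rule subsetI) (simp add: layer_shift[OF assms, of _ a])
qed

lemma lower_degree:
  assumes "a l \<noteq> 0"
  obtains a' where "a = a'(l := Suc (a' l))"
  using assms by (intro that[of "a(l := a l - 1)"]) simp

end

section \<open>Vanishing of homology and transport of socle classes\<close>

context multigraded_exact_complex begin

lemma vecs_empty: "v \<in> vecs i {} \<longleftrightarrow> v = 0"
  by (auto simp: vecs_def fun_eq_iff)

text \<open>In the long exact sequence the homology of \<open>F^(T+l)\<close> at \<open>i\<close>
  lies between that of \<open>F^T\<close> at \<open>i\<close> and at \<open>i - 1\<close>; both
  vanish by induction, which starts from exactness.\<close>

theorem acyclic:
  assumes "finite T" "card T < i" "z \<in> cycles T a i"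
  shows "z \<in> boundaries T a i"
  using assms
proof (induction T arbitrary: i z a rule: finite_induct)
  case empty
  then obtain i' where i: "i = Suc i'" by (cases i) auto
  have z: "z \<in> vecs i {..a}" "restr i' {..a} (bdy i z) = 0"
    using empty i by (auto simp: cycles_def layer_def atMost_def)
  then have "bdy i z = 0"
    using restr_id[OF bdy_vecs, of z i' a "{..a}"] i by simp
  then obtain w where w: "w \<in> vecs (Suc i) {..a}" "bdy (Suc i) w = z"
    using exact z i by blast
  then show ?case
    using restr_id[of z i "{..a}" "{..a}"] z(1)
    by (auto simp: boundaries_def layer_def atMost_def intro!: image_eqI[of _ _ w])
next
  case (insert l T)
  define E where "E = layer (insert l T) a"
  have E: "E \<subseteq> layer T a" by (auto simp: E_def layer_def)
  have z: "z \<in> vecs i E" "restr (i - Suc 0) E (bdy i z) = 0" using insert.prems by (auto simp: cycles_def E_def)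
  have zT: "z \<in> vecs i (layer T a)" using vecs_mono[OF z(1) E] .
  obtain i' where i: "i = Suc i'" using insert.prems by (cases i) auto
  \<comment> \<open>The connecting image of \<open>z\<close>: a cycle one index lower without part
    in \<open>E\<close>, hence a multiple of \<open>x_l\<close>.\<close>
  define q where "q = restr i' (layer T a) (bdy i z)"
  have q: "q \<in> cycles T a i'" using boundaries_sub_cycles zT by (simp add: q_def i)
  have qE: "restr i' E q = 0"
    using z(2) E by (simp add: q_def i restr_restr inf_absorb1)
  have qv: "q \<in> vecs i' (layer T a - E)"
    using diff_restr_vecs[of q i' "layer T a" E] q qE by (simp add: cycles_def)
  have "\<exists>w \<in> vecs i (layer T a - E). restr i' (layer T a) (bdy i w) = q"
  proof (cases "a l = 0")
    case True
    \<comment> \<open>There is no degree \<open>a - e_l\<close>, so nothing in degree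
      \<open>a\<close> is a multiple of \<open>x_l\<close>.\<close>
    then have "layer T a - E = {}" by (auto simp: E_def layer_def le_fun_def) (metis le_zero_eq)
    then have "q = 0" using qv by (simp only: vecs_empty)
    then show ?thesis by (intro bexI[of _ 0]) (auto simp: vecs_def)
  next
    case False
    obtain a' where a': "a = a'(l := Suc (a' l))" using lower_degree[of a l] False by blast
    have L: "layer T a - E = layer T a'" unfolding E_def a' by (rule layer_split(1)[OF insert.hyps(2)])
    have "layer T a' \<subseteq> layer T a" using L by auto
    have "restr (i' - Suc 0) (layer T a') (restr (i' - Suc 0) (layer T a) (bdy i' q)) = 0"
      using q by (simp add: cycles_def)
    then have "restr (i' - Suc 0) (layer T a') (bdy i' q) = 0"
      using \<open>layer T a' \<subseteq> layer T a\<close> by (simp add: restr_restr inf_absorb1)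
    then have "q \<in> cycles T a' i'" using qv L by (simp add: cycles_def)
    moreover have "card T < i'" using insert.prems insert.hyps i by simp
    ultimately have "q \<in> boundaries T a' i'" using insert.IH by blast
    then obtain w where w: "w \<in> vecs i (layer T a')" "q = restr i' (layer T a') (bdy i w)"
      unfolding boundaries_def i by blast
    have "w \<in> vecs (Suc i') {..a'}" using w(1) layer_vecs_le i by blast
    then have "bdy i w \<in> vecs i' {..a'}" using bdy_vecs i by blast
    \<comment> \<open>\<open>bdy i w\<close> stays below \<open>a'\<close>, where the two layers
      agree, so \<open>w\<close> bounds \<open>q\<close> in degree \<open>a\<close> as well.\<close>
    moreover have "c \<in> layer T a' \<longleftrightarrow> c \<in> layer T a" if "c \<le> a'" for c
      using that insert.hyps(2) by (auto simp: layer_def a' le_fun_def intro: le_SucI)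
    ultimately have "restr i' (layer T a) (bdy i w) = q"
      unfolding w(2) by (auto simp: restr_def vecs_def fun_eq_iff)
    then show ?thesis using w(1) L by auto
  qed
  then obtain w where w: "w \<in> vecs i (layer T a - E)" "restr i' (layer T a) (bdy i w) = q" by blast
  \<comment> \<open>Subtracting \<open>w\<close> turns \<open>z\<close> into a cycle of
    \<open>F^T\<close> without changing its part in \<open>E\<close>.\<close>
  have "z - w \<in> cycles T a i"
    using zT w vecs_mono[OF w(1), of "layer T a"]
    by (auto simp: cycles_def vecs_diff bdy_diff restr_diff i q_def)
  then have "z - w \<in> boundaries T a i" by (rule insert.IH[rotated]) (use insert.prems insert.hyps in simp)
  then obtain y where y: "y \<in> vecs (Suc i) (layer T a)" "z - w = restr i (layer T a) (bdy (Suc i) y)"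
    unfolding boundaries_def by blast
  have "restr i E w = 0" by (rule restr_disjoint[OF w(1)]) blast
  moreover have "restr i E z = z" by (rule restr_id[OF z(1)]) simp
  ultimately have "z = restr i E (z - w)" by (simp only: restr_diff diff_zero)
  also have "\<dots> = restr i E (bdy (Suc i) y)" using E by (simp add: y(2) restr_restr inf_absorb1)
  also have "\<dots> = restr i E (bdy (Suc i) (restr (Suc i) E y))"
    using restr_bdy_restr[OF layer_vecs_le[OF y(1)], of "insert l T"] by (simp add: E_def)
  finally have "z = restr i E (bdy (Suc i) (restr (Suc i) E y))" .
  moreover have "restr (Suc i) E y \<in> vecs (Suc i) E"
    using restr_vecs[OF y(1), of E] E by (simp add: inf_absorb2)
  ultimately show ?case unfolding boundaries_def E_def by blast
qed

text \<open>A nonzero class in the homology of \<open>F^T\<close> at index \<open>|T|\<close> killed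
  by all variables: \<open>x_m z\<close> is the same vector read in degree \<open>a + e_m\<close>.
  Variables in \<open>T\<close> act as zero on \<open>F^T\<close>, so only \<open>m\<close> outside
  \<open>T\<close> is tested.\<close>

definition socle_class :: "'n set \<Rightarrow> ('n \<Rightarrow> nat) \<Rightarrow> bool"
  where "socle_class T a \<longleftrightarrow> (\<exists>z. z \<in> cycles T a (card T) \<and> z \<notin> boundaries T a (card T) \<and>
    (\<forall>m. m \<notin> T \<longrightarrow> z \<in> boundaries T (a(m := Suc (a m))) (card T)))"

lemma boundaries_iff:
  "z \<in> boundaries T a i \<longleftrightarrow> (\<exists>w\<in>vecs (Suc i) (layer T a). z = restr i (layer T a) (bdy (Suc i) w))"
  by (auto simp: boundaries_def)

text \<open>The boundary of \<open>w\<close> lives below \<open>a\<close>, where the layers of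
  \<open>a\<close> and \<open>a + e_l\<close> coincide: multiplication by \<open>x_l\<close>
  commutes with the differential.\<close>

lemma restr_layer_bdy_shift:
  assumes "l \<notin> T" "w \<in> vecs (Suc i) (layer T a)"
  shows "restr i (layer T (a(l := Suc (a l)))) (bdy (Suc i) w) = restr i (layer T a) (bdy (Suc i) w)"
proof -
  have "bdy (Suc i) w \<in> vecs i {..a}" using bdy_vecs assms(2) layer_vecs_le by blast
  moreover have "c \<in> layer T (a(l := Suc (a l))) \<longleftrightarrow> c \<in> layer T a" if "c \<le> a" for c
    using that assms(1) by (auto simp: layer_def le_fun_def intro: le_SucI)
  ultimately show ?thesis by (auto simp: restr_def vecs_def fun_eq_iff)
qed

lemma restr_bdy_insert:
  assumes "w \<in> vecs i (layer T a)"
  shows "restr (i - Suc 0) (layer (insert l T) a) (bdy i (restr i (layer (insert l T) a) w))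
    = restr (i - Suc 0) (layer (insert l T) a) (restr (i - Suc 0) (layer T a) (bdy i w))"
proof -
  have "layer (insert l T) a \<subseteq> layer T a" by (auto simp: layer_def)
  then show ?thesis
    using restr_bdy_restr[OF layer_vecs_le[OF assms], of "insert l T"] by (simp add: restr_restr inf_absorb1)
qed

lemma restr_insert_vecs:
  assumes "w \<in> vecs i (layer T a)"
  shows "restr i (layer (insert l T) a) w \<in> vecs i (layer (insert l T) a)"
  using restr_vecs[OF assms, of "layer (insert l T) a"] by (rule vecs_mono) auto

text \<open>The next two lemmas are the two directions of the connecting homomorphism of the short exact
  sequence formed by the layers \<open>layer T a\<close>, \<open>layer T (a + e\<^sub>l)\<close> and \<open>layer (insert l T) (a + e\<^sub>l)\<close>.\<close>

lemma socle_class_insert: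
  assumes T: "finite T" "l \<notin> T" and soc: "socle_class T a"
  shows "socle_class (insert l T) (a(l := Suc (a l)))"
proof -
  let ?a = "a(l := Suc (a l))" and ?t = "card T"
  let ?E = "layer (insert l T) ?a"
  have card: "card (insert l T) = Suc ?t" using T by simp
  have sub: "?E \<subseteq> layer T ?a" by (auto simp: layer_def)
  obtain z where z: "z \<in> cycles T a ?t" "z \<notin> boundaries T a ?t"
    and soc: "\<And>m. m \<notin> T \<Longrightarrow> z \<in> boundaries T (a(m := Suc (a m))) ?t"
    using assms by (auto simp: socle_class_def)
  \<comment> \<open>As \<open>x_l\<close> kills \<open>z\<close>, some \<open>w\<close> in degree
    \<open>a + e_l\<close> has boundary \<open>z\<close>; its image in \<open>F^(T+l)\<close> is a
    cycle with connecting image \<open>z\<close>.\<close>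
  obtain w where w: "w \<in> vecs (Suc ?t) (layer T ?a)" "z = restr ?t (layer T ?a) (bdy (Suc ?t) w)"
    using soc[OF T(2)] unfolding boundaries_iff by blast
  define z' where "z' = restr (Suc ?t) ?E w"
  have z'v: "z' \<in> vecs (Suc ?t) ?E" unfolding z'_def using restr_insert_vecs w(1) by blast
  have zv: "z \<in> vecs ?t (layer T a)" using z(1) by (simp add: cycles_def)
  have "restr ?t ?E z = 0"
    using layer_split(1)[OF T(2), of a] by (intro restr_disjoint[OF zv]) blast
  then have z'cyc: "z' \<in> cycles (insert l T) ?a (Suc ?t)"
    using z'v restr_bdy_insert[OF w(1), of l] w(2) by (simp add: cycles_def z'_def)
  \<comment> \<open>If \<open>z'\<close> were the boundary of \<open>y\<close>, then
    \<open>w\<close> minus that boundary would be a multiple of \<open>x_l\<close>, and dividing by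
    \<open>x_l\<close> would make \<open>z\<close> a boundary.\<close>
  have notbd: "z' \<notin> boundaries (insert l T) ?a (Suc ?t)"
  proof
    assume "z' \<in> boundaries (insert l T) ?a (Suc ?t)"
    then obtain y where y: "y \<in> vecs (Suc (Suc ?t)) ?E" "z' = restr (Suc ?t) ?E (bdy (Suc (Suc ?t)) y)"
      unfolding boundaries_iff by blast
    have yT: "y \<in> vecs (Suc (Suc ?t)) (layer T ?a)" using vecs_mono[OF y(1) sub] .
    define w' where "w' = w - restr (Suc ?t) (layer T ?a) (bdy (Suc (Suc ?t)) y)"
    have "w' \<in> vecs (Suc ?t) (layer T ?a - ?E)"
      unfolding w'_def
    proof (rule vecs_diff_restrict[OF w(1) restr_bdy_vecs[OF yT]])
      show "restr (Suc ?t) ?E w = restr (Suc ?t) ?E (restr (Suc ?t) (layer T ?a) (bdy (Suc (Suc ?t)) y))"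
        using y(2) sub by (simp add: restr_restr inf_absorb1 z'_def)
    qed
    then have w'v: "w' \<in> vecs (Suc ?t) (layer T a)" using layer_split(1)[OF T(2), of a] by simp
    have "restr ?t (layer T ?a) (bdy (Suc ?t) w') = z"
      using boundary_cycle[OF yT] by (simp add: w'_def bdy_diff restr_diff w(2))
    then have "z = restr ?t (layer T a) (bdy (Suc ?t) w')"
      using restr_layer_bdy_shift[OF T(2) w'v] by simp
    then show False using z(2) w'v unfolding boundaries_iff by blast
  qed
  \<comment> \<open>Both \<open>w\<close> and the vector \<open>v\<close> bounding
    \<open>x_m z\<close> also bound \<open>x_l x_m z\<close>, so they differ by a cycle of
    \<open>F^T\<close> at index \<open>|T|+1\<close>, a boundary by \<open>acyclic\<close>. Modulo
    \<open>x_l\<close> the vector \<open>v\<close> disappears and \<open>z'\<close> is left.\<close>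
  have "z' \<in> boundaries (insert l T) (?a(m := Suc (?a m))) (Suc ?t)" if m: "m \<notin> insert l T" for m
  proof -
    let ?am = "a(m := Suc (a m))" and ?A = "?a(m := Suc (?a m))"
    have ml: "m \<noteq> l" "m \<notin> T" using m by auto
    have A: "?A = ?am(l := Suc (?am l))" using ml by (auto simp: fun_eq_iff)
    obtain v where v: "v \<in> vecs (Suc ?t) (layer T ?am)" "z = restr ?t (layer T ?am) (bdy (Suc ?t) v)"
      using soc[OF ml(2)] unfolding boundaries_iff by blast
    have s1: "layer T ?a \<subseteq> layer T ?A" by (rule layer_split(3)[OF ml(2)])
    have s2: "layer T ?am \<subseteq> layer T ?A" unfolding A by (rule layer_split(3)[OF T(2)])
    have wA: "w \<in> vecs (Suc ?t) (layer T ?A)" and vA: "v \<in> vecs (Suc ?t) (layer T ?A)"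
      using vecs_mono[OF w(1) s1] vecs_mono[OF v(1) s2] .
    have "restr ?t (layer T ?A) (bdy (Suc ?t) w) = z"
      using restr_layer_bdy_shift[OF ml(2) w(1)] w(2) by simp
    moreover have "restr ?t (layer T ?A) (bdy (Suc ?t) v) = z"
      using restr_layer_bdy_shift[OF T(2) v(1)] v(2) unfolding A by simp
    ultimately have "w - v \<in> cycles T ?A (Suc ?t)"
      using wA vA by (simp add: cycles_def vecs_diff bdy_diff restr_diff)
    then have "w - v \<in> boundaries T ?A (Suc ?t)" using acyclic T(1) by simp
    then obtain y where y: "y \<in> vecs (Suc (Suc ?t)) (layer T ?A)"
      "w - v = restr (Suc ?t) (layer T ?A) (bdy (Suc (Suc ?t)) y)"
      unfolding boundaries_iff by blast
    let ?EA = "layer (insert l T) ?A"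
    have "restr (Suc ?t) ?EA v = 0"
      using layer_split(1)[OF T(2), of ?am] unfolding A by (intro restr_disjoint[OF v(1)]) blast
    moreover have "restr (Suc ?t) ?EA w = z'"
    proof -
      have "c \<in> ?EA \<longleftrightarrow> c \<in> ?E" if "c \<in> layer T ?a" for c
        using that ml by (auto simp: layer_def le_fun_def) (metis le_SucI)
      then show ?thesis using w(1) by (auto simp: z'_def restr_def vecs_def fun_eq_iff)
    qed
    ultimately have "z' = restr (Suc ?t) ?EA (w - v)" by (simp only: restr_diff diff_zero)
    also have "\<dots> = restr (Suc ?t) ?EA (bdy (Suc (Suc ?t)) (restr (Suc (Suc ?t)) ?EA y))"
      using restr_bdy_insert[OF y(1), of l] y(2) by simp
    finally show ?thesis unfolding boundaries_iff using restr_insert_vecs[OF y(1)] by blast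
  qed
  then show ?thesis using z'cyc notbd unfolding socle_class_def card by blast
qed

lemma socle_class_remove:
  assumes T: "finite T" "l \<notin> T" and soc: "socle_class (insert l T) a'"
  obtains a where "a' = a(l := Suc (a l))" "socle_class T a"
proof -
  let ?t = "card T" and ?E = "layer (insert l T) a'"
  have card: "card (insert l T) = Suc ?t" using T by simp
  have sub: "?E \<subseteq> layer T a'" by (auto simp: layer_def)
  obtain z' where z': "z' \<in> cycles (insert l T) a' (Suc ?t)" "z' \<notin> boundaries (insert l T) a' (Suc ?t)"
    and soc: "\<And>m. m \<notin> insert l T \<Longrightarrow> z' \<in> boundaries (insert l T) (a'(m := Suc (a' m))) (Suc ?t)"
    using soc unfolding socle_class_def card by blast
  have z'v: "z' \<in> vecs (Suc ?t) ?E" and z'T: "z' \<in> vecs (Suc ?t) (layer T a')"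
    using z'(1) vecs_mono[OF _ sub] by (auto simp: cycles_def)
  \<comment> \<open>The connecting image of \<open>z'\<close>, to be shown a socle class of
    \<open>F^T\<close>.\<close>
  define z where "z = restr ?t (layer T a') (bdy (Suc ?t) z')"
  have zv: "z \<in> vecs ?t (layer T a' - ?E)"
  proof -
    have "z \<in> vecs ?t (layer T a')" using restr_bdy_vecs[OF z'T] by (simp add: z_def)
    moreover have "restr ?t ?E z = 0" using z'(1) sub by (simp add: z_def cycles_def restr_restr inf_absorb1)
    ultimately show ?thesis using diff_restr_vecs[of z ?t "layer T a'" ?E] by simp
  qed
  \<comment> \<open>Injectivity of the connecting map: with a multiple \<open>y\<close> of
    \<open>x_l\<close> having the same boundary \<open>z\<close>, the cycle \<open>z' - y\<close> of
    \<open>F^T\<close> would be a boundary by \<open>acyclic\<close>, and \<open>z'\<close> one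
    modulo \<open>x_l\<close>. It is applied to \<open>y = 0\<close> and to a \<open>y\<close>
    bounding \<open>z\<close>.\<close>
  have lift: False if "y \<in> vecs (Suc ?t) (layer T a' - ?E)" "restr ?t (layer T a') (bdy (Suc ?t) y) = z" for y
  proof -
    have "y \<in> vecs (Suc ?t) (layer T a')" using vecs_mono[OF that(1)] by blast
    then have "z' - y \<in> cycles T a' (Suc ?t)"
      using z'T that(2) by (simp add: cycles_def vecs_diff bdy_diff restr_diff z_def)
    then have "z' - y \<in> boundaries T a' (Suc ?t)" using acyclic T(1) by simp
    then obtain x where x: "x \<in> vecs (Suc (Suc ?t)) (layer T a')"
      "z' - y = restr (Suc ?t) (layer T a') (bdy (Suc (Suc ?t)) x)"
      unfolding boundaries_iff by blast
    have "restr (Suc ?t) ?E y = 0" by (rule restr_disjoint[OF that(1)]) blast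
    moreover have "restr (Suc ?t) ?E z' = z'" by (rule restr_id[OF z'v]) simp
    ultimately have "z' = restr (Suc ?t) ?E (z' - y)" by (simp only: restr_diff diff_zero)
    also have "\<dots> = restr (Suc ?t) ?E (bdy (Suc (Suc ?t)) (restr (Suc (Suc ?t)) ?E x))"
      using restr_bdy_insert[OF x(1), of l] x(2) by simp
    finally show False using z'(2) restr_insert_vecs[OF x(1), of l] unfolding boundaries_iff by blast
  qed
  have "a' l \<noteq> 0"
  proof
    assume "a' l = 0"
    then have "layer T a' - ?E = {}" by (auto simp: layer_def le_fun_def) (metis le_zero_eq)
    then have "z = 0" using zv by (simp only: vecs_empty)
    then show False using lift[of 0] by (auto simp: vecs_def)
  qed
  then obtain a where a: "a' = a(l := Suc (a l))" using lower_degree[of a' l] by blast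
  have L: "layer T a' - ?E = layer T a" unfolding a by (rule layer_split(1)[OF T(2)])
  have sub': "layer T a \<subseteq> layer T a'" using L by auto
  have "z \<in> cycles T a ?t"
  proof -
    have "restr (?t - Suc 0) (layer T a') (bdy ?t z) = 0"
      unfolding z_def by (rule boundary_cycle[OF z'T])
    then have "restr (?t - Suc 0) (layer T a) (restr (?t - Suc 0) (layer T a') (bdy ?t z)) = 0" by simp
    then show ?thesis using zv sub' by (simp add: cycles_def L restr_restr inf_absorb1)
  qed
  moreover have "z \<notin> boundaries T a ?t"
  proof
    assume "z \<in> boundaries T a ?t"
    then obtain w where w: "w \<in> vecs (Suc ?t) (layer T a)" "z = restr ?t (layer T a) (bdy (Suc ?t) w)"
      unfolding boundaries_iff by blast
    then show False using lift[of w] restr_layer_bdy_shift[OF T(2) w(1)] L unfolding a by simp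
  qed
  moreover have "z \<in> boundaries T (a(m := Suc (a m))) ?t" if m: "m \<notin> T" for m
  proof (cases "m = l")
    case True
    \<comment> \<open>\<open>z'\<close> itself bounds \<open>x_l z\<close>.\<close>
    then show ?thesis using z'T unfolding boundaries_iff z_def a by blast
  next
    case False
    let ?am = "a(m := Suc (a m))" and ?A = "a'(m := Suc (a' m))"
    have A: "?A = ?am(l := Suc (?am l))" using False unfolding a by (auto simp: fun_eq_iff)
    let ?EA = "layer (insert l T) ?A"
    have "z' \<in> boundaries (insert l T) ?A (Suc ?t)" using soc m False by blast
    then obtain y where y: "y \<in> vecs (Suc (Suc ?t)) ?EA" "z' = restr (Suc ?t) ?EA (bdy (Suc (Suc ?t)) y)"
      unfolding boundaries_iff by blast
    have subA: "?EA \<subseteq> layer T ?A" by (auto simp: layer_def)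
    have yT: "y \<in> vecs (Suc (Suc ?t)) (layer T ?A)" using vecs_mono[OF y(1) subA] .
    have z'A: "z' \<in> vecs (Suc ?t) (layer T ?A)"
      using vecs_mono[OF z'T layer_split(3)[OF m]] .
    \<comment> \<open>In \<open>F^(T+l)\<close> the vector \<open>x_m z'\<close> is the boundary of
      \<open>y\<close>. Removing that boundary leaves a multiple of \<open>x_l\<close>, which bounds
      \<open>x_m z\<close> after division by \<open>x_l\<close>.\<close>
    define v where "v = z' - restr (Suc ?t) (layer T ?A) (bdy (Suc (Suc ?t)) y)"
    have "v \<in> vecs (Suc ?t) (layer T ?A - ?EA)"
      unfolding v_def
    proof (rule vecs_diff_restrict[OF z'A restr_bdy_vecs[OF yT]])
      have "restr (Suc ?t) ?EA z' = z'"
        by (subst y(2), subst restr_restr) (simp add: y(2)[symmetric])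
      then show "restr (Suc ?t) ?EA z' = restr (Suc ?t) ?EA (restr (Suc ?t) (layer T ?A) (bdy (Suc (Suc ?t)) y))"
        using y(2) subA by (simp add: restr_restr inf_absorb1)
    qed
    then have vv: "v \<in> vecs (Suc ?t) (layer T ?am)"
      using layer_split(1)[OF T(2), of ?am] unfolding A by simp
    have "restr ?t (layer T ?A) (bdy (Suc ?t) v) = restr ?t (layer T ?A) (bdy (Suc ?t) z')"
      using boundary_cycle[OF yT] by (simp add: v_def bdy_diff restr_diff)
    also have "\<dots> = z" using restr_layer_bdy_shift[OF m z'T] by (simp add: z_def)
    finally have "z = restr ?t (layer T ?am) (bdy (Suc ?t) v)"
      using restr_layer_bdy_shift[OF T(2) vv] unfolding A by simp
    then show ?thesis using vv unfolding boundaries_iff by blast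
  qed
  ultimately show ?thesis using that a unfolding socle_class_def by blast
qed

section \<open>The quotient by all variables: vanishing and size of the ranks\<close>

lemma layer_UNIV: "layer UNIV a = {a}"
  by (auto simp: layer_def fun_eq_iff)

lemma restr_bdy_minimal:
  assumes "v \<in> vecs i {a}" shows "restr (i - Suc 0) {a} (bdy i v) = 0"
proof (cases i)
  case (Suc i')
  have "(\<Sum>j<b i. D i' l j * v j) = 0" if "l < b i'" "dg i' l = a" for l
  proof (rule sum.neutral, rule ballI)
    fix j assume "j \<in> {..<b i}"
    then show "D i' l j * v j = 0"
      using minimal[of l i' j] that assms Suc by (auto simp: vecs_def)
  qed
  then show ?thesis by (auto simp: Suc restr_def bdy_Suc fun_eq_iff)
qed simp

lemma cycles_UNIV: "cycles UNIV a i = vecs i {a}"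
  using restr_bdy_minimal by (auto simp: cycles_def layer_UNIV)

lemma boundaries_UNIV: "z \<in> boundaries UNIV a i \<longleftrightarrow> z = 0"
proof -
  have "(0 :: nat \<Rightarrow> 'k) \<in> vecs (Suc i) {a}" by (simp add: vecs_def)
  then show ?thesis using restr_bdy_minimal[of _ "Suc i" a]
    unfolding boundaries_iff layer_UNIV by auto
qed

lemma basis_vector:
  assumes "j < b i"
  shows "(\<lambda>l. if l = j then 1 else 0) \<in> vecs i {dg i j}" "(\<lambda>l. if l = j then 1 else 0) \<noteq> (0 :: nat \<Rightarrow> 'k)"
  using assms by (auto simp: vecs_def fun_eq_iff)

text \<open>The bound of Hilbert's syzygy theorem: modulo all variables a generator above index
  \<open>n\<close> is a cycle, hence a boundary by \<open>acyclic\<close>, but zero is the only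
  boundary.\<close>

theorem rank_eq_0:
  assumes "CARD('n) < i" shows "b i = 0"
proof (rule ccontr)
  assume "b i \<noteq> 0"
  then have "0 < b i" by simp
  note e = basis_vector[OF this]
  show False
    using acyclic[of UNIV i "\<lambda>l. if l = 0 then 1 else 0" "dg i 0"] e assms
    unfolding cycles_UNIV boundaries_UNIV by simp
qed

text \<open>For the full set \<open>T\<close> no variable remains to be tested, so any basis vector
  is a socle class; the variables are then removed one by one.\<close>

theorem socle_class_if_top_rank:
  assumes "0 < b CARD('n)" shows "\<exists>a. socle_class {} a"
proof -
  have "socle_class UNIV (dg CARD('n) 0)"
    using basis_vector[OF assms] unfolding socle_class_def cycles_UNIV boundaries_UNIV by auto
  moreover have "\<exists>a. socle_class {} a" if "socle_class T a" "finite T" for T a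
    using that(2,1)
  proof (induction T arbitrary: a rule: finite_induct)
    case (insert l T)
    then show ?case by (meson socle_class_remove)
  qed blast
  ultimately show ?thesis by simp
qed

lemma socle_class_spread:
  assumes "finite T" "socle_class {} u"
  shows "socle_class T (\<lambda>x. if x \<in> T then Suc (u x) else u x)"
  using assms(1)
proof (induction T rule: finite_induct)
  case (insert l T)
  have "(\<lambda>x. if x \<in> insert l T then Suc (u x) else u x)
      = (\<lambda>x. if x \<in> T then Suc (u x) else u x)(l := Suc ((\<lambda>x. if x \<in> T then Suc (u x) else u x) l))"
    using insert.hyps by (auto simp: fun_eq_iff)
  then show ?case using socle_class_insert[OF insert.hyps insert.IH] by simp
qed (simp add: assms(2))

theorem choose_le_rank:
  assumes "socle_class {} u" shows "CARD('n) choose i \<le> b i"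
proof -
  have "\<exists>j<b i. T = {x. dg i j x = Suc (u x)}" if T: "card T = i" for T
  proof -
    let ?a = "\<lambda>x. if x \<in> T then Suc (u x) else u x"
    have "socle_class T ?a" using socle_class_spread[OF _ assms] by simp
    then obtain z where z: "z \<in> vecs i (layer T ?a)" "z \<notin> boundaries T ?a i"
      unfolding socle_class_def cycles_def T by blast
    have "z \<noteq> 0"
    proof
      assume "z = 0"
      moreover have "0 \<in> boundaries T ?a i"
        unfolding boundaries_iff by (rule bexI[of _ 0]) (auto simp: vecs_def)
      ultimately show False using z(2) by simp
    qed
    \<comment> \<open>A vector that is not a boundary involves some generator, whose degree must lie
      in the layer.\<close>
    then obtain j where j: "z j \<noteq> 0" by (auto simp: fun_eq_iff)
    then have "j < b i" "dg i j \<in> layer T ?a" using z(1) by (auto simp: vecs_def)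
    moreover have "T = {x. c x = Suc (u x)}" if "c \<in> layer T ?a" for c
    proof -
      have "c x \<le> ?a x" "x \<in> T \<Longrightarrow> c x = ?a x" for x
        using that by (auto simp: layer_def le_fun_def)
      then show ?thesis by (fastforce split: if_splits)
    qed
    ultimately show ?thesis by blast
  qed
  then have "{T. T \<subseteq> UNIV \<and> card T = i} \<subseteq> (\<lambda>j. {x. dg i j x = Suc (u x)}) ` {..<b i}" by auto
  then have "card {T :: 'n set. T \<subseteq> UNIV \<and> card T = i} \<le> card {..<b i}"
    by (rule surj_card_le[rotated]) simp
  then show ?thesis by (simp add: n_subsets[of "UNIV :: 'n set" i, simplified])
qed

end

section \<open>Existence of the resolution\<close>

text \<open>A set \<open>B0\<close> that serves \<open>K\<close> also serves all points whose
  coordinate \<open>l\<close> reaches the maximum \<open>N\<close> over \<open>B0\<close>. Below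
  \<open>N\<close> there are finitely many slices with constant coordinate \<open>l\<close>, each
  served by induction.\<close>

lemma dickson_coordinates:
  fixes A :: "('n \<Rightarrow> nat) set"
  assumes "finite K"
  shows "\<exists>B\<subseteq>A. finite B \<and> (\<forall>a\<in>A. \<exists>b\<in>B. \<forall>k\<in>K. b k \<le> a k)"
  using assms
proof (induction K arbitrary: A rule: finite_induct)
  case empty
  show ?case
  proof (cases "A = {}")
    case False
    then obtain a where "a \<in> A" by blast
    then show ?thesis by (intro exI[of _ "{a}"]) auto
  qed auto
next
  case (insert l K)
  obtain B0 where B0: "B0 \<subseteq> A" "finite B0" "\<forall>a\<in>A. \<exists>b\<in>B0. \<forall>k\<in>K. b k \<le> a k"
    using insert.IH by meson
  have "\<forall>c. \<exists>B. B \<subseteq> {a \<in> A. a l = c} \<and> finite B \<and>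
      (\<forall>a\<in>{a \<in> A. a l = c}. \<exists>b\<in>B. \<forall>k\<in>K. b k \<le> a k)"
    by (rule allI, rule insert.IH)
  from choice[OF this] obtain B where B': "\<forall>c. B c \<subseteq> {a \<in> A. a l = c} \<and> finite (B c) \<and>
      (\<forall>a\<in>{a \<in> A. a l = c}. \<exists>b\<in>B c. \<forall>k\<in>K. b k \<le> a k)"
    by blast
  have B: "B c \<subseteq> {a \<in> A. a l = c}" "finite (B c)" for c
    using B' by blast+
  have B3: "\<exists>b\<in>B (a l). \<forall>k\<in>K. b k \<le> a k" if "a \<in> A" for a
    using B' that by blast
  \<comment> \<open>If \<open>B0\<close> is empty then so is \<open>A\<close>, and the unspecified
    maximum does no harm.\<close>
  define N where "N = Max ((\<lambda>b. b l) ` B0)"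
  have "\<exists>b\<in>B0 \<union> (\<Union>c<N. B c). \<forall>k\<in>insert l K. b k \<le> a k" if a: "a \<in> A" for a
  proof (cases "a l < N")
    case True
    obtain b where "b \<in> B (a l)" "\<forall>k\<in>K. b k \<le> a k" using B3[OF a] by blast
    then show ?thesis using True B(1)[of "a l"] by (intro bexI[of _ b]) auto
  next
    case False
    obtain b where b: "b \<in> B0" "\<forall>k\<in>K. b k \<le> a k" using B0(3) a by blast
    have "b l \<le> N" unfolding N_def using b(1) B0(2) by simp
    then show ?thesis using False b by (intro bexI[of _ b]) auto
  qed
  moreover have "B0 \<union> (\<Union>c<N. B c) \<subseteq> A" using B0(1) B(1) by blast
  moreover have "finite (B0 \<union> (\<Union>c<N. B c))" using B0(2) B(2) by simp
  ultimately show ?case by blast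
qed

corollary dickson:
  fixes A :: "('n::finite \<Rightarrow> nat) set"
  obtains B where "B \<subseteq> A" "finite B" "\<And>a. a \<in> A \<Longrightarrow> \<exists>b\<in>B. b \<le> a"
  using dickson_coordinates[of "UNIV :: 'n set" A] by (auto simp: le_fun_def)

text \<open>The degree parts of a multigraded submodule of a free module; \<open>mono\<close> is
  closure under multiplication by monomials. \<open>no_unit\<close> places the submodule inside the
  irrelevant ideal times the free module, the source of minimality.\<close>

locale subspace_family =
  fixes b :: nat and dg :: "nat \<Rightarrow> 'n::finite \<Rightarrow> nat" and W :: "('n \<Rightarrow> nat) \<Rightarrow> (nat \<Rightarrow> 'k::field) set"
  assumes supported: "v \<in> W a \<Longrightarrow> v j \<noteq> 0 \<Longrightarrow> j < b \<and> dg j \<le> a"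
    and zero_mem: "0 \<in> W a"
    and add_mem: "v \<in> W a \<Longrightarrow> w \<in> W a \<Longrightarrow> v + w \<in> W a"
    and scale_mem: "v \<in> W a \<Longrightarrow> (\<lambda>l. c * v l) \<in> W a"
    and mono: "v \<in> W a \<Longrightarrow> a \<le> a' \<Longrightarrow> v \<in> W a'"
    and no_unit: "v \<in> W a \<Longrightarrow> dg j = a \<Longrightarrow> v j = 0"
begin

definition generates :: "(('n \<Rightarrow> nat) \<times> (nat \<Rightarrow> 'k)) set \<Rightarrow> bool"
  where "generates H \<longleftrightarrow> finite H \<and> (\<forall>p\<in>H. snd p \<in> W (fst p)) \<and>
    (\<forall>a. \<forall>v\<in>W a. \<exists>c. v = (\<lambda>l. \<Sum>p\<in>{p \<in> H. fst p \<le> a}. c p * snd p l))"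

text \<open>In degree \<open>a\<close> exactly the generators of degree \<open>a\<close> are
  multiplied by constants, so this forbids relations with a unit coefficient: minimality in the
  sense of Nakayama's lemma.\<close>

definition irredundant :: "(('n \<Rightarrow> nat) \<times> (nat \<Rightarrow> 'k)) set \<Rightarrow> bool"
  where "irredundant H \<longleftrightarrow> (\<forall>a c. (\<forall>l. (\<Sum>p\<in>{p \<in> H. fst p \<le> a}. c p * snd p l) = 0) \<longrightarrow>
    (\<forall>p\<in>H. fst p = a \<longrightarrow> c p = 0))"

lemma sum_mem: "finite I \<Longrightarrow> (\<And>p. p \<in> I \<Longrightarrow> f p \<in> W a) \<Longrightarrow> (\<lambda>l. \<Sum>p\<in>I. c p * f p l) \<in> W a"
proof (induction I rule: finite_induct)
  case empty
  then show ?case using zero_mem by (simp add: zero_fun_def)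
next
  case (insert p I)
  have "(\<lambda>l. c p * f p l) + (\<lambda>l. \<Sum>p\<in>I. c p * f p l) \<in> W a"
    using insert by (intro add_mem scale_mem) auto
  then show ?case using insert.hyps by (simp add: plus_fun_def)
qed

text \<open>The initial degrees of vectors with a given last nonzero position form an upward closed set,
  so finitely many vectors suffice to clear that position.\<close>

lemma generates_exists: "\<exists>H. generates H"
proof -
  define A where "A q = {a. \<exists>v\<in>W a. v q \<noteq> 0 \<and> (\<forall>l>q. v l = 0)}" for q
  have "\<exists>B\<subseteq>A q. finite B \<and> (\<forall>a\<in>A q. \<exists>b\<in>B. b \<le> a)" for q
    by (rule dickson[of "A q"]) blast
  then obtain B where B: "\<And>q. B q \<subseteq> A q" "\<And>q. finite (B q)"
    "\<And>q a. a \<in> A q \<Longrightarrow> \<exists>b\<in>B q. b \<le> a"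
    by metis
  define g where "g q a = (SOME v. v \<in> W a \<and> v q \<noteq> 0 \<and> (\<forall>l>q. v l = 0))" for q a
  have "g q a \<in> W a \<and> g q a q \<noteq> 0 \<and> (\<forall>l>q. g q a l = 0)" if "a \<in> B q" for q a
  proof -
    have "\<exists>v. v \<in> W a \<and> v q \<noteq> 0 \<and> (\<forall>l>q. v l = 0)"
      using subsetD[OF B(1) that] by (simp add: A_def Bex_def)
    from someI_ex[OF this] show ?thesis unfolding g_def .
  qed
  then have g: "\<And>q a. a \<in> B q \<Longrightarrow> g q a \<in> W a" "\<And>q a. a \<in> B q \<Longrightarrow> g q a q \<noteq> 0"
    "\<And>q a l. a \<in> B q \<Longrightarrow> q < l \<Longrightarrow> g q a l = 0"
    by blast+
  define H where "H = (\<Union>q<b. (\<lambda>a. (a, g q a)) ` B q)"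
  have fin: "finite H" using B(2) by (simp add: H_def)
  \<comment> \<open>Division with respect to the last nonzero position, by induction on a bound
    \<open>q\<close> for the support.\<close>
  have "\<exists>c. v = (\<lambda>l. \<Sum>p\<in>{p \<in> H. fst p \<le> a}. c p * snd p l)"
    if "v \<in> W a" "\<And>l. q \<le> l \<Longrightarrow> v l = 0" "q \<le> b" for a v q
    using that
  proof (induction q arbitrary: v)
    case 0
    then show ?case by (intro exI[of _ "\<lambda>_. 0"]) auto
  next
    case (Suc q)
    show ?case
    proof (cases "v q = 0")
      case True
      have "v l = 0" if "q \<le> l" for l
        using Suc.prems(2)[of l] True that by (cases "l = q") auto
      then show ?thesis using Suc.IH[of v] Suc.prems by simp
    next
      case False
      then have "a \<in> A q" using Suc.prems unfolding A_def by auto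
      then obtain a' where a': "a' \<in> B q" "a' \<le> a" using B(3) by blast
      let ?g = "g q a'" and ?p = "(a', g q a')"
      define s where "s = v q / ?g q"
      have pH: "?p \<in> {p \<in> H. fst p \<le> a}" using a' Suc.prems(3) by (auto simp: H_def)
      have gW: "?g \<in> W a" using g(1)[OF a'(1)] mono a'(2) by blast
      define v' where "v' = v + (\<lambda>l. (- s) * ?g l)"
      have "v' \<in> W a" unfolding v'_def by (intro add_mem scale_mem gW Suc.prems)
      moreover have "v' l = 0" if "q \<le> l" for l
        using that g(2,3)[OF a'(1)] Suc.prems(2)[of l]
        by (cases "l = q") (auto simp: v'_def s_def)
      ultimately obtain c where c: "v' = (\<lambda>l. \<Sum>p\<in>{p \<in> H. fst p \<le> a}. c p * snd p l)"
        using Suc.IH[of v'] Suc.prems(3) by auto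
      have "v = (\<lambda>l. \<Sum>p\<in>{p \<in> H. fst p \<le> a}. (c p + (if p = ?p then s else 0)) * snd p l)"
      proof
        fix l
        have "(\<Sum>p\<in>{p \<in> H. fst p \<le> a}. (c p + (if p = ?p then s else 0)) * snd p l)
          = (\<Sum>p\<in>{p \<in> H. fst p \<le> a}. c p * snd p l) + (\<Sum>p\<in>{p \<in> H. fst p \<le> a}. if p = ?p then s * ?g l else 0)"
          unfolding sum.distrib[symmetric] by (intro sum.cong) (auto simp: distrib_right)
        also have "\<dots> = v' l + s * ?g l"
          using fin pH by (simp add: c sum.delta)
        finally show "v l = (\<Sum>p\<in>{p \<in> H. fst p \<le> a}. (c p + (if p = ?p then s else 0)) * snd p l)"
          by (simp add: v'_def)
      qed
      then show ?thesis by (rule exI[of _ "\<lambda>p. c p + (if p = ?p then s else 0)"])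
    qed
  qed
  note main = this
  have "v l = 0" if "v \<in> W a" "b \<le> l" for v a l using supported[OF that(1), of l] that(2) by auto
  then have "\<forall>a. \<forall>v\<in>W a. \<exists>c. v = (\<lambda>l. \<Sum>p\<in>{p \<in> H. fst p \<le> a}. c p * snd p l)"
    using main[of _ _ b] by blast
  moreover have "\<forall>p\<in>H. snd p \<in> W (fst p)" using g(1) by (auto simp: H_def)
  ultimately show ?thesis using fin unfolding generates_def by blast
qed

text \<open>A generating set of least cardinality is irredundant: a relation with a constant
  coefficient at \<open>p\<close> expresses \<open>p\<close> by the other generators.\<close>

lemma minimal_generators:
  obtains H where "generates H" "irredundant H"
proof -
  obtain H where H: "generates H" "\<And>H'. generates H' \<Longrightarrow> card H \<le> card H'"
    using generates_exists ex_has_least_nat[of generates _ card] by metis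
  have fin: "finite H" using H(1) by (simp add: generates_def)
  have "c p = 0" if rel: "\<forall>l. (\<Sum>p\<in>{p \<in> H. fst p \<le> a}. c p * snd p l) = 0" and p: "p \<in> H" "fst p = a" for a c p
  proof (rule ccontr)
    assume cp: "c p \<noteq> 0"
    have "\<exists>d. v = (\<lambda>l. \<Sum>r\<in>{r \<in> H - {p}. fst r \<le> a'}. d r * snd r l)" if v: "v \<in> W a'" for v a'
    proof -
      obtain d where d: "v = (\<lambda>l. \<Sum>r\<in>{r \<in> H. fst r \<le> a'}. d r * snd r l)"
        using H(1) v unfolding generates_def by blast
      show ?thesis
      proof (cases "a \<le> a'")
        case False
        then have "{r \<in> H - {p}. fst r \<le> a'} = {r \<in> H. fst r \<le> a'}" using p by auto
        then show ?thesis using d by auto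
      next
        case True
        \<comment> \<open>Subtracting \<open>d p / c p\<close> times the relation cancels
          \<open>p\<close>; the relation persists in degree \<open>a'\<close> since \<open>a\<close>
          lies below \<open>a'\<close>.\<close>
        define e where "e r = d r - d p / c p * (if fst r \<le> a then c r else 0)" for r
        have "v l = (\<Sum>r\<in>{r \<in> H - {p}. fst r \<le> a'}. e r * snd r l)" for l
        proof -
          have "(\<Sum>r\<in>{r \<in> H. fst r \<le> a'}. (if fst r \<le> a then c r else 0) * snd r l)
            = (\<Sum>r\<in>{r \<in> H. fst r \<le> a}. c r * snd r l)"
            using fin True by (intro sum.mono_neutral_cong_right) (auto intro: order_trans)
          then have "(\<Sum>r\<in>{r \<in> H. fst r \<le> a'}. d p / c p * ((if fst r \<le> a then c r else 0) * snd r l)) = 0"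
            unfolding sum_distrib_left[symmetric] using rel by simp
          then have "v l = (\<Sum>r\<in>{r \<in> H. fst r \<le> a'}. e r * snd r l)"
            by (simp add: d e_def left_diff_distrib sum_subtractf mult.assoc)
          also have "\<dots> = (\<Sum>r\<in>{r \<in> H - {p}. fst r \<le> a'}. e r * snd r l)"
            using fin cp p by (intro sum.mono_neutral_right) (auto simp: e_def)
          finally show ?thesis .
        qed
        then show ?thesis by (intro exI[of _ e] ext)
      qed
    qed
    then have "generates (H - {p})" using H(1) unfolding generates_def by simp
    then have "card H \<le> card (H - {p})" by (rule H(2))
    then show False using fin p(1) by (metis card_Diff1_less not_le)
  qed
  then have "irredundant H" unfolding irredundant_def by blast
  then show ?thesis by (rule that[OF H(1)])
qed

end

text \<open>The degree part of a free module outside any complex; it becomes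
  \<open>vecs i {..a}\<close> once the complex is built.\<close>

definition combos :: "nat \<Rightarrow> (nat \<Rightarrow> 'n \<Rightarrow> nat) \<Rightarrow> ('n \<Rightarrow> nat) \<Rightarrow> (nat \<Rightarrow> 'k::zero) set"
  where "combos b dg a = {w. \<forall>j. w j \<noteq> 0 \<longrightarrow> j < b \<and> dg j \<le> a}"

text \<open>One step of a minimal resolution: the columns of \<open>A\<close> are minimal generators
  of \<open>W\<close>, and the syzygies form the next family. \<open>no_unit\<close> for
  \<open>W\<close> makes the degrees differ strictly, and irredundance is \<open>no_unit\<close> for
  the syzygies.\<close>

lemma (in subspace_family) presentation:
  obtains b' dg' A where
    "\<And>l j. j < b' \<Longrightarrow> A l j \<noteq> 0 \<Longrightarrow> l < b \<and> dg l \<le> dg' j \<and> dg l \<noteq> dg' j"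
    "\<And>a. W a = (\<lambda>w l. \<Sum>j<b'. A l j * w j) ` combos b' dg' a"
    "subspace_family b' dg' (\<lambda>a. {w \<in> combos b' dg' a. \<forall>l. (\<Sum>j<b'. A l j * w j) = (0::'k)})"
proof -
  obtain H where H: "generates H" and irr: "irredundant H" by (rule minimal_generators)
  have fin: "finite H" using H by (simp add: generates_def)
  obtain h where h: "bij_betw h {0..<card H} H" using ex_bij_betw_nat_finite[OF fin] by blast
  define b' where "b' = card H"
  define dg' where "dg' j = fst (h j)" for j
  define A where "A l j = snd (h j) l" for l j
  have h: "bij_betw h {..<b'} H" using h by (simp add: b'_def atLeast0LessThan)
  have colW: "(\<lambda>l. A l j) \<in> W (dg' j)" if "j < b'" for j
    using H bij_betwE[OF h] that by (simp add: generates_def A_def dg'_def)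
  have hle: "{p \<in> H. fst p \<le> a} = h ` {j. j < b' \<and> dg' j \<le> a}" for a
    using bij_betw_imp_surj_on[OF h] by (auto simp: dg'_def)
  have inj: "inj_on h {j. j < b' \<and> dg' j \<le> a}" for a
    using bij_betw_imp_inj_on[OF h] by (rule inj_on_subset) auto
  have sum_h: "(\<Sum>p\<in>{p \<in> H. fst p \<le> a}. c p * snd p l) = (\<Sum>j\<in>{j. j < b' \<and> dg' j \<le> a}. A l j * c (h j))" for a c l
    unfolding hle sum.reindex[OF inj] by (simp add: A_def mult.commute)
  have sum_w: "(\<Sum>j\<in>{j. j < b' \<and> dg' j \<le> a}. A l j * w j) = (\<Sum>j<b'. A l j * w j)"
    if "w \<in> combos b' dg' a" for w a l
    using that by (intro sum.mono_neutral_left) (auto simp: combos_def)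
  define restrict where "restrict a c j = (if j < b' \<and> dg' j \<le> a then c j else 0)" for a and c :: "nat \<Rightarrow> 'k" and j
  have restr: "restrict a c \<in> combos b' dg' a" for a c by (auto simp: restrict_def combos_def)
  have W: "W a = (\<lambda>w l. \<Sum>j<b'. A l j * w j) ` combos b' dg' a" for a
  proof (intro subset_antisym subsetI)
    fix v assume "v \<in> W a"
    then obtain c where c: "v = (\<lambda>l. \<Sum>p\<in>{p \<in> H. fst p \<le> a}. c p * snd p l)"
      using H unfolding generates_def by blast
    have "v = (\<lambda>l. \<Sum>j<b'. A l j * restrict a (c \<circ> h) j)"
      unfolding c sum_h sum_w[OF restr, symmetric] by (auto simp: restrict_def intro!: sum.cong)
    then show "v \<in> (\<lambda>w l. \<Sum>j<b'. A l j * w j) ` combos b' dg' a" using restr by blast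
  next
    fix v assume "v \<in> (\<lambda>w l. \<Sum>j<b'. A l j * w j) ` combos b' dg' a"
    then obtain w where w: "w \<in> combos b' dg' a" "v = (\<lambda>l. \<Sum>j<b'. A l j * w j)" by blast
    have "v = (\<lambda>l. \<Sum>j\<in>{j. j < b' \<and> dg' j \<le> a}. w j * A l j)"
      unfolding w(2) sum_w[OF w(1), symmetric] by (simp add: mult.commute)
    also have "\<dots> \<in> W a"
      using sum_mem[of "{j. j < b' \<and> dg' j \<le> a}" "\<lambda>j l. A l j" a w] colW mono by auto
    finally show "v \<in> W a" .
  qed
  have ker: "w j = 0" if "w \<in> combos b' dg' a" "\<forall>l. (\<Sum>j<b'. A l j * w j) = 0" "dg' j = a" for w a j
  proof (cases "j < b'")
    case True
    have inv: "inv_into {..<b'} h (h i) = i" if "i < b'" for i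
      using bij_betw_inv_into_left[OF h] that by simp
    have "(\<Sum>p\<in>{p \<in> H. fst p \<le> a}. (w \<circ> inv_into {..<b'} h) p * snd p l) = 0" for l
    proof -
      have "(\<Sum>p\<in>{p \<in> H. fst p \<le> a}. (w \<circ> inv_into {..<b'} h) p * snd p l)
        = (\<Sum>j\<in>{j. j < b' \<and> dg' j \<le> a}. A l j * w j)"
        unfolding sum_h by (intro sum.cong) (auto simp: inv)
      then show ?thesis using that(2) sum_w[OF that(1), of l] by simp
    qed
    then have "(w \<circ> inv_into {..<b'} h) (h j) = 0"
      using irr bij_betwE[OF h] True that(3) unfolding irredundant_def dg'_def by blast
    then show ?thesis using inv[OF True] by simp
  qed (use that(1) in \<open>auto simp: combos_def\<close>)
  show ?thesis
  proof (rule that[of b' A dg'])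
    show "l < b \<and> dg l \<le> dg' j \<and> dg l \<noteq> dg' j" if "j < b'" "A l j \<noteq> 0" for l j
      using supported[OF colW[OF that(1)] that(2)] no_unit[OF colW[OF that(1)]] that(2) by metis
    show "W a = (\<lambda>w l. \<Sum>j<b'. A l j * w j) ` combos b' dg' a" for a by (rule W)
    show "subspace_family b' dg' (\<lambda>a. {w \<in> combos b' dg' a. \<forall>l. (\<Sum>j<b'. A l j * w j) = 0})"
    proof (unfold_locales, goal_cases)
      case (3 v a w)
      then show ?case by (auto simp: combos_def distrib_left sum.distrib) (metis add_0)+
    next
      case (4 v a c)
      have "(\<Sum>j<b'. A l j * (c * v j)) = c * (\<Sum>j<b'. A l j * v j)" for l
        by (simp add: sum_distrib_left mult.left_commute)
      then show ?case using 4 by (auto simp: combos_def)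
    next
      case (6 v a j)
      then show ?case using ker by blast
    qed (auto simp: combos_def intro: order_trans)
  qed
qed

text \<open>From index \<open>1\<close> on the chosen submodule is both the kernel of one map and
  the image of the next, which is exactness. Minimality holds since nonzero coefficients occur only
  between different degrees.\<close>

theorem exact_complex_exists:
  fixes W0 :: "('n::finite \<Rightarrow> nat) \<Rightarrow> (nat \<Rightarrow> 'k::field) set"
  assumes "subspace_family b0 dg0 W0"
  obtains b dg D where "b 0 = b0" "dg 0 = dg0" "multigraded_exact_complex b dg D"
    "\<forall>a. W0 a = multigraded_complex.bdy b D 1 ` multigraded_complex.vecs b dg 1 {..a}"
proof -
  define step where "step = (\<lambda>(b :: nat, dg :: nat \<Rightarrow> 'n \<Rightarrow> nat, W) (b', dg', W') A.
    (\<forall>l j. j < b' \<longrightarrow> A l j \<noteq> 0 \<longrightarrow> l < b \<and> dg l \<le> dg' j \<and> dg l \<noteq> (dg' j :: 'n \<Rightarrow> nat)) \<and>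
    (\<forall>a. W a = (\<lambda>w l. \<Sum>j<b'. A l j * w j) ` combos b' dg' a) \<and>
    W' = (\<lambda>a. {w \<in> combos b' dg' a. \<forall>l. (\<Sum>j<b'. A l j * w j) = (0::'k)}))"
  define P where "P = (\<lambda>(i::nat) (b, dg, W). subspace_family b dg (W :: ('n \<Rightarrow> nat) \<Rightarrow> (nat \<Rightarrow> 'k) set)
    \<and> (i = 0 \<longrightarrow> (b, dg, W) = (b0, dg0, W0)))"
  have "\<exists>f. \<forall>i. P i (f i) \<and> (\<exists>A. step (f i) (f (Suc i)) A)"
  proof (rule dependent_nat_choice)
    show "\<exists>x. P 0 x" using assms by (auto simp: P_def)
  next
    fix x :: "nat \<times> (nat \<Rightarrow> 'n \<Rightarrow> nat) \<times> (('n \<Rightarrow> nat) \<Rightarrow> (nat \<Rightarrow> 'k) set)" and i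
    assume "P i x"
    then obtain b dg W where x: "x = (b, dg, W)" "subspace_family b dg W"
      by (cases x) (auto simp: P_def)
    show "\<exists>y. P (Suc i) y \<and> (\<exists>A. step x y A)"
    proof (rule subspace_family.presentation[OF x(2)])
      fix b' :: nat and A :: "nat \<Rightarrow> nat \<Rightarrow> 'k" and dg' :: "nat \<Rightarrow> 'n \<Rightarrow> nat"
      let ?W' = "\<lambda>a. {w \<in> combos b' dg' a. \<forall>l. (\<Sum>j<b'. A l j * w j) = (0::'k)}"
      assume "\<And>l j. j < b' \<Longrightarrow> A l j \<noteq> 0 \<Longrightarrow> l < b \<and> dg l \<le> dg' j \<and> dg l \<noteq> dg' j"
        "\<And>a. W a = (\<lambda>w l. \<Sum>j<b'. A l j * w j) ` combos b' dg' a"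
        "subspace_family b' dg' ?W'"
      then have "P (Suc i) (b', dg', ?W') \<and> step x (b', dg', ?W') A"
        unfolding x(1) P_def step_def by simp
      then show ?thesis by blast
    qed
  qed
  then obtain f A where P: "\<And>i. P i (f i)" and step: "\<And>i. step (f i) (f (Suc i)) (A i)" by metis
  define b where "b i = fst (f i)" for i
  define dg where "dg i = fst (snd (f i))" for i
  define W where "W i = snd (snd (f i))" for i
  have f: "f i = (b i, dg i, W i)" for i by (simp add: b_def dg_def W_def)
  have A: "l < b i \<and> dg i l \<le> dg (Suc i) j \<and> dg i l \<noteq> dg (Suc i) j" if "j < b (Suc i)" "A i l j \<noteq> 0" for i l j
    using step[of i] that unfolding f step_def by auto
  have W: "W i a = (\<lambda>w l. \<Sum>j<b (Suc i). A i l j * w j) ` combos (b (Suc i)) (dg (Suc i)) a" for i a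
    using step[of i] unfolding f step_def by auto
  have W_Suc: "W (Suc i) a = {w \<in> combos (b (Suc i)) (dg (Suc i)) a. \<forall>l. (\<Sum>j<b (Suc i). A i l j * w j) = 0}" for i a
    using step[of i] unfolding f step_def by auto
  interpret multigraded_complex b dg A by unfold_locales (use A in blast)
  have vecs: "vecs i {..a} = combos (b i) (dg i) a" for i a by (auto simp: vecs_def combos_def)
  have bdy: "bdy (Suc i) w = (\<lambda>l. \<Sum>j<b (Suc i). A i l j * w j)" for i w
  proof
    fix l
    have "A i l j = 0" if "j < b (Suc i)" "\<not> l < b i" for j using A[of j i l] that by blast
    then show "bdy (Suc i) w l = (\<Sum>j<b (Suc i). A i l j * w j)"
      unfolding bdy_Suc by (auto intro!: sum.neutral)
  qed
  have W_img: "W i a = bdy (Suc i) ` vecs (Suc i) {..a}" for i a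
    unfolding W vecs by (simp add: bdy[abs_def])
  have W_ker: "W (Suc i) a = {w \<in> vecs (Suc i) {..a}. bdy (Suc i) w = 0}" for i a
    unfolding W_Suc vecs bdy by (auto simp: fun_eq_iff)
  interpret multigraded_exact_complex b dg A
  proof
    show "bdy i (bdy (Suc i) w) = 0" if "w \<in> vecs (Suc i) {..a}" for i a w
    proof (cases i)
      case (Suc i')
      have "bdy (Suc i) w \<in> W i a" using that W_img by blast
      then show ?thesis using W_ker Suc by auto
    qed simp
    show "\<exists>w\<in>vecs (Suc (Suc i)) {..a}. bdy (Suc (Suc i)) w = v"
      if "v \<in> vecs (Suc i) {..a}" "bdy (Suc i) v = 0" for i a v
    proof -
      have "v \<in> W (Suc i) a" using that W_ker by blast
      then show ?thesis unfolding W_img by blast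
    qed
    show "A i l j = 0" if "l < b i" "j < b (Suc i)" "dg i l = dg (Suc i) j" for i l j
      using A that by blast
  qed
  have "b 0 = b0" "dg 0 = dg0" "W 0 = W0" using P[of 0] unfolding f P_def by auto
  then show ?thesis using that[OF _ _ multigraded_exact_complex_axioms] W_img[of 0] by simp
qed

section \<open>Comparison of projective resolutions\<close>

lemma mod_homD:
  assumes "f \<in> mod_hom R A B"
  shows "x \<in> carrier A \<Longrightarrow> f x \<in> carrier B"
    and "x \<in> carrier A \<Longrightarrow> y \<in> carrier A \<Longrightarrow> f (x \<oplus>\<^bsub>A\<^esub> y) = f x \<oplus>\<^bsub>B\<^esub> f y"
    and "r \<in> carrier R \<Longrightarrow> x \<in> carrier A \<Longrightarrow> f (r \<odot>\<^bsub>A\<^esub> x) = r \<odot>\<^bsub>B\<^esub> f x"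
  using assms by (auto simp: mod_hom_def)

lemma mod_homI:
  assumes "\<And>x. x \<in> carrier A \<Longrightarrow> f x \<in> carrier B"
    and "\<And>x y. x \<in> carrier A \<Longrightarrow> y \<in> carrier A \<Longrightarrow> f (x \<oplus>\<^bsub>A\<^esub> y) = f x \<oplus>\<^bsub>B\<^esub> f y"
    and "\<And>r x. r \<in> carrier R \<Longrightarrow> x \<in> carrier A \<Longrightarrow> f (r \<odot>\<^bsub>A\<^esub> x) = r \<odot>\<^bsub>B\<^esub> f x"
  shows "f \<in> mod_hom R A B"
  using assms by (auto simp: mod_hom_def)

lemma mod_hom_comp:
  assumes "f \<in> mod_hom R A B" "g \<in> mod_hom R B C"
  shows "(\<lambda>x. g (f x)) \<in> mod_hom R A C"
  by (rule mod_homI) (simp_all add: mod_homD[OF assms(1)] mod_homD[OF assms(2)])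

lemma mod_hom_zero:
  assumes "Module.module R A" "Module.module R B" "f \<in> mod_hom R A B"
  shows "f \<zero>\<^bsub>A\<^esub> = \<zero>\<^bsub>B\<^esub>"
proof -
  interpret A: Module.module R A by fact
  interpret B: Module.module R B by fact
  have "f (\<zero>\<^bsub>R\<^esub> \<odot>\<^bsub>A\<^esub> \<zero>\<^bsub>A\<^esub>) = \<zero>\<^bsub>R\<^esub> \<odot>\<^bsub>B\<^esub> f \<zero>\<^bsub>A\<^esub>"
    by (rule mod_homD(3)[OF assms(3)]) simp_all
  then show ?thesis using mod_homD(1)[OF assms(3) A.zero_closed] by simp
qed

text \<open>Lifting through a map onto a module of arbitrary type: the image of \<open>f\<close> is copied to the type
  of its domain by choosing preimages.\<close>

lemma projective_lift:
  fixes P A :: "('a, 'b) module" and Q :: "('a, 'c) module"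
  assumes P: "projective_module R P" and A: "Module.module R A" and Q: "Module.module R Q"
    and f: "f \<in> mod_hom R A Q" and g: "g \<in> mod_hom R P Q"
    and img: "\<And>x. x \<in> carrier P \<Longrightarrow> g x \<in> f ` carrier A"
  shows "\<exists>h\<in>mod_hom R P A. \<forall>x\<in>carrier P. f (h x) = g x"
proof -
  interpret A: Module.module R A by fact
  interpret Q: Module.module R Q by fact
  define \<iota> where "\<iota> = inv_into (carrier A) f"
  have f\<iota>: "f (\<iota> y) = y" "\<iota> y \<in> carrier A" if "y \<in> f ` carrier A" for y
    using that by (auto simp: \<iota>_def f_inv_into_f inv_into_into)
  note fA = mod_homD[OF f] and gP = mod_homD[OF g]
  have f0: "f \<zero>\<^bsub>A\<^esub> = \<zero>\<^bsub>Q\<^esub>" by (rule mod_hom_zero[OF A Q f])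
  have img_add: "x \<oplus>\<^bsub>Q\<^esub> y \<in> f ` carrier A" if "x \<in> f ` carrier A" "y \<in> f ` carrier A" for x y
    using that by (auto simp flip: fA(2))
  have img_smult: "r \<odot>\<^bsub>Q\<^esub> y \<in> f ` carrier A" if "r \<in> carrier R" "y \<in> f ` carrier A" for r y
    using that by (auto simp flip: fA(3))
  have img_zero: "\<zero>\<^bsub>Q\<^esub> \<in> f ` carrier A" using f0 by (metis A.zero_closed imageI)
  have imgQ: "y \<in> carrier Q" if "y \<in> f ` carrier A" for y using that fA(1) by auto
  define B :: "('a, 'b) module" where "B = \<lparr>carrier = \<iota> ` f ` carrier A, mult = undefined, one = undefined,
     zero = \<iota> \<zero>\<^bsub>Q\<^esub>, add = (\<lambda>x y. \<iota> (f x \<oplus>\<^bsub>Q\<^esub> f y)), smult = (\<lambda>r x. \<iota> (r \<odot>\<^bsub>Q\<^esub> f x))\<rparr>"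
  have B: "Module.module R B"
  proof (rule moduleI)
    show "cring R" ..
    show "abelian_group B"
    proof (rule abelian_groupI)
      fix x assume "x \<in> carrier B"
      then obtain y where y: "y \<in> carrier A" "x = \<iota> (f y)" by (auto simp: B_def)
      have "f (\<ominus>\<^bsub>A\<^esub> y) \<oplus>\<^bsub>Q\<^esub> f y = \<zero>\<^bsub>Q\<^esub>"
        using y(1) fA(2)[of "\<ominus>\<^bsub>A\<^esub> y" y] f0 by (simp add: A.l_neg)
      then show "\<exists>z\<in>carrier B. z \<oplus>\<^bsub>B\<^esub> x = \<zero>\<^bsub>B\<^esub>"
        using y by (intro bexI[of _ "\<iota> (f (\<ominus>\<^bsub>A\<^esub> y))"]) (auto simp: B_def f\<iota>)
    qed (auto simp: B_def f\<iota> img_add img_zero imgQ A.a_ac fA(1) simp flip: fA(2))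
  qed (auto simp: B_def f\<iota> img_add img_smult imgQ fA(1) A.smult_l_distr A.smult_r_distr A.smult_assoc1
      simp flip: fA(2,3))
  have lift: "\<exists>h\<in>mod_hom R P A. \<forall>x\<in>carrier P. f' (h x) = g' x"
    if "f' \<in> mod_hom R A B" "f' ` carrier A = carrier B" "g' \<in> mod_hom R P B" for f' g'
    using P A B that unfolding projective_module_def by blast
  have f'': "(\<lambda>x. \<iota> (f x)) \<in> mod_hom R A B"
    by (rule mod_homI) (auto simp: B_def f\<iota> fA)
  have onto: "(\<lambda>x. \<iota> (f x)) ` carrier A = carrier B" by (auto simp: B_def)
  have g'': "(\<lambda>x. \<iota> (g x)) \<in> mod_hom R P B"
    using img by (intro mod_homI) (auto simp: B_def f\<iota> gP)
  obtain h where h: "h \<in> mod_hom R P A" "\<forall>x\<in>carrier P. \<iota> (f (h x)) = \<iota> (g x)"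
    using lift[OF f'' onto g''] by blast
  have "f (h x) = g x" if "x \<in> carrier P" for x
  proof -
    have "f (\<iota> (f (h x))) = f (\<iota> (g x))" using h(2) that by simp
    then show ?thesis using f\<iota>(1)[of "f (h x)"] f\<iota>(1)[OF img[OF that]] mod_homD(1)[OF h(1) that] by simp
  qed
  then show ?thesis using h(1) by blast
qed

lemma resolution_image_kernel:
  assumes "resolution R N P d \<epsilon>"
  shows "x \<in> carrier (P 1) \<Longrightarrow> \<epsilon> (d 0 x) = \<zero>\<^bsub>N\<^esub>"
    and "x \<in> carrier (P (Suc (Suc i))) \<Longrightarrow> d i (d (Suc i) x) = \<zero>\<^bsub>P i\<^esub>"
    and "y \<in> carrier (P 0) \<Longrightarrow> \<epsilon> y = \<zero>\<^bsub>N\<^esub> \<Longrightarrow> y \<in> d 0 ` carrier (P 1)"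
    and "y \<in> carrier (P (Suc i)) \<Longrightarrow> d i y = \<zero>\<^bsub>P i\<^esub> \<Longrightarrow> y \<in> d (Suc i) ` carrier (P (Suc (Suc i)))"
proof -
  have 0: "d 0 ` carrier (P 1) = mod_kernel (P 0) N \<epsilon>"
    and i: "d (Suc i) ` carrier (P (Suc (Suc i))) = mod_kernel (P (Suc i)) (P i) (d i)"
    using assms by (auto simp: resolution_def)
  show "x \<in> carrier (P 1) \<Longrightarrow> \<epsilon> (d 0 x) = \<zero>\<^bsub>N\<^esub>" "y \<in> carrier (P 0) \<Longrightarrow> \<epsilon> y = \<zero>\<^bsub>N\<^esub> \<Longrightarrow> y \<in> d 0 ` carrier (P 1)"
    using 0 unfolding mod_kernel_def by blast+
  show "x \<in> carrier (P (Suc (Suc i))) \<Longrightarrow> d i (d (Suc i) x) = \<zero>\<^bsub>P i\<^esub>"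
    "y \<in> carrier (P (Suc i)) \<Longrightarrow> d i y = \<zero>\<^bsub>P i\<^esub> \<Longrightarrow> y \<in> d (Suc i) ` carrier (P (Suc (Suc i)))"
    using i unfolding mod_kernel_def by blast+
qed

lemma resolutionD:
  assumes "resolution R N P d \<epsilon>"
  shows "Module.module R (P i)" "d i \<in> mod_hom R (P (Suc i)) (P i)" "\<epsilon> \<in> mod_hom R (P 0) N"
    "\<epsilon> ` carrier (P 0) = carrier N"
  using assms by (auto simp: resolution_def)

theorem comparison_map:
  fixes P Q :: "nat \<Rightarrow> ('a, 'b) module"
  assumes N: "Module.module R N" and P: "resolution R N P d \<epsilon>" "\<And>i. projective_module R (P i)"
    and Q: "resolution R N Q d' \<epsilon>'"
  obtains f where "\<And>i. f i \<in> mod_hom R (P i) (Q i)"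
    "\<And>x. x \<in> carrier (P 0) \<Longrightarrow> \<epsilon>' (f 0 x) = \<epsilon> x"
    "\<And>i x. x \<in> carrier (P (Suc i)) \<Longrightarrow> d' i (f (Suc i) x) = f i (d i x)"
proof -
  note PD = resolutionD[OF P(1)] and QD = resolutionD[OF Q]
  note PX = resolution_image_kernel[OF P(1)] and QX = resolution_image_kernel[OF Q]
  \<comment> \<open>The second clause is the image condition under which
    \<open>projective_lift\<close> yields the next map.\<close>
  define L where "L i f \<longleftrightarrow> f \<in> mod_hom R (P i) (Q i) \<and>
      (\<forall>x\<in>carrier (P (Suc i)). f (d i x) \<in> d' i ` carrier (Q (Suc i))) \<and>
      (i = 0 \<longrightarrow> (\<forall>x\<in>carrier (P 0). \<epsilon>' (f x) = \<epsilon> x))" for i f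
  have "\<exists>f. \<forall>i. L i (f i) \<and> (\<forall>x\<in>carrier (P (Suc i)). d' i (f (Suc i) x) = f i (d i x))"
  proof (rule dependent_nat_choice)
    have "\<exists>f\<in>mod_hom R (P 0) (Q 0). \<forall>x\<in>carrier (P 0). \<epsilon>' (f x) = \<epsilon> x"
    proof (rule projective_lift[OF P(2) QD(1) N QD(3) PD(3)])
      show "\<epsilon> x \<in> \<epsilon>' ` carrier (Q 0)" if "x \<in> carrier (P 0)" for x
        using QD(4) mod_homD(1)[OF PD(3) that] by simp
    qed
    then obtain f where f: "f \<in> mod_hom R (P 0) (Q 0)" "\<And>x. x \<in> carrier (P 0) \<Longrightarrow> \<epsilon>' (f x) = \<epsilon> x"
      by blast
    have "f (d 0 x) \<in> d' 0 ` carrier (Q (Suc 0))" if "x \<in> carrier (P (Suc 0))" for x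
      using QX(3)[of "f (d 0 x)"] PX(1)[of x] f(2)[of "d 0 x"] that
        mod_homD(1)[OF PD(2)[of 0] that] mod_homD(1)[OF f(1)] by simp
    then show "\<exists>f. L 0 f" using f unfolding L_def by blast
  next
    fix f i assume L: "L i f"
    have f: "f \<in> mod_hom R (P i) (Q i)" and im: "\<And>x. x \<in> carrier (P (Suc i)) \<Longrightarrow> f (d i x) \<in> d' i ` carrier (Q (Suc i))"
      using L unfolding L_def by auto
    obtain f' where f': "f' \<in> mod_hom R (P (Suc i)) (Q (Suc i))"
      "\<And>x. x \<in> carrier (P (Suc i)) \<Longrightarrow> d' i (f' x) = f (d i x)"
      using projective_lift[OF P(2) QD(1) QD(1) QD(2) mod_hom_comp[OF PD(2) f] im] by blast
    have "f' (d (Suc i) x) \<in> d' (Suc i) ` carrier (Q (Suc (Suc i)))" if "x \<in> carrier (P (Suc (Suc i)))" for x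
    proof (rule QX(4))
      have dx: "d (Suc i) x \<in> carrier (P (Suc i))" by (rule mod_homD(1)[OF PD(2) that])
      show "f' (d (Suc i) x) \<in> carrier (Q (Suc i))" by (rule mod_homD(1)[OF f'(1) dx])
      show "d' i (f' (d (Suc i) x)) = \<zero>\<^bsub>Q i\<^esub>"
        using f'(2)[OF dx] PX(2)[OF that] mod_hom_zero[OF PD(1) QD(1) f] by simp
    qed
    then show "\<exists>f'. L (Suc i) f' \<and> (\<forall>x\<in>carrier (P (Suc i)). d' i (f' x) = f (d i x))"
      using f' unfolding L_def by blast
  qed
  then obtain f where "\<forall>i. L i (f i) \<and> (\<forall>x\<in>carrier (P (Suc i)). d' i (f (Suc i) x) = f i (d i x))" by blast
  then show ?thesis by (intro that[of f]) (auto simp: L_def)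
qed

theorem null_homotopy:
  fixes P Q :: "nat \<Rightarrow> ('a, 'b) module"
  assumes N: "Module.module R N" and P: "resolution R N P d \<epsilon>" "\<And>i. projective_module R (P i)"
    and Q: "resolution R N Q d' \<epsilon>'"
    and \<psi>: "\<And>i. \<psi> i \<in> mod_hom R (P i) (Q i)"
    and \<psi>_0: "\<And>x. x \<in> carrier (P 0) \<Longrightarrow> \<epsilon>' (\<psi> 0 x) = \<zero>\<^bsub>N\<^esub>"
    and \<psi>_d: "\<And>i x. x \<in> carrier (P (Suc i)) \<Longrightarrow> d' i (\<psi> (Suc i) x) = \<psi> i (d i x)"
  obtains s where "\<And>i. s i \<in> mod_hom R (P i) (Q (Suc i))"
    "\<And>x. x \<in> carrier (P 0) \<Longrightarrow> \<psi> 0 x = d' 0 (s 0 x)"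
    "\<And>i x. x \<in> carrier (P (Suc i)) \<Longrightarrow> \<psi> (Suc i) x = d' (Suc i) (s (Suc i) x) \<oplus>\<^bsub>Q (Suc i)\<^esub> s i (d i x)"
proof -
  note PD = resolutionD[OF P(1)] and QD = resolutionD[OF Q]
  note PX = resolution_image_kernel[OF P(1)] and QX = resolution_image_kernel[OF Q]
  \<comment> \<open>The second clause makes \<psi> minus \<open>s d\<close> a cycle at the next
    index, so that it lifts through \<open>d'\<close>.\<close>
  define L where "L i s \<longleftrightarrow> s \<in> mod_hom R (P i) (Q (Suc i)) \<and>
      (\<forall>x\<in>carrier (P (Suc i)). d' i (s (d i x)) = \<psi> i (d i x)) \<and>
      (i = 0 \<longrightarrow> (\<forall>x\<in>carrier (P 0). \<psi> 0 x = d' 0 (s x)))" for i s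
  have "\<exists>s. \<forall>i. L i (s i) \<and>
    (\<forall>x\<in>carrier (P (Suc i)). \<psi> (Suc i) x = d' (Suc i) (s (Suc i) x) \<oplus>\<^bsub>Q (Suc i)\<^esub> s i (d i x))"
  proof (rule dependent_nat_choice)
    have "\<exists>s\<in>mod_hom R (P 0) (Q 1). \<forall>x\<in>carrier (P 0). d' 0 (s x) = \<psi> 0 x"
    proof (rule projective_lift[OF P(2) QD(1) QD(1) _ \<psi>])
      show "d' 0 \<in> mod_hom R (Q 1) (Q 0)" using QD(2)[of 0] by simp
      show "\<psi> 0 x \<in> d' 0 ` carrier (Q 1)" if "x \<in> carrier (P 0)" for x
        using QX(3) mod_homD(1)[OF \<psi> that] \<psi>_0[OF that] by blast
    qed
    then obtain s where s: "s \<in> mod_hom R (P 0) (Q 1)" "\<And>x. x \<in> carrier (P 0) \<Longrightarrow> d' 0 (s x) = \<psi> 0 x"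
      by blast
    then show "\<exists>s. L 0 s" using mod_homD(1)[OF PD(2)[of 0]] unfolding L_def by auto
  next
    fix s i assume L: "L i s"
    interpret Q: Module.module R "Q (Suc i)" by (rule QD(1))
    interpret Q0: Module.module R "Q i" by (rule QD(1))
    have s: "s \<in> mod_hom R (P i) (Q (Suc i))" and ds: "\<And>x. x \<in> carrier (P (Suc i)) \<Longrightarrow> d' i (s (d i x)) = \<psi> i (d i x)"
      using L unfolding L_def by auto
    note dP = mod_homD[OF PD(2)] and dQ = mod_homD[OF QD(2)] and sP = mod_homD[OF s] and \<psi>P = mod_homD[OF \<psi>]
    define g where "g x = \<psi> (Suc i) x \<ominus>\<^bsub>Q (Suc i)\<^esub> s (d i x)" for x
    have g: "g \<in> mod_hom R (P (Suc i)) (Q (Suc i))"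
    proof (rule mod_homI)
      fix x y assume "x \<in> carrier (P (Suc i))" "y \<in> carrier (P (Suc i))"
      then show "g (x \<oplus>\<^bsub>P (Suc i)\<^esub> y) = g x \<oplus>\<^bsub>Q (Suc i)\<^esub> g y"
        by (simp add: g_def dP sP \<psi>P a_minus_def Q.minus_add Q.a_ac)
    next
      fix r x assume "r \<in> carrier R" "x \<in> carrier (P (Suc i))"
      then show "g (r \<odot>\<^bsub>P (Suc i)\<^esub> x) = r \<odot>\<^bsub>Q (Suc i)\<^esub> g x"
        by (simp add: g_def dP sP \<psi>P a_minus_def Q.smult_r_distr Q.smult_r_minus)
    qed (simp add: g_def dP sP \<psi>P)
    have "\<exists>s'\<in>mod_hom R (P (Suc i)) (Q (Suc (Suc i))). \<forall>x\<in>carrier (P (Suc i)). d' (Suc i) (s' x) = g x"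
    proof (rule projective_lift[OF P(2) QD(1) QD(1) QD(2) g])
      show "g x \<in> d' (Suc i) ` carrier (Q (Suc (Suc i)))" if x: "x \<in> carrier (P (Suc i))" for x
      proof (rule QX(4))
        show "g x \<in> carrier (Q (Suc i))" by (rule mod_homD(1)[OF g x])
        have c: "s (d i x) \<in> carrier (Q (Suc i))" "\<psi> (Suc i) x \<in> carrier (Q (Suc i))" "g x \<in> carrier (Q (Suc i))"
          using x mod_homD(1)[OF g x] by (simp_all add: dP sP \<psi>P)
        have "\<psi> (Suc i) x = g x \<oplus>\<^bsub>Q (Suc i)\<^esub> s (d i x)"
          using c by (simp add: g_def a_minus_def Q.a_assoc Q.l_neg)
        then have "d' i (\<psi> (Suc i) x) = d' i (g x) \<oplus>\<^bsub>Q i\<^esub> d' i (s (d i x))"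
          using c by (simp add: dQ)
        then have "d' i (\<psi> (Suc i) x) = d' i (g x) \<oplus>\<^bsub>Q i\<^esub> d' i (\<psi> (Suc i) x)"
          using \<psi>_d[OF x] ds[OF x] by simp
        then show "d' i (g x) = \<zero>\<^bsub>Q i\<^esub>"
          using c dQ(1) by (metis Q0.add.r_cancel_one)
      qed
    qed
    then obtain s' where s': "s' \<in> mod_hom R (P (Suc i)) (Q (Suc (Suc i)))"
      "\<And>x. x \<in> carrier (P (Suc i)) \<Longrightarrow> d' (Suc i) (s' x) = g x"
      by blast
    have eq: "\<psi> (Suc i) x = d' (Suc i) (s' x) \<oplus>\<^bsub>Q (Suc i)\<^esub> s (d i x)" if x: "x \<in> carrier (P (Suc i))" for x
      using x s'(2)[OF x] by (simp add: g_def a_minus_def Q.a_assoc Q.l_neg dP sP \<psi>P)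
    have "d' (Suc i) (s' (d (Suc i) x)) = \<psi> (Suc i) (d (Suc i) x)" if x: "x \<in> carrier (P (Suc (Suc i)))" for x
    proof -
      have dx: "d (Suc i) x \<in> carrier (P (Suc i))" by (rule dP(1)[OF x])
      have "s (d i (d (Suc i) x)) = \<zero>\<^bsub>Q (Suc i)\<^esub>"
        using PX(2)[OF x] mod_hom_zero[OF PD(1) QD(1) s] by simp
      then show ?thesis using eq[OF dx] dx by (simp add: s'(2) mod_homD(1)[OF g])
    qed
    then show "\<exists>s'. L (Suc i) s' \<and>
        (\<forall>x\<in>carrier (P (Suc i)). \<psi> (Suc i) x = d' (Suc i) (s' x) \<oplus>\<^bsub>Q (Suc i)\<^esub> s (d i x))"
      using s'(1) eq unfolding L_def by blast
  qed
  then obtain s where "\<forall>i. L i (s i) \<and>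
    (\<forall>x\<in>carrier (P (Suc i)). \<psi> (Suc i) x = d' (Suc i) (s (Suc i) x) \<oplus>\<^bsub>Q (Suc i)\<^esub> s i (d i x))" by blast
  then show ?thesis by (intro that[of s]) (auto simp: L_def)
qed

section \<open>Free modules\<close>

lemma free_module_simps [simp]:
  "carrier (free_module R r) = {v. (\<forall>i<r. v i \<in> carrier R) \<and> (\<forall>i\<ge>r. v i = \<zero>\<^bsub>R\<^esub>)}"
  "\<zero>\<^bsub>free_module R r\<^esub> = (\<lambda>_. \<zero>\<^bsub>R\<^esub>)"
  "v \<oplus>\<^bsub>free_module R r\<^esub> w = (\<lambda>i. v i \<oplus>\<^bsub>R\<^esub> w i)"
  "a \<odot>\<^bsub>free_module R r\<^esub> v = (\<lambda>i. a \<otimes>\<^bsub>R\<^esub> v i)"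
  by (simp_all add: free_module_def)

lemma free_module_closed:
  assumes "cring R" "v \<in> carrier (free_module R r)" shows "v i \<in> carrier R"
proof -
  interpret cring R by fact
  show ?thesis using assms(2) by (cases "i < r") auto
qed

lemma free_module_module:
  assumes "cring R" shows "Module.module R (free_module R r)"
proof -
  interpret cring R by fact
  note cl = free_module_closed[OF assms]
  show ?thesis
  proof (rule moduleI)
    show "abelian_group (free_module R r)"
    proof (rule abelian_groupI)
      fix v assume v: "v \<in> carrier (free_module R r)"
      show "\<exists>w\<in>carrier (free_module R r). w \<oplus>\<^bsub>free_module R r\<^esub> v = \<zero>\<^bsub>free_module R r\<^esub>"
        using v cl[OF v] by (intro bexI[of _ "\<lambda>i. \<ominus>\<^bsub>R\<^esub> v i"]) (auto simp: l_neg)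
    next
      fix x y z
      assume "x \<in> carrier (free_module R r)" "y \<in> carrier (free_module R r)" "z \<in> carrier (free_module R r)"
      note c = this[THEN cl]
      show "x \<oplus>\<^bsub>free_module R r\<^esub> y \<oplus>\<^bsub>free_module R r\<^esub> z = x \<oplus>\<^bsub>free_module R r\<^esub> (y \<oplus>\<^bsub>free_module R r\<^esub> z)"
        using c by (simp add: a_assoc)
    next
      fix x y
      assume "x \<in> carrier (free_module R r)" "y \<in> carrier (free_module R r)"
      note c = this[THEN cl]
      show "x \<oplus>\<^bsub>free_module R r\<^esub> y = y \<oplus>\<^bsub>free_module R r\<^esub> x"
        using c by (simp add: a_comm)
    next
      fix x assume "x \<in> carrier (free_module R r)"
      from cl[OF this] show "\<zero>\<^bsub>free_module R r\<^esub> \<oplus>\<^bsub>free_module R r\<^esub> x = x" by simp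
    qed auto
  next
    fix a b x y
    assume ab: "a \<in> carrier R" "b \<in> carrier R" and "x \<in> carrier (free_module R r)" "y \<in> carrier (free_module R r)"
    note c = this(3-)[THEN cl]
    show "(a \<oplus>\<^bsub>R\<^esub> b) \<odot>\<^bsub>free_module R r\<^esub> x = a \<odot>\<^bsub>free_module R r\<^esub> x \<oplus>\<^bsub>free_module R r\<^esub> b \<odot>\<^bsub>free_module R r\<^esub> x"
      "a \<odot>\<^bsub>free_module R r\<^esub> (x \<oplus>\<^bsub>free_module R r\<^esub> y) = a \<odot>\<^bsub>free_module R r\<^esub> x \<oplus>\<^bsub>free_module R r\<^esub> a \<odot>\<^bsub>free_module R r\<^esub> y"
      "a \<otimes>\<^bsub>R\<^esub> b \<odot>\<^bsub>free_module R r\<^esub> x = a \<odot>\<^bsub>free_module R r\<^esub> (b \<odot>\<^bsub>free_module R r\<^esub> x)"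
      using ab c by (simp_all add: l_distr r_distr m_assoc)
  next
    fix x assume "x \<in> carrier (free_module R r)"
    from cl[OF this] show "\<one>\<^bsub>R\<^esub> \<odot>\<^bsub>free_module R r\<^esub> x = x" by simp
  qed (auto simp: assms)
qed

primrec lincomb :: "('a, 'b, 'm) module_scheme \<Rightarrow> (nat \<Rightarrow> 'a) \<Rightarrow> (nat \<Rightarrow> 'b) \<Rightarrow> nat \<Rightarrow> 'b"
  where "lincomb A c x 0 = \<zero>\<^bsub>A\<^esub>"
  | "lincomb A c x (Suc n) = lincomb A c x n \<oplus>\<^bsub>A\<^esub> c n \<odot>\<^bsub>A\<^esub> x n"

context Module.module
begin

lemma lincomb_closed:
  "(\<And>i. i < n \<Longrightarrow> c i \<in> carrier R) \<Longrightarrow> (\<And>i. i < n \<Longrightarrow> x i \<in> carrier M) \<Longrightarrow> lincomb M c x n \<in> carrier M"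
  by (induction n) auto

lemma lincomb_add:
  assumes "\<And>i. i < n \<Longrightarrow> c i \<in> carrier R" "\<And>i. i < n \<Longrightarrow> c' i \<in> carrier R" "\<And>i. i < n \<Longrightarrow> x i \<in> carrier M"
  shows "lincomb M (\<lambda>i. c i \<oplus>\<^bsub>R\<^esub> c' i) x n = lincomb M c x n \<oplus>\<^bsub>M\<^esub> lincomb M c' x n"
  using assms
proof (induction n)
  case (Suc n)
  have "lincomb M c x n \<in> carrier M" "lincomb M c' x n \<in> carrier M" using Suc.prems by (auto intro!: lincomb_closed)
  then show ?case using Suc by (simp add: smult_l_distr M.a_ac)
qed simp

lemma lincomb_smult:
  assumes "a \<in> carrier R" "\<And>i. i < n \<Longrightarrow> c i \<in> carrier R" "\<And>i. i < n \<Longrightarrow> x i \<in> carrier M"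
  shows "lincomb M (\<lambda>i. a \<otimes>\<^bsub>R\<^esub> c i) x n = a \<odot>\<^bsub>M\<^esub> lincomb M c x n"
  using assms
proof (induction n)
  case (Suc n)
  have "lincomb M c x n \<in> carrier M" using Suc.prems by (auto intro!: lincomb_closed)
  then show ?case using Suc by (simp add: smult_r_distr smult_assoc1)
qed simp

end

lemma lincomb_cong:
  "(\<And>i. i < n \<Longrightarrow> c i = c' i) \<Longrightarrow> (\<And>i. i < n \<Longrightarrow> x i = x' i) \<Longrightarrow> lincomb A c x n = lincomb A c' x' n"
  by (induction n) auto

lemma lincomb_hom:
  assumes A: "Module.module R A" and B: "Module.module R B" and f: "f \<in> mod_hom R A B"
    and "\<And>i. i < n \<Longrightarrow> c i \<in> carrier R" "\<And>i. i < n \<Longrightarrow> x i \<in> carrier A"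
  shows "f (lincomb A c x n) = lincomb B c (\<lambda>i. f (x i)) n"
  using assms(4-)
proof (induction n)
  case 0
  then show ?case by (simp add: mod_hom_zero[OF A B f])
next
  case (Suc n)
  have "lincomb A c x n \<in> carrier A" "c n \<odot>\<^bsub>A\<^esub> x n \<in> carrier A"
    using Suc.prems module.lincomb_closed[OF A, of n c x] module.smult_closed[OF A] by auto
  then show ?case using Suc by (simp add: mod_homD[OF f])
qed

lemma unit_vector_closed: "cring R \<Longrightarrow> j < r \<Longrightarrow> unit_vector R j \<in> carrier (free_module R r)"
  by (auto simp: unit_vector_def cring.cring_simprules)

lemma free_module_expansion:
  assumes "cring R" "v \<in> carrier (free_module R r)"
  shows "lincomb (free_module R r) v (unit_vector R) r = v"
proof -
  interpret cring R by fact
  note cl = free_module_closed[OF assms]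
  have "lincomb (free_module R r) v (unit_vector R) n = (\<lambda>i. if i < n then v i else \<zero>\<^bsub>R\<^esub>)" for n
  proof (induction n)
    case (Suc n)
    show ?case
    proof
      fix i
      show "lincomb (free_module R r) v (unit_vector R) (Suc n) i = (if i < Suc n then v i else \<zero>\<^bsub>R\<^esub>)"
        using cl by (cases i n rule: linorder_cases) (simp_all add: Suc unit_vector_def)
    qed
  qed simp
  then show ?thesis using assms(2) by (auto simp: fun_eq_iff not_less)
qed

lemma free_module_projective:
  fixes R :: "('a, 'r) ring_scheme"
  assumes "cring R" shows "projective_module R (free_module R r)"
  unfolding projective_module_def
proof (intro conjI allI impI free_module_module[OF assms])
  let ?F = "free_module R r" and ?e = "unit_vector R"
  fix A B :: "('a, nat \<Rightarrow> 'a) module" and f g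
  assume A: "Module.module R A" and B: "Module.module R B" and f: "f \<in> mod_hom R A B"
    and onto: "f ` carrier A = carrier B" and g: "g \<in> mod_hom R ?F B"
  interpret A: Module.module R A by fact
  have "\<exists>a\<in>carrier A. f a = g (?e j)" if "j < r" for j
    using onto mod_homD(1)[OF g unit_vector_closed[OF assms that]] by (metis imageE)
  then obtain a where a: "\<And>j. j < r \<Longrightarrow> a j \<in> carrier A" "\<And>j. j < r \<Longrightarrow> f (a j) = g (?e j)" by metis
  have "(\<lambda>v. lincomb A v a r) \<in> mod_hom R ?F A"
    by (rule mod_homI) (auto intro!: A.lincomb_closed A.lincomb_add A.lincomb_smult a(1))
  moreover have "f (lincomb A v a r) = g v" if v: "v \<in> carrier ?F" for v
  proof -
    have c: "v i \<in> carrier R" for i using free_module_closed[OF assms v] .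
    have "f (lincomb A v a r) = lincomb B v (\<lambda>i. f (a i)) r"
      using a(1) c by (intro lincomb_hom[OF A B f])
    also have "\<dots> = lincomb B v (\<lambda>i. g (?e i)) r" using a(2) by (intro lincomb_cong) auto
    also have "\<dots> = g (lincomb ?F v ?e r)"
      using c unit_vector_closed[OF assms]
      by (intro lincomb_hom[OF free_module_module[OF assms] B g, symmetric])
    finally show ?thesis by (simp only: free_module_expansion[OF assms v])
  qed
  ultimately show "\<exists>h\<in>mod_hom R ?F A. \<forall>x\<in>carrier ?F. f (h x) = g x"
    by (intro bexI[of _ "\<lambda>v. lincomb A v a r"] ballI)
qed

lemma quot_module_module:
  assumes "cring R" "ideal I R" shows "Module.module R (quot_module R I)"
proof -
  interpret ideal I R by fact
  interpret R: cring R by fact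
  interpret Q: cring "R Quot I" by (rule quotient_is_cring) fact
  have eqs: "carrier (quot_module R I) = carrier (R Quot I)" "zero (quot_module R I) = zero (R Quot I)"
    "add (quot_module R I) = add (R Quot I)"
    "\<And>r X. r \<odot>\<^bsub>quot_module R I\<^esub> X = (I +>\<^bsub>R\<^esub> r) \<otimes>\<^bsub>R Quot I\<^esub> X"
    by (simp_all add: quot_module_def)
  note h = ring_hom_memE[OF rcos_ring_hom]
  show ?thesis
  proof (rule moduleI)
    show "abelian_group (quot_module R I)"
    proof (rule abelian_groupI)
      fix x assume "x \<in> carrier (quot_module R I)"
      then show "\<exists>y\<in>carrier (quot_module R I). y \<oplus>\<^bsub>quot_module R I\<^esub> x = \<zero>\<^bsub>quot_module R I\<^esub>"
        unfolding eqs using Q.l_neg Q.a_inv_closed by blast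
    qed (auto simp: eqs Q.a_ac)
  qed (auto simp: eqs assms h(1) h(2) h(3) h(4) Q.l_distr Q.r_distr Q.m_assoc)
qed

section \<open>Linear algebra for the comparison of ranks\<close>

lemma homogeneous_system_solution:
  fixes X :: "nat \<Rightarrow> 'b \<Rightarrow> 'k::field"
  assumes "finite J" "m < card J"
  shows "\<exists>c. (\<exists>j\<in>J. c j \<noteq> 0) \<and> (\<forall>i<m. (\<Sum>j\<in>J. X i j * c j) = 0)"
  using assms
proof (induction m arbitrary: J X)
  case 0
  then have "J \<noteq> {}" by auto
  then show ?case by (intro exI[of _ "\<lambda>_. 1"]) auto
next
  case (Suc m)
  show ?case
  proof (cases "\<forall>j\<in>J. X m j = 0")
    case True
    have "m < card J" using Suc.prems by simp
    from Suc.IH[OF Suc.prems(1) this, of X] obtain c where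
      "\<exists>j\<in>J. c j \<noteq> 0" "\<forall>i<m. (\<Sum>j\<in>J. X i j * c j) = 0" by blast
    then show ?thesis using True by (intro exI[of _ c]) (auto simp: less_Suc_eq)
  next
    case False
    then obtain p where p: "p \<in> J" "X m p \<noteq> 0" by blast
    \<comment> \<open>Row \<open>i\<close> after clearing column \<open>p\<close> with the pivot row
      \<open>m\<close>; the unknown at \<open>p\<close> is recovered from row \<open>m\<close>
      afterwards.\<close>
    define Y where "Y i j = X i j - X i p * X m j / X m p" for i j
    have "m < card (J - {p})" "finite (J - {p})" using Suc.prems p by simp_all
    from Suc.IH[OF this(2,1), of Y] obtain c where
      c: "\<exists>j\<in>J - {p}. c j \<noteq> 0" "\<forall>i<m. (\<Sum>j\<in>J - {p}. Y i j * c j) = 0" by blast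
    define s where "s = (\<Sum>j\<in>J - {p}. X m j * c j)"
    define c' where "c' = c(p := - s / X m p)"
    have sum: "(\<Sum>j\<in>J. X i j * c' j) = (\<Sum>j\<in>J - {p}. X i j * c j) - X i p * s / X m p" for i
    proof -
      have "(\<Sum>j\<in>J. X i j * c' j) = X i p * c' p + (\<Sum>j\<in>J - {p}. X i j * c' j)"
        using Suc.prems(1) p(1) by (rule sum.remove)
      also have "(\<Sum>j\<in>J - {p}. X i j * c' j) = (\<Sum>j\<in>J - {p}. X i j * c j)"
        by (intro sum.cong) (auto simp: c'_def)
      finally show ?thesis by (simp add: c'_def)
    qed
    have "(\<Sum>j\<in>J - {p}. Y i j * c j) = (\<Sum>j\<in>J - {p}. X i j * c j) - X i p * s / X m p" for i
      by (simp add: Y_def s_def left_diff_distrib sum_subtractf sum_distrib_left sum_divide_distrib mult.assoc)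
    then have "(\<Sum>j\<in>J. X i j * c' j) = 0" if "i < Suc m" for i
      using sum[of i] c(2) that p(2) by (cases "i = m") (auto simp: s_def less_Suc_eq)
    moreover have "\<exists>j\<in>J. c' j \<noteq> 0" using c(1) by (auto simp: c'_def)
    ultimately show ?thesis by blast
  qed
qed

text \<open>For \<open>m < n\<close> the matrix \<open>X\<close> has a nonzero kernel vector, but
  the product \<open>Y X\<close> reproduces every vector.\<close>

lemma left_inverse_dim_le:
  fixes X :: "nat \<Rightarrow> nat \<Rightarrow> 'k::field"
  assumes "\<And>l j. l < n \<Longrightarrow> j < n \<Longrightarrow> (\<Sum>i<m. Y l i * X i j) = (if l = j then 1 else 0)"
  shows "n \<le> m"
proof (rule ccontr)
  assume "\<not> n \<le> m"
  then obtain c where c: "\<exists>j<n. c j \<noteq> 0" "\<forall>i<m. (\<Sum>j<n. X i j * c j) = 0"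
    using homogeneous_system_solution[of "{..<n}" m X] by auto
  have "c l = 0" if "l < n" for l
  proof -
    have "c l = (\<Sum>j<n. (\<Sum>i<m. Y l i * X i j) * c j)"
      using that assms[OF that] by (simp add: if_distrib[of "\<lambda>x. x * _"] cong: if_cong)
    also have "\<dots> = (\<Sum>i<m. Y l i * (\<Sum>j<n. X i j * c j))"
      unfolding sum_distrib_left sum_distrib_right by (subst sum.swap) (simp add: mult.assoc)
    finally show ?thesis using c(2) by simp
  qed
  then show False using c(1) by blast
qed

section \<open>Monomial ideals\<close>

lemma mpoly_ring_simps [simp]:
  "carrier (mpoly_ring V) = {p. \<forall>m\<in>Poly_Mapping.keys p. Poly_Mapping.keys m \<subseteq> V}"
  "p \<otimes>\<^bsub>mpoly_ring V\<^esub> q = p * q" "p \<oplus>\<^bsub>mpoly_ring V\<^esub> q = p + q"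
  "\<one>\<^bsub>mpoly_ring V\<^esub> = 1" "\<zero>\<^bsub>mpoly_ring V\<^esub> = 0"
  by (simp_all add: mpoly_ring_def)

lemma keys_add_nat: "Poly_Mapping.keys (a + b) = Poly_Mapping.keys a \<union> Poly_Mapping.keys (b :: 'v \<Rightarrow>\<^sub>0 nat)"
  by (auto simp: in_keys_iff lookup_add)

lemma mono_dvd_refl: "mono_dvd a a"
  by (simp add: mono_dvd_def)

lemma mono_dvd_trans: "mono_dvd a b \<Longrightarrow> mono_dvd b c \<Longrightarrow> mono_dvd a c"
  using order_trans by (fastforce simp: mono_dvd_def)

lemma mono_dvd_antisym: "mono_dvd a b \<Longrightarrow> mono_dvd b a \<Longrightarrow> a = b"
  by (auto simp: mono_dvd_def intro!: poly_mapping_eqI order_antisym)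

lemma mono_dvd_add: "mono_dvd a (a + b)"
  by (simp add: mono_dvd_def lookup_add)

lemma mono_dvd_diff: "mono_dvd a b \<Longrightarrow> a + (b - a) = b"
  by (auto simp: mono_dvd_def lookup_add lookup_minus intro!: poly_mapping_eqI)

lemma lookup_mult_single:
  fixes p :: "('v \<Rightarrow>\<^sub>0 nat) \<Rightarrow>\<^sub>0 'k::field"
  shows "Poly_Mapping.lookup (p * Poly_Mapping.single m c) k
    = (if mono_dvd m k then Poly_Mapping.lookup p (k - m) * c else 0)"
proof -
  have "(\<Sum>q. Poly_Mapping.lookup (Poly_Mapping.single m c) q when k = l + q) = (c when k = l + m)" for l
  proof -
    have "(\<lambda>q. Poly_Mapping.lookup (Poly_Mapping.single m c) q when k = l + q)
        = (\<lambda>q. (c when k = l + m) when q = m)"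
      by (auto simp: fun_eq_iff lookup_single when_def)
    then show ?thesis by (simp only: Sum_any_when_equal)
  qed
  then have *: "Poly_Mapping.lookup (p * Poly_Mapping.single m c) k
      = (\<Sum>l. Poly_Mapping.lookup p l * (c when k = l + m))"
    by (simp add: lookup_mult)
  show ?thesis
  proof (cases "mono_dvd m k")
    case True
    have "k = l + m \<longleftrightarrow> l = k - m" for l
      using mono_dvd_diff[OF True] by (metis add.commute add_diff_cancel_right')
    then have "(\<lambda>l. Poly_Mapping.lookup p l * (c when k = l + m))
        = (\<lambda>l. (Poly_Mapping.lookup p (k - m) * c) when l = k - m)"
      by (auto simp: fun_eq_iff when_def)
    then show ?thesis unfolding * using True by (simp only: Sum_any_when_equal if_True)
  next
    case False
    then have "k \<noteq> l + m" for l using mono_dvd_add[of m l] by (auto simp: add.commute)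
    then show ?thesis using False unfolding * by simp
  qed
qed

text \<open>Exponent vectors sum to zero only if both are zero. Taking constant terms is reduction
  modulo the irrelevant ideal and turns polynomial matrices into scalar ones.\<close>

lemma lookup_mult_zero:
  fixes p q :: "('v \<Rightarrow>\<^sub>0 nat) \<Rightarrow>\<^sub>0 'k::field"
  shows "Poly_Mapping.lookup (p * q) 0 = Poly_Mapping.lookup p 0 * Poly_Mapping.lookup q 0"
proof -
  have z: "0 = l + q \<longleftrightarrow> l = 0 \<and> q = 0" for l q :: "'v \<Rightarrow>\<^sub>0 nat"
    by (auto simp: poly_mapping_eq_iff lookup_add fun_eq_iff)
  have "(\<Sum>r. Poly_Mapping.lookup q r when 0 = l + r) = (Poly_Mapping.lookup q 0 when l = 0)" for l
  proof -
    have "(\<lambda>r. Poly_Mapping.lookup q r when 0 = l + r) = (\<lambda>r. (Poly_Mapping.lookup q 0 when l = 0) when r = 0)"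
      by (auto simp: fun_eq_iff when_def z)
    then show ?thesis by (simp only: Sum_any_when_equal)
  qed
  then have "Poly_Mapping.lookup (p * q) 0
      = (\<Sum>l. Poly_Mapping.lookup p l * (Poly_Mapping.lookup q 0 when l = 0))"
    by (simp add: lookup_mult)
  also have "(\<lambda>l. Poly_Mapping.lookup p l * (Poly_Mapping.lookup q 0 when l = 0))
      = (\<lambda>l. (Poly_Mapping.lookup p 0 * Poly_Mapping.lookup q 0) when l = 0)"
    by (auto simp: fun_eq_iff when_def)
  finally show ?thesis by (simp only: Sum_any_when_equal)
qed

lemma sum_of_terms:
  "p = (\<Sum>m\<in>Poly_Mapping.keys p. Poly_Mapping.single m (Poly_Mapping.lookup p m))"
  by (rule poly_mapping_eqI) (simp add: lookup_sum lookup_single when_def in_keys_iff)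

lemma mpoly_ring_cring: "cring (mpoly_ring V :: (('v \<Rightarrow>\<^sub>0 nat) \<Rightarrow>\<^sub>0 'k::field) ring)"
proof (rule cringI)
  have add: "p + q \<in> carrier (mpoly_ring V)"
    if "p \<in> carrier (mpoly_ring V)" "q \<in> carrier (mpoly_ring V)" for p q :: "('v \<Rightarrow>\<^sub>0 nat) \<Rightarrow>\<^sub>0 'k"
    using that keys_add[of p q] by fastforce
  show "abelian_group (mpoly_ring V :: (('v \<Rightarrow>\<^sub>0 nat) \<Rightarrow>\<^sub>0 'k) ring)"
  proof (rule abelian_groupI)
    fix p :: "('v \<Rightarrow>\<^sub>0 nat) \<Rightarrow>\<^sub>0 'k" assume "p \<in> carrier (mpoly_ring V)"
    moreover have "Poly_Mapping.keys (- p) = Poly_Mapping.keys p" by (auto simp: in_keys_iff)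
    ultimately show "\<exists>q\<in>carrier (mpoly_ring V). q \<oplus>\<^bsub>mpoly_ring V\<^esub> p = \<zero>\<^bsub>mpoly_ring V\<^esub>"
      by (intro bexI[of _ "- p"]) auto
  next
    show "p \<oplus>\<^bsub>mpoly_ring V\<^esub> q \<in> carrier (mpoly_ring V)"
      if "p \<in> carrier (mpoly_ring V)" "q \<in> carrier (mpoly_ring V)" for p q :: "('v \<Rightarrow>\<^sub>0 nat) \<Rightarrow>\<^sub>0 'k"
      using add[OF that] by (simp only: mpoly_ring_simps)
  qed (simp_all add: add_ac)
  have mult: "p * q \<in> carrier (mpoly_ring V)"
    if "p \<in> carrier (mpoly_ring V)" "q \<in> carrier (mpoly_ring V)" for p q :: "('v \<Rightarrow>\<^sub>0 nat) \<Rightarrow>\<^sub>0 'k"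
    using that keys_mult[of p q] by (fastforce simp: keys_add_nat)
  show "comm_monoid (mpoly_ring V :: (('v \<Rightarrow>\<^sub>0 nat) \<Rightarrow>\<^sub>0 'k) ring)"
  proof (rule comm_monoidI)
    show "p \<otimes>\<^bsub>mpoly_ring V\<^esub> q \<in> carrier (mpoly_ring V)"
      if "p \<in> carrier (mpoly_ring V)" "q \<in> carrier (mpoly_ring V)" for p q :: "('v \<Rightarrow>\<^sub>0 nat) \<Rightarrow>\<^sub>0 'k"
      using mult[OF that] by (simp only: mpoly_ring_simps)
  qed (simp_all add: mult_ac)
qed (simp add: distrib_right)

lemma a_inv_mpoly_ring:
  fixes p :: "('v \<Rightarrow>\<^sub>0 nat) \<Rightarrow>\<^sub>0 'k::field"
  assumes "p \<in> carrier (mpoly_ring V)" shows "\<ominus>\<^bsub>mpoly_ring V\<^esub> p = - p"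
proof -
  interpret cring "mpoly_ring V :: (('v \<Rightarrow>\<^sub>0 nat) \<Rightarrow>\<^sub>0 'k) ring" by (rule mpoly_ring_cring)
  have "Poly_Mapping.keys (- p) = Poly_Mapping.keys p" by (auto simp: in_keys_iff)
  then show ?thesis using assms by (intro minus_equality) simp_all
qed

lemma ideal_sum_mem:
  fixes I :: "(('v \<Rightarrow>\<^sub>0 nat) \<Rightarrow>\<^sub>0 'k::field) set"
  assumes "ideal I (mpoly_ring V)" "finite A" "\<And>a. a \<in> A \<Longrightarrow> f a \<in> I"
  shows "(\<Sum>a\<in>A. f a) \<in> I"
proof -
  have I: "additive_subgroup I (mpoly_ring V)" by (rule ideal.axioms(1)[OF assms(1)])
  show ?thesis using assms(2,3)
  proof (induction A rule: finite_induct)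
    case empty
    show ?case using additive_subgroup.zero_closed[OF I] by simp
  next
    case (insert a A)
    then show ?case using additive_subgroup.a_closed[OF I, of "f a" "sum f A"] by simp
  qed
qed

text \<open>The right-hand side is an ideal containing the monomials; conversely each term of a
  member is a multiple of a monomial from \<open>A\<close>. Membership becomes a question about
  exponents.\<close>

lemma generated_by_monomials_eq:
  assumes A: "A \<subseteq> monomials_in V"
  shows "(generated_by_monomials V A :: (('v \<Rightarrow>\<^sub>0 nat) \<Rightarrow>\<^sub>0 'k::field) set)
    = {p. \<forall>m\<in>Poly_Mapping.keys p. Poly_Mapping.keys m \<subseteq> V \<and> (\<exists>a\<in>A. mono_dvd a m)}" (is "_ = ?J")
proof -
  let ?S = "mpoly_ring V :: (('v \<Rightarrow>\<^sub>0 nat) \<Rightarrow>\<^sub>0 'k) ring"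
  interpret cring ?S by (rule mpoly_ring_cring)
  have gens: "mono_poly ` A \<subseteq> carrier ?S"
    using A by (auto simp: mono_poly_def monomials_in_def)
  have "ideal ?J ?S"
  proof (rule idealI[OF ring_axioms])
    show "subgroup ?J (add_monoid ?S)"
    proof
      show "inv\<^bsub>add_monoid ?S\<^esub> p \<in> ?J" if "p \<in> ?J" for p
      proof -
        have "Poly_Mapping.keys (- p) = Poly_Mapping.keys p" by (auto simp: in_keys_iff)
        moreover have "inv\<^bsub>add_monoid ?S\<^esub> p = - p"
          using that a_inv_mpoly_ring[of p V] by (auto simp: a_inv_def)
        ultimately show ?thesis using that by simp
      qed
      show "p \<otimes>\<^bsub>add_monoid ?S\<^esub> q \<in> ?J" if "p \<in> ?J" "q \<in> ?J" for p q
        using that keys_add[of p q] by fastforce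
    qed auto
  next
    fix p q assume p: "p \<in> ?J" and q: "q \<in> carrier ?S"
    have "Poly_Mapping.keys m \<subseteq> V \<and> (\<exists>a\<in>A. mono_dvd a m)" if m: "m \<in> Poly_Mapping.keys (p * q)" for m
    proof -
      obtain u w where uw: "u \<in> Poly_Mapping.keys p" "w \<in> Poly_Mapping.keys q" "m = u + w"
        using m keys_mult[of p q] by blast
      then obtain a where "a \<in> A" "mono_dvd a u" using p by blast
      then have "\<exists>a\<in>A. mono_dvd a m" using mono_dvd_trans[OF _ mono_dvd_add] uw(3) by blast
      then show ?thesis using uw p q by (auto simp: keys_add_nat)
    qed
    then show "p \<otimes>\<^bsub>?S\<^esub> q \<in> ?J" "q \<otimes>\<^bsub>?S\<^esub> p \<in> ?J" by (auto simp: mult.commute)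
  qed
  moreover have "mono_poly ` A \<subseteq> ?J"
    using A mono_dvd_refl by (fastforce simp: mono_poly_def monomials_in_def)
  ultimately have "genideal ?S (mono_poly ` A) \<subseteq> ?J" by (rule genideal_minimal)
  moreover have "?J \<subseteq> genideal ?S (mono_poly ` A)"
  proof
    fix p assume p: "p \<in> ?J"
    interpret I: ideal "genideal ?S (mono_poly ` A)" ?S by (rule genideal_ideal[OF gens])
    have "(\<Sum>m\<in>Poly_Mapping.keys p. Poly_Mapping.single m (Poly_Mapping.lookup p m)) \<in> genideal ?S (mono_poly ` A)"
    proof (rule ideal_sum_mem[OF I.is_ideal])
      fix m assume m: "m \<in> Poly_Mapping.keys p"
      then obtain a where a: "a \<in> A" "mono_dvd a m" using p by blast
      let ?q = "Poly_Mapping.single (m - a) (Poly_Mapping.lookup p m)"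
      have "Poly_Mapping.keys m \<subseteq> V" using p m by blast
      then have "?q \<in> carrier ?S" by (auto simp: in_keys_iff lookup_minus)
      moreover have "mono_poly a \<in> genideal ?S (mono_poly ` A)"
        using genideal_self[OF gens] a(1) by blast
      ultimately have "mono_poly a * ?q \<in> genideal ?S (mono_poly ` A)"
        using I.I_r_closed by fastforce
      then show "Poly_Mapping.single m (Poly_Mapping.lookup p m) \<in> genideal ?S (mono_poly ` A)"
        by (simp add: mono_poly_def mult_single mono_dvd_diff[OF a(2)])
    qed simp
    then show "p \<in> genideal ?S (mono_poly ` A)" using sum_of_terms[of p] by simp
  qed
  ultimately show ?thesis unfolding generated_by_monomials_def by blast
qed

lemma generated_by_monomials_ideal:
  assumes "A \<subseteq> monomials_in V"
  shows "ideal (generated_by_monomials V A :: (('v \<Rightarrow>\<^sub>0 nat) \<Rightarrow>\<^sub>0 'k::field) set) (mpoly_ring V)"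
proof -
  interpret cring "mpoly_ring V :: (('v \<Rightarrow>\<^sub>0 nat) \<Rightarrow>\<^sub>0 'k) ring" by (rule mpoly_ring_cring)
  show ?thesis unfolding generated_by_monomials_def
    using assms by (intro genideal_ideal) (auto simp: mono_poly_def monomials_in_def)
qed

definition mono_antichain :: "('v \<Rightarrow>\<^sub>0 nat) set \<Rightarrow> bool"
  where "mono_antichain A \<longleftrightarrow> (\<forall>a\<in>A. \<forall>b\<in>A. mono_dvd a b \<longrightarrow> a = b)"

text \<open>An \<open>a\<close> in \<open>A\<close> is divisible by some \<open>h\<close> in
  \<open>H\<close>, and \<open>h\<close> by an element of \<open>A\<close>, which can only be
  \<open>a\<close>; so \<open>h = a\<close>. This evaluates the definite description in
  \<open>min_gens\<close>.\<close>

lemma antichain_subset_generators: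
  fixes A :: "('v \<Rightarrow>\<^sub>0 nat) set"
  assumes A: "A \<subseteq> monomials_in V" "mono_antichain A" and H: "H \<subseteq> monomials_in V"
    and eq: "(generated_by_monomials V H :: (('v \<Rightarrow>\<^sub>0 nat) \<Rightarrow>\<^sub>0 'k::field) set) = generated_by_monomials V A"
  shows "A \<subseteq> H"
proof
  have mem: "(mono_poly m :: ('v \<Rightarrow>\<^sub>0 nat) \<Rightarrow>\<^sub>0 'k) \<in> generated_by_monomials V B \<longleftrightarrow> (\<exists>b\<in>B. mono_dvd b m)"
    if "m \<in> monomials_in V" "B \<subseteq> monomials_in V" for m B
    using that(1) unfolding generated_by_monomials_eq[OF that(2)] by (auto simp: mono_poly_def monomials_in_def)
  fix a assume a: "a \<in> A"
  have aV: "a \<in> monomials_in V" using a A(1) by blast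
  then have "(mono_poly a :: ('v \<Rightarrow>\<^sub>0 nat) \<Rightarrow>\<^sub>0 'k) \<in> generated_by_monomials V H"
    unfolding eq using a mem[OF aV A(1)] mono_dvd_refl by blast
  then obtain h where h: "h \<in> H" "mono_dvd h a" using mem[OF aV H] by blast
  have hV: "h \<in> monomials_in V" using h(1) H by blast
  then have "(mono_poly h :: ('v \<Rightarrow>\<^sub>0 nat) \<Rightarrow>\<^sub>0 'k) \<in> generated_by_monomials V A"
    unfolding eq[symmetric] using h(1) mem[OF hV H] mono_dvd_refl by blast
  then obtain a' where a': "a' \<in> A" "mono_dvd a' h" using mem[OF hV A(1)] by blast
  then have "a' = a" using A(2) a mono_dvd_trans[OF a'(2) h(2)] unfolding mono_antichain_def by blast
  then show "a \<in> H" using h a'(2) mono_dvd_antisym by blast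
qed

lemma min_gens_antichain:
  fixes A :: "('v \<Rightarrow>\<^sub>0 nat) set"
  assumes "A \<subseteq> monomials_in V" "mono_antichain A"
  shows "min_gens V (generated_by_monomials V A :: (('v \<Rightarrow>\<^sub>0 nat) \<Rightarrow>\<^sub>0 'k::field) set) = A"
  unfolding min_gens_def
proof (rule the_equality)
  let ?I = "generated_by_monomials V :: _ \<Rightarrow> (('v \<Rightarrow>\<^sub>0 nat) \<Rightarrow>\<^sub>0 'k) set"
  note sub = antichain_subset_generators[OF assms, where 'k = 'k]
  show "A \<subseteq> monomials_in V \<and> ?I A = ?I A \<and> (\<forall>H. H \<subset> A \<longrightarrow> ?I H \<noteq> ?I A)"
    using assms(1) sub by blast
  show "H = A" if "H \<subseteq> monomials_in V \<and> ?I H = ?I A \<and> (\<forall>K. K \<subset> H \<longrightarrow> ?I K \<noteq> ?I A)" for H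
    using that sub[of H] by blast
qed

text \<open>Proper division lowers the total degree, so every element has a divisor in
  \<open>A\<close> that is minimal under division.\<close>

lemma antichain_generators_exist:
  fixes A :: "('n::finite \<Rightarrow>\<^sub>0 nat) set"
  obtains B where "B \<subseteq> A" "mono_antichain B" "\<And>a. a \<in> A \<Longrightarrow> \<exists>b\<in>B. mono_dvd b a"
proof -
  define deg where "deg m = (\<Sum>i\<in>UNIV. Poly_Mapping.lookup m i)" for m :: "'n \<Rightarrow>\<^sub>0 nat"
  have less: "deg a < deg b" if "mono_dvd a b" "a \<noteq> b" for a b
  proof -
    have "\<exists>i. Poly_Mapping.lookup a i \<noteq> Poly_Mapping.lookup b i"
      using that(2) by (auto intro: poly_mapping_eqI)
    then show ?thesis
      using that(1) unfolding deg_def mono_dvd_def by (intro sum_strict_mono_ex1) (auto simp: nat_less_le)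
  qed
  define B where "B = {b \<in> A. \<forall>a\<in>A. mono_dvd a b \<longrightarrow> a = b}"
  have "\<exists>b\<in>B. mono_dvd b a" if "a \<in> A" for a
    using that
  proof (induction "deg a" arbitrary: a rule: less_induct)
    case less: (less a)
    show ?case
    proof (cases "a \<in> B")
      case True
      then show ?thesis using mono_dvd_refl by blast
    next
      case False
      then obtain a' where "a' \<in> A" "mono_dvd a' a" "a' \<noteq> a" using less.prems unfolding B_def by blast
      then show ?thesis using less.hyps[of a'] \<open>\<And>b a. mono_dvd a b \<Longrightarrow> a \<noteq> b \<Longrightarrow> deg a < deg b\<close> mono_dvd_trans by meson
    qed
  qed
  then show ?thesis by (intro that[of B]) (auto simp: B_def mono_antichain_def)
qed

lemma irrelevant_ideal_iff:
  fixes p :: "('n \<Rightarrow>\<^sub>0 nat) \<Rightarrow>\<^sub>0 'k::field"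
  shows "p \<in> irrelevant_ideal \<longleftrightarrow> Poly_Mapping.lookup p 0 = 0"
proof -
  have dvd: "(\<exists>i. mono_dvd (Poly_Mapping.single i 1) m) \<longleftrightarrow> m \<noteq> 0" for m :: "'n \<Rightarrow>\<^sub>0 nat"
  proof -
    have "mono_dvd (Poly_Mapping.single i 1) m \<longleftrightarrow> Poly_Mapping.lookup m i \<noteq> 0" for i
      by (auto simp: mono_dvd_def lookup_single when_def)
    then show ?thesis by (auto simp: poly_mapping_eq_iff fun_eq_iff)
  qed
  have "p \<in> irrelevant_ideal \<longleftrightarrow> (\<forall>m\<in>Poly_Mapping.keys p. m \<noteq> 0)"
    unfolding irrelevant_ideal_def
    by (subst generated_by_monomials_eq) (auto simp: monomials_in_def dvd simp del: One_nat_def)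
  then show ?thesis by (auto simp: in_keys_iff)
qed

section \<open>From scalar complexes to polynomial resolutions\<close>

definition mono_of :: "('n::finite \<Rightarrow> nat) \<Rightarrow> 'n \<Rightarrow>\<^sub>0 nat"
  where "mono_of f = Abs_poly_mapping f"

lemma lookup_mono_of [simp]: "Poly_Mapping.lookup (mono_of f) = f"
  by (simp add: mono_of_def)

lemma mono_of_lookup [simp]: "mono_of (Poly_Mapping.lookup m) = m"
  by (simp add: mono_of_def)

lemma mono_of_eq_iff [simp]: "mono_of f = mono_of g \<longleftrightarrow> f = g"
  by (metis lookup_mono_of)

lemma mono_dvd_mono_of: "mono_dvd (mono_of f) (mono_of g) \<longleftrightarrow> f \<le> g"
  by (simp add: mono_dvd_def le_fun_def)

lemma mono_of_diff: "mono_of f - mono_of g = mono_of (\<lambda>x. f x - g x)"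
  by (rule poly_mapping_eqI) (simp add: lookup_minus)

abbreviation poly_vectors :: "nat \<Rightarrow> (nat \<Rightarrow> (('n \<Rightarrow>\<^sub>0 nat) \<Rightarrow>\<^sub>0 'k::field)) set"
  where "poly_vectors r \<equiv> carrier (free_module (mpoly_ring UNIV) r)"

lemma unit_vector_mpoly_ring: "unit_vector (mpoly_ring V) j = (\<lambda>i. if i = j then 1 else 0)"
  by (auto simp: unit_vector_def fun_eq_iff)

context multigraded_exact_complex
begin

text \<open>\<open>homog_part i a v\<close> is the part of degree \<open>a\<close> of an element of the \<open>i\<close>-th free module, whose
  \<open>j\<close>-th generator has degree \<open>dg i j\<close>.\<close>

definition homog_part :: "nat \<Rightarrow> ('n \<Rightarrow> nat) \<Rightarrow> (nat \<Rightarrow> (('n \<Rightarrow>\<^sub>0 nat) \<Rightarrow>\<^sub>0 'k)) \<Rightarrow> nat \<Rightarrow> 'k"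
  where "homog_part i a v =
    (\<lambda>j. if j < b i \<and> dg i j \<le> a then Poly_Mapping.lookup (v j) (mono_of (\<lambda>x. a x - dg i j x)) else 0)"

definition poly_bdy :: "nat \<Rightarrow> (nat \<Rightarrow> (('n \<Rightarrow>\<^sub>0 nat) \<Rightarrow>\<^sub>0 'k)) \<Rightarrow> nat \<Rightarrow> (('n \<Rightarrow>\<^sub>0 nat) \<Rightarrow>\<^sub>0 'k)"
  where "poly_bdy i v = (\<lambda>l. if l < b i then \<Sum>j<b (Suc i).
      v j * Poly_Mapping.single (mono_of (\<lambda>x. dg (Suc i) j x - dg i l x)) (D i l j) else 0)"

lemma homog_part_vecs: "homog_part i a v \<in> vecs i {..a}"
  by (auto simp: homog_part_def vecs_def)

lemma poly_bdy_vectors: "poly_bdy i v \<in> poly_vectors (b i)"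
  by (simp add: poly_bdy_def)

text \<open>In degree \<open>a\<close>, entry \<open>j\<close> is read at exponent
  \<open>a - dg (Suc i) j\<close> and entry \<open>l\<close> at \<open>a - dg i l\<close>, and the
  monomial in the matrix is their difference. The order of degrees at nonzero coefficients keeps the
  subtractions of naturals exact.\<close>

lemma homog_part_poly_bdy: "homog_part i a (poly_bdy i v) = bdy (Suc i) (homog_part (Suc i) a v)"
proof
  fix l
  have eq: "(if dg i l \<le> a then Poly_Mapping.lookup
        (v j * Poly_Mapping.single (mono_of (\<lambda>x. dg (Suc i) j x - dg i l x)) (D i l j))
        (mono_of (\<lambda>x. a x - dg i l x)) else 0) = D i l j * homog_part (Suc i) a v j"
    if l: "l < b i" and j: "j < b (Suc i)" for j
  proof (cases "D i l j = 0")
    case False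
    have le: "dg i l \<le> dg (Suc i) j" by (rule D_deg[OF l j False])
    show ?thesis
    proof (cases "dg i l \<le> a")
      case True
      have "dg (Suc i) j x - dg i l x \<le> a x - dg i l x \<longleftrightarrow> dg (Suc i) j x \<le> a x"
        "(a x - dg i l x) - (dg (Suc i) j x - dg i l x) = a x - dg (Suc i) j x" for x
        using le_funD[OF le, of x] le_funD[OF True, of x] by auto
      then show ?thesis
        using True j by (simp add: lookup_mult_single mono_dvd_mono_of mono_of_diff le_fun_def homog_part_def)
    next
      case False
      then have "\<not> dg (Suc i) j \<le> a" using le by (meson order_trans)
      then show ?thesis using False by (simp add: homog_part_def)
    qed
  qed simp
  show "homog_part i a (poly_bdy i v) l = bdy (Suc i) (homog_part (Suc i) a v) l"
  proof (cases "l < b i")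
    case True
    have "homog_part i a (poly_bdy i v) l = (\<Sum>j<b (Suc i). if dg i l \<le> a then Poly_Mapping.lookup
        (v j * Poly_Mapping.single (mono_of (\<lambda>x. dg (Suc i) j x - dg i l x)) (D i l j))
        (mono_of (\<lambda>x. a x - dg i l x)) else 0)"
      using True by (simp add: homog_part_def poly_bdy_def lookup_sum)
    also have "\<dots> = (\<Sum>j<b (Suc i). D i l j * homog_part (Suc i) a v j)"
      using eq[OF True] by (intro sum.cong) auto
    finally show ?thesis using True by (simp add: bdy_Suc)
  qed (simp add: homog_part_def bdy_Suc)
qed

lemma lookup_eq_homog_part:
  assumes "j < b i"
  shows "Poly_Mapping.lookup (v j) m = homog_part i (\<lambda>x. Poly_Mapping.lookup m x + dg i j x) v j"
  using assms by (simp add: homog_part_def le_fun_def)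

lemma homog_part_inject:
  assumes "v \<in> poly_vectors (b i)" "w \<in> poly_vectors (b i)" "\<And>a. homog_part i a v = homog_part i a w"
  shows "v = w"
proof
  fix j
  show "v j = w j"
  proof (cases "j < b i")
    case True
    then show ?thesis using assms(3) by (intro poly_mapping_eqI) (simp add: lookup_eq_homog_part)
  next
    case False
    then show ?thesis using assms(1,2) by simp
  qed
qed

lemma finite_homog_parts: "finite {a. homog_part i a v \<noteq> 0}"
proof (rule finite_subset)
  show "{a. homog_part i a v \<noteq> 0} \<subseteq>
    (\<Union>j<b i. (\<lambda>m x. Poly_Mapping.lookup m x + dg i j x) ` Poly_Mapping.keys (v j))"
  proof
    fix a assume "a \<in> {a. homog_part i a v \<noteq> 0}"
    then obtain j where j: "j < b i" "dg i j \<le> a" "Poly_Mapping.lookup (v j) (mono_of (\<lambda>x. a x - dg i j x)) \<noteq> 0"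
      by (auto simp: homog_part_def fun_eq_iff split: if_splits)
    have "a = (\<lambda>x. Poly_Mapping.lookup (mono_of (\<lambda>x. a x - dg i j x)) x + dg i j x)"
      using j(2) by (auto simp: le_fun_def fun_eq_iff)
    then show "a \<in> (\<Union>j<b i. (\<lambda>m x. Poly_Mapping.lookup m x + dg i j x) ` Poly_Mapping.keys (v j))"
      using j(1,3) by (auto simp: in_keys_iff intro!: bexI[of _ j] image_eqI)
  qed
qed simp

text \<open>Each prescribed coordinate becomes one term, and different degrees give different terms
  in the same entry.\<close>

lemma homog_part_assemble:
  assumes "finite A" "\<And>a. a \<in> A \<Longrightarrow> w a \<in> vecs i {..a}"
  obtains v where "v \<in> poly_vectors (b i)" "\<And>a. homog_part i a v = (if a \<in> A then w a else 0)"
proof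
  define v where "v j = (if j < b i then \<Sum>a\<in>A. if dg i j \<le> a
      then Poly_Mapping.single (mono_of (\<lambda>x. a x - dg i j x)) (w a j) else 0 else 0)" for j
  show "v \<in> poly_vectors (b i)" by (simp add: v_def)
  show "homog_part i a v = (if a \<in> A then w a else 0)" for a
  proof
    fix j
    show "homog_part i a v j = (if a \<in> A then w a else 0) j"
    proof (cases "j < b i \<and> dg i j \<le> a")
      case True
      have eq: "(\<lambda>x. c x - dg i j x) = (\<lambda>x. a x - dg i j x) \<longleftrightarrow> c = a" if "dg i j \<le> c" for c
        using that True by (auto simp: fun_eq_iff le_fun_def) (metis le_add_diff_inverse)
      have "homog_part i a v j = (\<Sum>c\<in>A. if dg i j \<le> c then Poly_Mapping.lookup
          (Poly_Mapping.single (mono_of (\<lambda>x. c x - dg i j x)) (w c j)) (mono_of (\<lambda>x. a x - dg i j x)) else 0)"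
        using True by (auto simp: homog_part_def v_def lookup_sum intro!: sum.cong)
      also have "\<dots> = (\<Sum>c\<in>A. if c = a then w a j else 0)"
        using True eq by (intro sum.cong) (auto simp: lookup_single when_def)
      finally show ?thesis using assms(1) by simp
    next
      case False
      then have "w a j = 0" if "a \<in> A" using assms(2)[OF that] by (auto simp: vecs_def)
      then show ?thesis using False by (auto simp: homog_part_def)
    qed
  qed
qed

text \<open>The differential preserves degrees, so preimages are chosen degree by degree; only
  finitely many parts are nonzero, so the choices assemble to one polynomial vector.\<close>

lemma poly_bdy_image_iff:
  assumes v: "v \<in> poly_vectors (b i)"
  shows "v \<in> poly_bdy i ` poly_vectors (b (Suc i)) \<longleftrightarrow>
    (\<forall>a. homog_part i a v \<in> bdy (Suc i) ` vecs (Suc i) {..a})"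
proof
  assume "v \<in> poly_bdy i ` poly_vectors (b (Suc i))"
  then obtain u where "v = poly_bdy i u" by blast
  then show "\<forall>a. homog_part i a v \<in> bdy (Suc i) ` vecs (Suc i) {..a}"
    using homog_part_poly_bdy homog_part_vecs by simp
next
  assume "\<forall>a. homog_part i a v \<in> bdy (Suc i) ` vecs (Suc i) {..a}"
  then have "\<forall>a. \<exists>w. w \<in> vecs (Suc i) {..a} \<and> homog_part i a v = bdy (Suc i) w" by blast
  from choice[OF this] obtain w where w: "\<And>a. w a \<in> vecs (Suc i) {..a}"
    "\<And>a. homog_part i a v = bdy (Suc i) (w a)" by blast
  define A where "A = {a. homog_part i a v \<noteq> 0}"
  have "finite A" unfolding A_def by (rule finite_homog_parts)
  from homog_part_assemble[OF this, of w "Suc i"] w(1) obtain u where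
    u: "u \<in> poly_vectors (b (Suc i))" "\<And>a. homog_part (Suc i) a u = (if a \<in> A then w a else 0)" by blast
  have "homog_part i a (poly_bdy i u) = homog_part i a v" for a
    using w(2)[of a] by (simp add: homog_part_poly_bdy u(2) A_def)
  then have "poly_bdy i u = v" by (intro homog_part_inject[OF poly_bdy_vectors v])
  then show "v \<in> poly_bdy i ` poly_vectors (b (Suc i))" using u(1) by blast
qed

lemma poly_bdy_kernel:
  assumes v: "v \<in> poly_vectors (b (Suc i))"
  shows "poly_bdy i v = (\<lambda>_. 0) \<longleftrightarrow> v \<in> poly_bdy (Suc i) ` poly_vectors (b (Suc (Suc i)))"
proof -
  have "(\<lambda>_. 0) \<in> poly_vectors (b i)" by simp
  moreover have "homog_part i a (\<lambda>_. 0) = 0" for a by (auto simp: homog_part_def fun_eq_iff)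
  ultimately have "poly_bdy i v = (\<lambda>_. 0) \<longleftrightarrow> (\<forall>a. homog_part i a (poly_bdy i v) = 0)"
    using homog_part_inject[OF poly_bdy_vectors, of "\<lambda>_. 0" i v] by auto
  also have "\<dots> \<longleftrightarrow> (\<forall>a. homog_part (Suc i) a v \<in> bdy (Suc (Suc i)) ` vecs (Suc (Suc i)) {..a})"
    unfolding homog_part_poly_bdy
  proof (intro all_cong1 iffI)
    fix a assume "bdy (Suc i) (homog_part (Suc i) a v) = 0"
    then show "homog_part (Suc i) a v \<in> bdy (Suc (Suc i)) ` vecs (Suc (Suc i)) {..a}"
      using exact[OF homog_part_vecs] by (metis imageI)
  next
    fix a assume "homog_part (Suc i) a v \<in> bdy (Suc (Suc i)) ` vecs (Suc (Suc i)) {..a}"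
    then show "bdy (Suc i) (homog_part (Suc i) a v) = 0" using bdy_bdy by auto
  qed
  finally show ?thesis unfolding poly_bdy_image_iff[OF v] .
qed

lemma poly_bdy_hom:
  "poly_bdy i \<in> mod_hom (mpoly_ring UNIV) (free_module (mpoly_ring UNIV) (b (Suc i))) (free_module (mpoly_ring UNIV) (b i))"
proof (rule mod_homI)
  show "poly_bdy i (v \<oplus>\<^bsub>free_module (mpoly_ring UNIV) (b (Suc i))\<^esub> w)
      = poly_bdy i v \<oplus>\<^bsub>free_module (mpoly_ring UNIV) (b i)\<^esub> poly_bdy i w" for v w
    by (simp add: poly_bdy_def fun_eq_iff distrib_right sum.distrib)
  show "poly_bdy i (r \<odot>\<^bsub>free_module (mpoly_ring UNIV) (b (Suc i))\<^esub> v)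
      = r \<odot>\<^bsub>free_module (mpoly_ring UNIV) (b i)\<^esub> poly_bdy i v" for r v
    by (simp add: poly_bdy_def fun_eq_iff sum_distrib_left mult.assoc)
qed (rule poly_bdy_vectors)

text \<open>At a nonzero summand the chain \<open>dg i l \<le> dg (Suc i) j \<le> a = dg i l\<close>
  collapses, contradicting \<open>minimal\<close>.\<close>

lemma bdy_minimal:
  assumes "w \<in> vecs (Suc i) {..a}" "l < b i" "dg i l = a" shows "bdy (Suc i) w l = 0"
proof -
  have "(\<Sum>j<b (Suc i). D i l j * w j) = 0"
  proof (rule sum.neutral, rule ballI)
    fix j assume j: "j \<in> {..<b (Suc i)}"
    show "D i l j * w j = 0"
    proof (rule ccontr)
      assume nz: "D i l j * w j \<noteq> 0"
      then have "dg i l \<le> dg (Suc i) j" "dg (Suc i) j \<le> a"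
        using D_deg[of l i j] assms j by (auto simp: vecs_def)
      then have "dg i l = dg (Suc i) j" using assms(3) by simp
      then show False using minimal[of l i j] assms(2) j nz by simp
    qed
  qed
  then show ?thesis by (simp add: bdy_Suc)
qed

text \<open>\<open>U\<close> collects the exponents of the monomials in \<open>M\<close>, and
  \<open>W\<close> identifies the image of the first differential with the degree parts of
  \<open>M\<close>; exactness and minimality then transfer degree by degree.\<close>

theorem minimal_free_resolution_of_complex:
  fixes M :: "(('n \<Rightarrow>\<^sub>0 nat) \<Rightarrow>\<^sub>0 'k) set"
  assumes M: "ideal M (mpoly_ring UNIV)" and U: "\<And>p. p \<in> M \<longleftrightarrow> (\<forall>m\<in>Poly_Mapping.keys p. Poly_Mapping.lookup m \<in> U)"
    and b0: "b 0 = 1" and dg0: "dg 0 = (\<lambda>_ _. 0)"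
    and W: "\<And>a. bdy 1 ` vecs 1 {..a} = {v. (\<forall>j. v j \<noteq> 0 \<longrightarrow> j = 0) \<and> (v 0 \<noteq> 0 \<longrightarrow> a \<in> U)}"
  shows "minimal_free_resolution M b (\<lambda>i j. mono_of (dg i j)) poly_bdy (\<lambda>v. M +>\<^bsub>mpoly_ring UNIV\<^esub> v 0)"
proof -
  let ?S = "mpoly_ring UNIV :: (('n \<Rightarrow>\<^sub>0 nat) \<Rightarrow>\<^sub>0 'k) ring"
  let ?F = "\<lambda>i. free_module ?S (b i)" and ?\<epsilon> = "\<lambda>v. M +>\<^bsub>?S\<^esub> v 0"
  interpret ideal M ?S by (rule M)
  have cr: "cring ?S" by (rule mpoly_ring_cring)
  have coset_zero: "M +>\<^bsub>?S\<^esub> p = M \<longleftrightarrow> p \<in> M" for p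
  proof
    assume "M +>\<^bsub>?S\<^esub> p = M"
    then show "p \<in> M" using a_rcos_self[of p] by simp
  next
    assume "p \<in> M"
    then show "M +>\<^bsub>?S\<^esub> p = M" by (intro a_coset_join2[OF _ a_subgroup]) simp_all
  qed
  have eps: "?\<epsilon> \<in> mod_hom ?S (?F 0) (quot_module ?S M)"
  proof (rule mod_homI)
    show "?\<epsilon> v \<in> carrier (quot_module ?S M)" for v :: "nat \<Rightarrow> (('n \<Rightarrow>\<^sub>0 nat) \<Rightarrow>\<^sub>0 'k)"
      using ring_hom_memE(1)[OF rcos_ring_hom, of "v 0"] by (simp add: quot_module_def)
    show "?\<epsilon> (v \<oplus>\<^bsub>?F 0\<^esub> w) = ?\<epsilon> v \<oplus>\<^bsub>quot_module ?S M\<^esub> ?\<epsilon> w" for v w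
      using ring_hom_memE(3)[OF rcos_ring_hom, of "v 0" "w 0"] by (simp add: quot_module_def)
    show "?\<epsilon> (r \<odot>\<^bsub>?F 0\<^esub> v) = r \<odot>\<^bsub>quot_module ?S M\<^esub> ?\<epsilon> v" for r v
      using ring_hom_memE(2)[OF rcos_ring_hom, of r "v 0"] by (simp add: quot_module_def)
  qed
  have onto: "?\<epsilon> ` carrier (?F 0) = carrier (quot_module ?S M)"
  proof
    show "carrier (quot_module ?S M) \<subseteq> ?\<epsilon> ` carrier (?F 0)"
    proof
      fix X assume "X \<in> carrier (quot_module ?S M)"
      then obtain p where "X = M +>\<^bsub>?S\<^esub> p" by (auto simp: quot_module_def FactRing_def A_RCOSETS_defs a_r_coset_def)
      then show "X \<in> ?\<epsilon> ` carrier (?F 0)"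
        by (intro image_eqI[of _ _ "\<lambda>j. if j = 0 then p else 0"]) (auto simp: b0)
    qed
  qed (use mod_homD(1)[OF eps] in blast)
  have "v 0 \<in> M \<longleftrightarrow> v \<in> poly_bdy 0 ` carrier (?F 1)" if v: "v \<in> carrier (?F 0)" for v
  proof -
    have "v 0 \<in> M \<longleftrightarrow> (\<forall>a. Poly_Mapping.lookup (v 0) (mono_of a) \<noteq> 0 \<longrightarrow> a \<in> U)"
    proof
      assume "v 0 \<in> M"
      then show "\<forall>a. Poly_Mapping.lookup (v 0) (mono_of a) \<noteq> 0 \<longrightarrow> a \<in> U"
        unfolding U in_keys_iff Ball_def using lookup_mono_of by metis
    next
      assume *: "\<forall>a. Poly_Mapping.lookup (v 0) (mono_of a) \<noteq> 0 \<longrightarrow> a \<in> U"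
      show "v 0 \<in> M"
        unfolding U using * by (metis in_keys_iff mono_of_lookup)
    qed
    also have "\<dots> \<longleftrightarrow> (\<forall>a. homog_part 0 a v \<in> bdy 1 ` vecs 1 {..a})"
      unfolding W by (auto simp: homog_part_def b0 dg0 le_fun_def)
    finally show ?thesis using poly_bdy_image_iff[OF v] by simp
  qed
  then have ker0: "poly_bdy 0 ` carrier (?F 1) = mod_kernel (?F 0) (quot_module ?S M) ?\<epsilon>"
    using poly_bdy_vectors[of 0] coset_zero
    by (auto simp: mod_kernel_def quot_module_def FactRing_def simp del: free_module_simps(1))
  have ker: "poly_bdy (Suc i) ` carrier (?F (Suc (Suc i))) = mod_kernel (?F (Suc i)) (?F i) (poly_bdy i)" for i
    using poly_bdy_kernel[of _ i] poly_bdy_vectors[of "Suc i"] unfolding mod_kernel_def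
    by (auto simp del: free_module_simps(1))
  have res: "resolution ?S (quot_module ?S M) ?F poly_bdy ?\<epsilon>"
    unfolding resolution_def using free_module_module[OF cr] poly_bdy_hom eps onto ker0 ker by blast
  have deg: "c + mono_of (dg i l) = mono_of (dg (Suc i) j)"
    if "j < b (Suc i)" "l < b i" "c \<in> Poly_Mapping.keys (poly_bdy i (unit_vector ?S j) l)" for i j l c
  proof -
    have "poly_bdy i (unit_vector ?S j) l = (\<Sum>j'<b (Suc i). if j' = j then
        Poly_Mapping.single (mono_of (\<lambda>x. dg (Suc i) j x - dg i l x)) (D i l j) else 0)"
      unfolding poly_bdy_def unit_vector_mpoly_ring by (simp only: that(2) if_True, intro sum.cong) auto
    also have "\<dots> = Poly_Mapping.single (mono_of (\<lambda>x. dg (Suc i) j x - dg i l x)) (D i l j)"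
      using that(1) by simp
    finally have c: "c = mono_of (\<lambda>x. dg (Suc i) j x - dg i l x)" "D i l j \<noteq> 0"
      using that(3) by (auto split: if_splits)
    show ?thesis using le_funD[OF D_deg[OF that(2,1) c(2)]] unfolding c(1)
      by (intro poly_mapping_eqI) (simp add: lookup_add)
  qed
  have min: "poly_bdy i v l \<in> irrelevant_ideal" if "l < b i" for i v l
  proof -
    \<comment> \<open>The constant term of entry \<open>l\<close> is its coordinate in degree
      \<open>dg i l\<close>, where the basis element occurs without a variable.\<close>
    have "Poly_Mapping.lookup (poly_bdy i v l) 0 = homog_part i (dg i l) (poly_bdy i v) l"
      using lookup_eq_homog_part[OF that, of "poly_bdy i v" 0] by simp
    also have "\<dots> = 0" unfolding homog_part_poly_bdy
      by (rule bdy_minimal[OF homog_part_vecs that refl])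
    finally show ?thesis by (simp add: irrelevant_ideal_iff)
  qed
  have "mono_of (dg 0 0) = 0" by (rule poly_mapping_eqI) (simp add: dg0)
  then have deg0: "\<exists>c. ?\<epsilon> (unit_vector ?S j) = M +>\<^bsub>?S\<^esub> Poly_Mapping.single (mono_of (dg 0 j)) c" if "j < b 0" for j
    using that b0 by (intro exI[of _ 1]) (simp add: unit_vector_mpoly_ring)
  show ?thesis
    unfolding minimal_free_resolution_def Let_def using res deg min deg0 by blast
qed

end

section \<open>Ranks of a minimal resolution\<close>

lemma lincomb_poly_vectors:
  "lincomb (free_module (mpoly_ring UNIV) r) c x n = (\<lambda>l. \<Sum>j<n. c j * x j l)"
  by (induction n) auto

lemma poly_hom_expansion:
  assumes f: "f \<in> mod_hom (mpoly_ring UNIV) (free_module (mpoly_ring UNIV) r) (free_module (mpoly_ring UNIV) r')"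
    and v: "v \<in> poly_vectors r"
  shows "f v l = (\<Sum>j<r. v j * f (unit_vector (mpoly_ring UNIV) j) l)"
proof -
  let ?S = "mpoly_ring UNIV" and ?e = "unit_vector (mpoly_ring UNIV)"
  note cr = mpoly_ring_cring[of UNIV]
  have "f v = f (lincomb (free_module ?S r) v ?e r)" by (simp only: free_module_expansion[OF cr v])
  also have "\<dots> = lincomb (free_module ?S r') v (\<lambda>j. f (?e j)) r"
    using unit_vector_closed[OF cr]
    by (intro lincomb_hom[OF free_module_module[OF cr] free_module_module[OF cr] f]) simp_all
  finally show ?thesis by (simp add: lincomb_poly_vectors)
qed

text \<open>Modulo the irrelevant ideal a homomorphism is the scalar matrix of its constant terms;
  in particular it preserves vectors with zero constant terms.\<close>

lemma lookup_poly_hom_zero: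
  assumes "f \<in> mod_hom (mpoly_ring UNIV) (free_module (mpoly_ring UNIV) r) (free_module (mpoly_ring UNIV) r')"
    and "v \<in> poly_vectors r"
  shows "Poly_Mapping.lookup (f v l) 0
    = (\<Sum>j<r. Poly_Mapping.lookup (v j) 0 * Poly_Mapping.lookup (f (unit_vector (mpoly_ring UNIV) j) l) 0)"
  by (simp only: poly_hom_expansion[OF assms] lookup_sum lookup_mult_zero)

lemma minimal_free_resolutionD:
  assumes "minimal_free_resolution M b deg d \<epsilon>"
  shows "resolution (mpoly_ring UNIV) (quot_module (mpoly_ring UNIV) M) (\<lambda>i. free_module (mpoly_ring UNIV) (b i)) d \<epsilon>"
    and "v \<in> poly_vectors (b (Suc i)) \<Longrightarrow> Poly_Mapping.lookup (d i v l) 0 = 0"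
proof -
  show res: "resolution (mpoly_ring UNIV) (quot_module (mpoly_ring UNIV) M) (\<lambda>i. free_module (mpoly_ring UNIV) (b i)) d \<epsilon>"
    using assms unfolding minimal_free_resolution_def Let_def by blast
  assume v: "v \<in> poly_vectors (b (Suc i))"
  show "Poly_Mapping.lookup (d i v l) 0 = 0"
  proof (cases "l < b i")
    case True
    then have "d i v l \<in> irrelevant_ideal"
      using assms v unfolding minimal_free_resolution_def Let_def by blast
    then show ?thesis by (simp add: irrelevant_ideal_iff)
  next
    case False
    then show ?thesis using mod_homD(1)[OF resolutionD(2)[OF res] v] by simp
  qed
qed

text \<open>Homotopic endomorphisms of a minimal resolution agree modulo the irrelevant ideal, so a minimal
  resolution is, modulo that ideal, a retract of every projective resolution.\<close>

theorem retract_modulo_irrelevant: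
  fixes P :: "nat \<Rightarrow> (('n \<Rightarrow>\<^sub>0 nat) \<Rightarrow>\<^sub>0 'k::field, nat \<Rightarrow> (('n \<Rightarrow>\<^sub>0 nat) \<Rightarrow>\<^sub>0 'k)) module"
  assumes M: "ideal M (mpoly_ring UNIV)" and F: "minimal_free_resolution M b deg d \<epsilon>"
    and P: "resolution (mpoly_ring UNIV) (quot_module (mpoly_ring UNIV) M) P d' \<epsilon>'"
      "\<And>i. projective_module (mpoly_ring UNIV) (P i)"
  obtains f g where
    "f \<in> mod_hom (mpoly_ring UNIV) (free_module (mpoly_ring UNIV) (b i)) (P i)"
    "g \<in> mod_hom (mpoly_ring UNIV) (P i) (free_module (mpoly_ring UNIV) (b i))"
    "\<forall>v\<in>poly_vectors (b i). \<forall>l. Poly_Mapping.lookup (g (f v) l) 0 = Poly_Mapping.lookup (v l) 0"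
proof -
  let ?S = "mpoly_ring UNIV :: (('n \<Rightarrow>\<^sub>0 nat) \<Rightarrow>\<^sub>0 'k) ring"
  let ?F = "\<lambda>i. free_module ?S (b i)"
  have cr: "cring ?S" by (rule mpoly_ring_cring)
  note N = quot_module_module[OF cr M]
  note Fr = minimal_free_resolutionD[OF F] and Fp = free_module_projective[OF cr]
  obtain f where f: "\<And>i. f i \<in> mod_hom ?S (?F i) (P i)"
    "\<And>x. x \<in> carrier (?F 0) \<Longrightarrow> \<epsilon>' (f 0 x) = \<epsilon> x"
    "\<And>i x. x \<in> carrier (?F (Suc i)) \<Longrightarrow> d' i (f (Suc i) x) = f i (d i x)"
    using comparison_map[OF N Fr(1) Fp P(1)] by metis
  obtain g where g: "\<And>i. g i \<in> mod_hom ?S (P i) (?F i)"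
    "\<And>x. x \<in> carrier (P 0) \<Longrightarrow> \<epsilon> (g 0 x) = \<epsilon>' x"
    "\<And>i x. x \<in> carrier (P (Suc i)) \<Longrightarrow> d i (g (Suc i) x) = g i (d' i x)"
    using comparison_map[OF N P Fr(1)] by metis
  \<comment> \<open>The composite of \<open>f\<close> and \<open>g\<close> and the identity both
    lift the identity of \<open>S/M\<close>, so their difference is null-homotopic.\<close>
  define \<psi> where "\<psi> i v = (\<lambda>l. g i (f i v) l - v l)" for i v
  have dh: "d i \<in> mod_hom ?S (?F (Suc i)) (?F i)" for i using resolutionD(2)[OF Fr(1)] .
  have gf: "(\<lambda>v. g i (f i v)) \<in> mod_hom ?S (?F i) (?F i)" for i by (rule mod_hom_comp[OF f(1) g(1)])
  have \<psi>: "\<psi> i \<in> mod_hom ?S (?F i) (?F i)" for i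
  proof (rule mod_homI)
    fix v w assume v: "v \<in> carrier (?F i)" and w: "w \<in> carrier (?F i)"
    show "\<psi> i v \<in> carrier (?F i)" using mod_homD(1)[OF gf v] v by (simp add: \<psi>_def)
    show "\<psi> i (v \<oplus>\<^bsub>?F i\<^esub> w) = \<psi> i v \<oplus>\<^bsub>?F i\<^esub> \<psi> i w"
      using mod_homD(2)[OF gf v w] by (simp add: \<psi>_def add_diff_add)
  next
    fix r v assume r: "r \<in> carrier ?S" and v: "v \<in> carrier (?F i)"
    show "\<psi> i (r \<odot>\<^bsub>?F i\<^esub> v) = r \<odot>\<^bsub>?F i\<^esub> \<psi> i v"
      using mod_homD(3)[OF gf r v] by (simp add: \<psi>_def right_diff_distrib)
  qed
  have sub: "h (\<lambda>l. x l - y l) = (\<lambda>l. h x l - h y l)"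
    if h: "h \<in> mod_hom ?S (?F i) (?F k)" and "x \<in> carrier (?F i)" "y \<in> carrier (?F i)" for h i k x y
  proof -
    have "(\<lambda>l. x l - y l) \<in> carrier (?F i)" using that by simp
    then have "h ((\<lambda>l. x l - y l) \<oplus>\<^bsub>?F i\<^esub> y) = h (\<lambda>l. x l - y l) \<oplus>\<^bsub>?F k\<^esub> h y"
      using mod_homD(2)[OF h] that(3) by blast
    then show ?thesis by (auto simp: fun_eq_iff)
  qed
  interpret N: Module.module ?S "quot_module ?S M" by (rule N)
  note \<epsilon>h = resolutionD(3)[OF Fr(1)]
  have "\<epsilon> (\<psi> 0 v) = \<zero>\<^bsub>quot_module ?S M\<^esub>" if v: "v \<in> carrier (?F 0)" for v
  proof -
    have c: "\<epsilon> (\<psi> 0 v) \<in> carrier (quot_module ?S M)" "\<epsilon> v \<in> carrier (quot_module ?S M)"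
      using mod_homD(1)[OF \<epsilon>h mod_homD(1)[OF \<psi> v]] mod_homD(1)[OF \<epsilon>h v] .
    have "\<epsilon> v = \<epsilon> (g 0 (f 0 v))" using f(2)[OF v] g(2)[OF mod_homD(1)[OF f(1) v]] by simp
    also have "g 0 (f 0 v) = \<psi> 0 v \<oplus>\<^bsub>?F 0\<^esub> v" by (simp add: \<psi>_def)
    also have "\<epsilon> \<dots> = \<epsilon> (\<psi> 0 v) \<oplus>\<^bsub>quot_module ?S M\<^esub> \<epsilon> v"
      by (rule mod_homD(2)[OF \<epsilon>h mod_homD(1)[OF \<psi> v] v])
    finally show ?thesis using c by (metis N.M.add.r_cancel_one)
  qed
  moreover have "d i (\<psi> (Suc i) v) = \<psi> i (d i v)" if v: "v \<in> carrier (?F (Suc i))" for i v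
  proof -
    have "d i (g (Suc i) (f (Suc i) v)) = g i (f i (d i v))"
      using g(3)[OF mod_homD(1)[OF f(1) v]] f(3)[OF v] by simp
    then show ?thesis unfolding \<psi>_def sub[OF dh mod_homD(1)[OF gf v] v] by simp
  qed
  ultimately obtain s where s: "\<And>i. s i \<in> mod_hom ?S (?F i) (?F (Suc i))"
    "\<And>x. x \<in> carrier (?F 0) \<Longrightarrow> \<psi> 0 x = d 0 (s 0 x)"
    "\<And>i x. x \<in> carrier (?F (Suc i)) \<Longrightarrow> \<psi> (Suc i) x = d (Suc i) (s (Suc i) x) \<oplus>\<^bsub>?F (Suc i)\<^esub> s i (d i x)"
    using null_homotopy[OF N Fr(1) Fp Fr(1), of \<psi>] \<psi> by metis
  \<comment> \<open>Both parts of the homotopy have zero constant terms: \<open>d s\<close> because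
    \<open>d\<close> is minimal, \<open>s d\<close> because \<open>s\<close> acts on constant terms
    by a scalar matrix.\<close>
  have "Poly_Mapping.lookup (\<psi> i v l) 0 = 0" if v: "v \<in> carrier (?F i)" for v l
  proof (cases i)
    case 0
    then show ?thesis using s(2) Fr(2)[of "s 0 v" 0] mod_homD(1)[OF s(1), of v 0] v by simp
  next
    case (Suc i')
    have dv: "d i' v \<in> carrier (?F i')" using mod_homD(1)[OF dh] v Suc by blast
    have "Poly_Mapping.lookup (s i' (d i' v) l) 0 = 0"
      unfolding lookup_poly_hom_zero[OF s(1) dv] using Fr(2) v Suc by simp
    moreover have "Poly_Mapping.lookup (d i (s i v) l) 0 = 0"
      using Fr(2)[OF mod_homD(1)[OF s(1) v]] .
    ultimately show ?thesis using s(3)[of v i'] v Suc by (simp add: lookup_add)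
  qed
  then have "Poly_Mapping.lookup (g i (f i v) l) 0 = Poly_Mapping.lookup (v l) 0"
    if "v \<in> poly_vectors (b i)" for v l
    using that by (simp add: \<psi>_def lookup_minus)
  then show ?thesis using that[OF f(1) g(1)] by blast
qed

text \<open>The constant terms of the retraction factor the identity of \<open>k^(b i)\<close>
  through \<open>k^(b' i)\<close>.\<close>

lemma rank_le_rank:
  fixes M :: "(('n \<Rightarrow>\<^sub>0 nat) \<Rightarrow>\<^sub>0 'k::field) set"
  assumes M: "ideal M (mpoly_ring UNIV)" and F: "minimal_free_resolution M b deg d \<epsilon>"
    and F': "minimal_free_resolution M b' deg' d' \<epsilon>'"
  shows "b i \<le> b' i"
proof -
  let ?S = "mpoly_ring UNIV :: (('n \<Rightarrow>\<^sub>0 nat) \<Rightarrow>\<^sub>0 'k) ring"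
  let ?e = "unit_vector ?S" and ?c = "\<lambda>p. Poly_Mapping.lookup p 0"
  have cr: "cring ?S" by (rule mpoly_ring_cring)
  obtain f g where f: "f \<in> mod_hom ?S (free_module ?S (b i)) (free_module ?S (b' i))"
    and g: "g \<in> mod_hom ?S (free_module ?S (b' i)) (free_module ?S (b i))"
    and gf: "\<forall>v\<in>poly_vectors (b i). \<forall>l. ?c (g (f v) l) = ?c (v l)"
    by (rule retract_modulo_irrelevant[OF M F minimal_free_resolutionD(1)[OF F'] free_module_projective[OF cr]])
  show ?thesis
  proof (rule left_inverse_dim_le)
    fix l j assume "l < b i" and j: "j < b i"
    have e: "?e j \<in> poly_vectors (b i)" by (rule unit_vector_closed[OF cr j])
    have "(\<Sum>k<b' i. ?c (g (?e k) l) * ?c (f (?e j) k)) = ?c (g (f (?e j)) l)"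
      unfolding lookup_poly_hom_zero[OF g mod_homD(1)[OF f e]] by (simp add: mult.commute)
    also have "\<dots> = (if l = j then 1 else 0)"
      unfolding gf[rule_format, OF e] by (simp add: unit_vector_mpoly_ring)
    finally show "(\<Sum>k<b' i. ?c (g (?e k) l) * ?c (f (?e j) k)) = (if l = j then 1 else 0)" .
  qed
qed

lemma betti_eq_rank:
  assumes "ideal M (mpoly_ring UNIV)" "minimal_free_resolution M b deg d \<epsilon>"
  shows "betti M i = b i"
  unfolding betti_def
proof (rule the_equality)
  show "\<exists>b' deg d \<epsilon>. minimal_free_resolution M b' deg d \<epsilon> \<and> b' i = b i" using assms(2) by blast
  show "r = b i" if "\<exists>b deg d \<epsilon>. minimal_free_resolution M b deg d \<epsilon> \<and> b i = r" for r
    using that rank_le_rank[OF assms(1)] assms(2) by (metis order_antisym)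
qed

text \<open>The identity on constant terms factors through \<open>P i\<close>, which is
  zero.\<close>

lemma rank_eq_0_beyond_projective_resolution:
  fixes P :: "nat \<Rightarrow> (('n \<Rightarrow>\<^sub>0 nat) \<Rightarrow>\<^sub>0 'k::field, nat \<Rightarrow> (('n \<Rightarrow>\<^sub>0 nat) \<Rightarrow>\<^sub>0 'k)) module"
  assumes M: "ideal M (mpoly_ring UNIV)" and F: "minimal_free_resolution M b deg d \<epsilon>"
    and P: "resolution (mpoly_ring UNIV) (quot_module (mpoly_ring UNIV) M) P d' \<epsilon>'"
      "\<And>i. projective_module (mpoly_ring UNIV) (P i)"
    and 0: "carrier (P i) = {\<zero>\<^bsub>P i\<^esub>}"
  shows "b i = 0"
proof (rule ccontr)
  let ?S = "mpoly_ring UNIV :: (('n \<Rightarrow>\<^sub>0 nat) \<Rightarrow>\<^sub>0 'k) ring"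
  assume "b i \<noteq> 0"
  have cr: "cring ?S" by (rule mpoly_ring_cring)
  have e: "unit_vector ?S 0 \<in> poly_vectors (b i)" by (rule unit_vector_closed[OF cr]) (use \<open>b i \<noteq> 0\<close> in simp)
  obtain f g where f: "f \<in> mod_hom ?S (free_module ?S (b i)) (P i)"
    and g: "g \<in> mod_hom ?S (P i) (free_module ?S (b i))"
    and gf: "\<forall>v\<in>poly_vectors (b i). \<forall>l. Poly_Mapping.lookup (g (f v) l) 0 = Poly_Mapping.lookup (v l) 0"
    by (rule retract_modulo_irrelevant[OF M F P])
  have "f (unit_vector ?S 0) = \<zero>\<^bsub>P i\<^esub>" using mod_homD(1)[OF f e] 0 by blast
  then have "g (f (unit_vector ?S 0)) = (\<lambda>_. 0)"
    using mod_hom_zero[OF resolutionD(1)[OF P(1)] free_module_module[OF cr] g] by simp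
  then show False using gf[rule_format, OF e, of 0] by (simp add: unit_vector_mpoly_ring)
qed

text \<open>A length \<open>l\<close> occurs exactly if all ranks beyond \<open>l\<close> vanish:
  the minimal resolution then has that length, and no projective resolution can stop below a nonzero
  rank.\<close>

lemma proj_dim_eq_iff:
  fixes M :: "(('n \<Rightarrow>\<^sub>0 nat) \<Rightarrow>\<^sub>0 'k::field) set"
  assumes M: "ideal M (mpoly_ring UNIV)" and F: "minimal_free_resolution M b deg d \<epsilon>"
    and n: "0 < n" "\<And>i. n < i \<Longrightarrow> b i = 0"
  shows "proj_dim (mpoly_ring UNIV) (quot_module (mpoly_ring UNIV) M) = enat n \<longleftrightarrow> 0 < b n"
proof -
  let ?S = "mpoly_ring UNIV :: (('n \<Rightarrow>\<^sub>0 nat) \<Rightarrow>\<^sub>0 'k) ring"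
  define L where "L = {l. \<exists>(P :: nat \<Rightarrow> (('n \<Rightarrow>\<^sub>0 nat) \<Rightarrow>\<^sub>0 'k, nat \<Rightarrow> (('n \<Rightarrow>\<^sub>0 nat) \<Rightarrow>\<^sub>0 'k)) module) d \<epsilon>.
      resolution ?S (quot_module ?S M) P d \<epsilon> \<and> (\<forall>i. projective_module ?S (P i)) \<and>
      (\<forall>i>l. carrier (P i) = {\<zero>\<^bsub>P i\<^esub>})}"
  have pd: "proj_dim ?S (quot_module ?S M) = Inf (enat ` L)"
    unfolding proj_dim_def L_def by (rule arg_cong[of _ _ Inf]) blast
  have L_iff: "l \<in> L \<longleftrightarrow> (\<forall>i>l. b i = 0)" for l
  proof
    assume "l \<in> L"
    then show "\<forall>i>l. b i = 0"
      unfolding L_def using rank_eq_0_beyond_projective_resolution[OF M F] by blast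
  next
    assume l: "\<forall>i>l. b i = 0"
    have "carrier (free_module ?S (b i)) = {\<zero>\<^bsub>free_module ?S (b i)\<^esub>}" if "l < i" for i
      using l that by (auto simp: fun_eq_iff)
    then show "l \<in> L" unfolding L_def
      using minimal_free_resolutionD(1)[OF F] free_module_projective[OF mpoly_ring_cring] by blast
  qed
  have nL: "n \<in> L" using n(2) L_iff by blast
  show ?thesis
  proof
    assume eq: "proj_dim ?S (quot_module ?S M) = enat n"
    show "0 < b n"
    proof (rule ccontr)
      assume "\<not> 0 < b n"
      then have "b i = 0" if "n - 1 < i" for i
        using n that by (cases "i = n") auto
      then have "n - 1 \<in> L" unfolding L_iff by blast
      then have "Inf (enat ` L) \<le> enat (n - 1)" by (intro Inf_lower) blast
      then show False using eq pd n(1) by simp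
    qed
  next
    assume "0 < b n"
    have "n \<le> l" if "l \<in> L" for l
    proof (rule ccontr)
      assume "\<not> n \<le> l"
      then have "b n = 0" using that unfolding L_iff by simp
      then show False using \<open>0 < b n\<close> by simp
    qed
    then have "Inf (enat ` L) = enat n"
      using nL by (intro antisym Inf_lower Inf_greatest) auto
    then show "proj_dim ?S (quot_module ?S M) = enat n" using pd by simp
  qed
qed

theorem monomial_resolution:
  fixes U :: "('n::finite \<Rightarrow> nat) set" and M :: "(('n \<Rightarrow>\<^sub>0 nat) \<Rightarrow>\<^sub>0 'k::field) set"
  assumes M: "ideal M (mpoly_ring UNIV)" and U: "\<And>p. p \<in> M \<longleftrightarrow> (\<forall>m\<in>Poly_Mapping.keys p. Poly_Mapping.lookup m \<in> U)"
    and up: "\<And>a c. a \<in> U \<Longrightarrow> a \<le> c \<Longrightarrow> c \<in> U" and proper: "(\<lambda>_. 0) \<notin> U"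
  obtains b deg d \<epsilon> where "minimal_free_resolution M b deg d \<epsilon>" "\<And>i. CARD('n) < i \<Longrightarrow> b i = 0"
    "0 < b CARD('n) \<Longrightarrow> \<exists>u. u \<notin> U \<and> (\<forall>x. u(x := Suc (u x)) \<in> U)"
    "\<And>u i. u \<notin> U \<Longrightarrow> (\<And>x. u(x := Suc (u x)) \<in> U) \<Longrightarrow> CARD('n) choose i \<le> b i"
proof -
  \<comment> \<open>The degree parts of \<open>M\<close> inside the free module on one generator of
    degree \<open>0\<close>: a line for exponents in \<open>U\<close>, zero otherwise. As
    \<open>1\<close> is not in \<open>M\<close>, \<open>no_unit\<close> holds.\<close>
  define W :: "('n \<Rightarrow> nat) \<Rightarrow> (nat \<Rightarrow> 'k) set"
    where "W a = {v. (\<forall>j. v j \<noteq> 0 \<longrightarrow> j = 0) \<and> (v 0 \<noteq> 0 \<longrightarrow> a \<in> U)}" for a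
  have W_iff: "v \<in> W a \<longleftrightarrow> (\<forall>j. j \<noteq> 0 \<longrightarrow> v j = 0) \<and> (a \<notin> U \<longrightarrow> v 0 = 0)" for v a
    unfolding W_def by blast
  have sf: "subspace_family 1 (\<lambda>_ _. 0) W"
  proof (unfold_locales, goal_cases)
    case (1 v a j)
    then show ?case by (cases "j = 0") (auto simp: W_iff le_fun_def)
  next
    case (6 v a j)
    then show ?case using proper by (cases "j = 0") (auto simp: W_iff)
  qed (use up in \<open>auto simp: W_iff\<close>)
  obtain b dg D where b0: "b 0 = 1" and dg0: "dg 0 = (\<lambda>_ _. 0)" and ex: "multigraded_exact_complex b dg D"
    and W': "\<forall>a. W a = multigraded_complex.bdy b D 1 ` multigraded_complex.vecs b dg 1 {..a}"
    by (rule exact_complex_exists[OF sf])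
  interpret multigraded_exact_complex b dg D by (rule ex)
  have W: "W a = bdy 1 ` vecs 1 {..a}" for a using W' by blast
  \<comment> \<open>With no variable divided out, index \<open>0\<close> gives \<open>S/M\<close>:
    the cycles are the whole line and the boundaries in degree \<open>c\<close> are
    \<open>W c\<close>.\<close>
  have soc: "socle_class {} a \<longleftrightarrow> a \<notin> U \<and> (\<forall>x. a(x := Suc (a x)) \<in> U)" for a
  proof -
    have lay: "layer {} c = {..c}" for c :: "'n \<Rightarrow> nat" by (auto simp: layer_def)
    have cyc: "cycles {} a 0 = {v. \<forall>j. v j \<noteq> 0 \<longrightarrow> j = 0}"
      by (auto simp: cycles_def lay vecs_def b0 dg0 le_fun_def)
    have "restr 0 {..c} (bdy (Suc 0) w) = bdy (Suc 0) w" if "w \<in> vecs (Suc 0) {..c}" for c w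
      by (rule restr_id[OF bdy_vecs[OF that]]) simp
    then have bnd: "boundaries {} c 0 = W c" for c
      unfolding boundaries_def lay W by simp
    show ?thesis
    proof
      assume "socle_class {} a"
      then show "a \<notin> U \<and> (\<forall>x. a(x := Suc (a x)) \<in> U)"
        unfolding socle_class_def card.empty cyc bnd W_def by auto
    next
      assume *: "a \<notin> U \<and> (\<forall>x. a(x := Suc (a x)) \<in> U)"
      then show "socle_class {} a"
        unfolding socle_class_def card.empty cyc bnd W_def
        by (intro exI[of _ "\<lambda>j. if j = 0 then 1 else 0"]) auto
    qed
  qed
  show ?thesis
  proof (rule that)
    show "minimal_free_resolution M b (\<lambda>i j. mono_of (dg i j)) poly_bdy (\<lambda>v. M +>\<^bsub>mpoly_ring UNIV\<^esub> v 0)"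
      by (rule minimal_free_resolution_of_complex[OF M U b0 dg0 W[unfolded W_def, symmetric]])
    show "b i = 0" if "CARD('n) < i" for i using rank_eq_0[OF that] .
    show "\<exists>u. u \<notin> U \<and> (\<forall>x. u(x := Suc (u x)) \<in> U)" if "0 < b CARD('n)"
      using socle_class_if_top_rank[OF that] soc by blast
    show "CARD('n) choose i \<le> b i" if "u \<notin> U" "\<And>x. u(x := Suc (u x)) \<in> U" for u i
      using choose_le_rank[of u i] soc that by blast
  qed
qed

section \<open>Socle monomials\<close>

definition socle_monomial :: "('n \<Rightarrow>\<^sub>0 nat) set \<Rightarrow> ('n \<Rightarrow> nat) \<Rightarrow> bool"
  where "socle_monomial G u \<longleftrightarrow> (\<forall>g\<in>G. \<not> Poly_Mapping.lookup g \<le> u) \<and>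
    (\<forall>x. \<exists>g\<in>G. Poly_Mapping.lookup g \<le> u(x := Suc (u x)))"

text \<open>A generator that divides the product of \<open>x^u\<close> with a variable, but not
  \<open>x^u\<close>, has to use the additional factor.\<close>

lemma socle_monomial_generators:
  assumes "socle_monomial G u"
  obtains g where "\<forall>x. g x \<in> G \<and> Poly_Mapping.lookup (g x) x = Suc (u x) \<and>
    (\<forall>y. y \<noteq> x \<longrightarrow> Poly_Mapping.lookup (g x) y \<le> u y)"
proof -
  have "\<exists>g. g \<in> G \<and> Poly_Mapping.lookup g x = Suc (u x) \<and> (\<forall>y. y \<noteq> x \<longrightarrow> Poly_Mapping.lookup g y \<le> u y)" for x
  proof -
    obtain g where g: "g \<in> G" "Poly_Mapping.lookup g \<le> u(x := Suc (u x))"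
      using assms unfolding socle_monomial_def by blast
    have le: "Poly_Mapping.lookup g y \<le> u y" if "y \<noteq> x" for y using le_funD[OF g(2), of y] that by simp
    have "\<not> Poly_Mapping.lookup g x \<le> u x"
    proof
      assume "Poly_Mapping.lookup g x \<le> u x"
      then have "Poly_Mapping.lookup g \<le> u" using le by (metis le_funI)
      then show False using assms g(1) unfolding socle_monomial_def by blast
    qed
    then have "Poly_Mapping.lookup g x = Suc (u x)" using le_funD[OF g(2), of x] by simp
    then show ?thesis using g(1) le by blast
  qed
  then show ?thesis using that by metis
qed

section \<open>Dominant sets and the order of dominance\<close>

lemma lookup_mono_lcm:
  fixes D :: "('n::finite \<Rightarrow>\<^sub>0 nat) set"
  shows "Poly_Mapping.lookup (mono_lcm D) x = (SUP m\<in>D. Poly_Mapping.lookup m x)"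
  by (simp add: mono_lcm_def)

lemma lookup_mono_lcm_dominant:
  fixes D :: "('n::finite \<Rightarrow>\<^sub>0 nat) set"
  assumes "dominant_in D d x"
  shows "Poly_Mapping.lookup (mono_lcm D) x = Poly_Mapping.lookup d x"
  unfolding lookup_mono_lcm
  by (rule cSup_eq_maximum) (use assms in \<open>auto simp: dominant_in_def intro: less_imp_le\<close>)

lemma dominant_in_unique:
  assumes "dominant_in D d x" "dominant_in D d' x" shows "d = d'"
  using assms unfolding dominant_in_def by (metis insertE insert_Diff less_asym)

text \<open>Two elements are never dominant in the same variable, so a choice of one variable for
  each of the \<open>n\<close> elements is a bijection.\<close>

lemma full_dominant_set:
  fixes D :: "('n::finite \<Rightarrow>\<^sub>0 nat) set"
  assumes D: "dominant_set D" "card D = CARD('n)" and "0 \<notin> D"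
  obtains g where "bij_betw g UNIV D" "\<forall>x. dominant_in D (g x) x"
    "\<forall>x. Poly_Mapping.lookup (mono_lcm D) x > 0"
proof -
  have fin: "finite D" using D(1) by (simp add: dominant_set_def)
  have "\<forall>d. \<exists>x. d \<in> D \<longrightarrow> dominant_in D d x" using D(1) unfolding dominant_set_def by blast
  from choice[OF this] obtain f where f: "\<And>d. d \<in> D \<Longrightarrow> dominant_in D d (f d)" by blast
  have inj: "inj_on f D" using f dominant_in_unique by (metis inj_onI)
  have "card (f ` D) = CARD('n)" using card_image[OF inj] D(2) by simp
  then have "f ` D = UNIV" by (intro card_subset_eq) auto
  then have bij: "bij_betw f D UNIV" using inj by (simp add: bij_betw_def)
  define g where "g = inv_into D f"
  have g: "bij_betw g UNIV D" unfolding g_def by (rule bij_betw_inv_into[OF bij])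
  have dom: "dominant_in D (g x) x" for x
    using f[of "g x"] bij_betwE[OF g] bij_betw_inv_into_right[OF bij, of x] by (simp add: g_def)
  \<comment> \<open>Exceeding another element forces a positive exponent. For a singleton
    \<open>D\<close> dominance is vacuous, but then there is only one variable and the element is
    not \<open>1\<close>.\<close>
  have "Poly_Mapping.lookup (g x) x > 0" for x
  proof (cases "D = {g x}")
    case True
    then have "CARD('n) = 1" using D(2) by (metis card_1_singleton_iff One_nat_def)
    then have "(UNIV :: 'n set) = {x}" by (metis UNIV_I card_1_singletonE singletonD)
    then have y: "y = x" for y by blast
    have "g x \<noteq> 0" using True assms(3) by auto
    then obtain y where "Poly_Mapping.lookup (g x) y \<noteq> 0" by (metis lookup_zero poly_mapping_eqI)
    then show ?thesis using y[of y] by simp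
  next
    case False
    moreover have "g x \<in> D" using bij_betwE[OF g] by simp
    ultimately obtain d where "d \<in> D - {g x}" by blast
    then show ?thesis using dom[of x] unfolding dominant_in_def by (metis gr0I less_nat_zero_code)
  qed
  then show ?thesis using that[OF g] dom lookup_mono_lcm_dominant[OF dom] by simp
qed

lemma mono_dvd_single: "mono_dvd (Poly_Mapping.single x k) m \<longleftrightarrow> k \<le> Poly_Mapping.lookup m x"
  by (auto simp: mono_dvd_def lookup_single when_def)

lemma mono_strongly_dvd_iff:
  assumes "\<forall>x. Poly_Mapping.lookup b x > 0"
  shows "mono_strongly_dvd a b \<longleftrightarrow> (\<forall>x. Poly_Mapping.lookup a x < Poly_Mapping.lookup b x)"
  using assms by (auto simp: mono_strongly_dvd_def) (metis neq0_conv)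

text \<open>With \<open>u\<close> the exponent of \<open>lcm D\<close> lowered by one everywhere,
  strong divisibility of \<open>lcm D\<close> is divisibility of \<open>x^u\<close>. The element
  dominant in \<open>x\<close> exceeds \<open>u\<close> at \<open>x\<close> only, as at every other
  variable it is beaten by the element dominant there.\<close>

theorem socle_monomial_iff_dominant_set:
  fixes G :: "('n::finite \<Rightarrow>\<^sub>0 nat) set"
  assumes "0 \<notin> G"
  shows "(\<exists>u. socle_monomial G u) \<longleftrightarrow>
    (\<exists>D\<subseteq>G. dominant_set D \<and> card D = CARD('n) \<and> \<not> (\<exists>m\<in>G. mono_strongly_dvd m (mono_lcm D)))"
proof
  assume "\<exists>u. socle_monomial G u"
  then obtain u where u: "socle_monomial G u" by blast
  obtain g where g: "\<forall>x. g x \<in> G \<and> Poly_Mapping.lookup (g x) x = Suc (u x) \<and>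
    (\<forall>y. y \<noteq> x \<longrightarrow> Poly_Mapping.lookup (g x) y \<le> u y)"
    by (rule socle_monomial_generators[OF u])
  have ne: "g x \<noteq> g y" if "x \<noteq> y" for x y
  proof
    assume "g x = g y"
    moreover have "Poly_Mapping.lookup (g x) y \<le> u y" using g that by simp
    moreover have "Poly_Mapping.lookup (g y) y = Suc (u y)" using g by blast
    ultimately show False by simp
  qed
  have dom: "dominant_in (range g) (g x) x" for x
    unfolding dominant_in_def
  proof (intro conjI ballI)
    fix m assume "m \<in> range g - {g x}"
    then obtain y where "m = g y" "y \<noteq> x" by blast
    then have "Poly_Mapping.lookup m x \<le> u x" using g by metis
    then show "Poly_Mapping.lookup m x < Poly_Mapping.lookup (g x) x" using g by simp
  qed simp
  have "inj g" using ne by (metis injI)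
  then have "card (range g) = CARD('n)" by (rule card_image)
  moreover have "dominant_set (range g)" using dom unfolding dominant_set_def by auto
  moreover have "range g \<subseteq> G" using g by blast
  moreover have "\<not> mono_strongly_dvd m (mono_lcm (range g))" if "m \<in> G" for m
  proof
    have "Poly_Mapping.lookup (mono_lcm (range g)) x = Suc (u x)" for x
      using lookup_mono_lcm_dominant[OF dom] g by simp
    moreover assume "mono_strongly_dvd m (mono_lcm (range g))"
    ultimately have "Poly_Mapping.lookup m x \<le> u x" for x
      unfolding mono_strongly_dvd_def by (metis bot_nat_0.extremum less_Suc_eq_le)
    then show False using u that unfolding socle_monomial_def le_fun_def by blast
  qed
  ultimately show "\<exists>D\<subseteq>G. dominant_set D \<and> card D = CARD('n) \<and> \<not> (\<exists>m\<in>G. mono_strongly_dvd m (mono_lcm D))"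
    by blast
next
  assume "\<exists>D\<subseteq>G. dominant_set D \<and> card D = CARD('n) \<and> \<not> (\<exists>m\<in>G. mono_strongly_dvd m (mono_lcm D))"
  then obtain D where D: "D \<subseteq> G" "dominant_set D" "card D = CARD('n)"
    and str: "\<not> (\<exists>m\<in>G. mono_strongly_dvd m (mono_lcm D))" by blast
  have "0 \<notin> D" using D(1) assms by blast
  from full_dominant_set[OF D(2,3) this] obtain g where g: "bij_betw g UNIV D"
    and dom: "\<forall>x. dominant_in D (g x) x" and pos: "\<forall>x. Poly_Mapping.lookup (mono_lcm D) x > 0" .
  define u where "u x = Poly_Mapping.lookup (mono_lcm D) x - 1" for x
  have lcm: "Poly_Mapping.lookup (mono_lcm D) x = Suc (u x)" for x
    using pos[rule_format, of x] by (simp add: u_def)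
  have "Poly_Mapping.lookup (g x) \<le> u(x := Suc (u x))" for x
  proof (rule le_funI)
    fix y
    show "Poly_Mapping.lookup (g x) y \<le> (u(x := Suc (u x))) y"
    proof (cases "y = x")
      case True
      then show ?thesis using lookup_mono_lcm_dominant[OF dom[rule_format, of x]] lcm[of x] by simp
    next
      case False
      then have "g x \<noteq> g y" using bij_betw_imp_inj_on[OF g] by (auto dest: injD)
      then have "Poly_Mapping.lookup (g x) y < Poly_Mapping.lookup (g y) y"
        using dom[rule_format, of y] bij_betwE[OF g] unfolding dominant_in_def by simp
      then show ?thesis using False lookup_mono_lcm_dominant[OF dom[rule_format, of y]] lcm[of y] by simp
    qed
  qed
  moreover have "g x \<in> G" for x using bij_betwE[OF g] D(1) by blast
  moreover have "\<not> Poly_Mapping.lookup m \<le> u" if "m \<in> G" for m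
    using str that unfolding mono_strongly_dvd_iff[OF pos] lcm le_fun_def by (metis le_imp_less_Suc)
  ultimately have "socle_monomial G u" unfolding socle_monomial_def by blast
  then show "\<exists>u. socle_monomial G u" by blast
qed

text \<open>A sequence of length \<open>n\<close> uses all variables; the divisibility clause of
  \<open>odom_class\<close> then says that no generator is strictly below \<open>lcm D\<close> at
  every variable.\<close>

theorem odom_eq_iff:
  fixes M :: "(('n::{finite,linorder} \<Rightarrow>\<^sub>0 nat) \<Rightarrow>\<^sub>0 'k::field) set"
  assumes G: "min_gens UNIV M = G" and "0 \<notin> G" "G \<noteq> {}" "mono_antichain G"
  shows "odom M = CARD('n) \<longleftrightarrow>
    (\<exists>D\<subseteq>G. dominant_set D \<and> card D = CARD('n) \<and> \<not> (\<exists>m\<in>G. mono_strongly_dvd m (mono_lcm D)))"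
proof -
  have len: "length xs \<le> CARD('n)" if "sorted_wrt (<) xs" for xs :: "'n list"
    using that distinct_card[of xs] card_mono[of UNIV "set xs"] by (simp add: strict_sorted_iff)
  have fin: "finite (length ` odom_class M)"
    by (rule finite_subset[of _ "{..CARD('n)}"]) (auto simp: odom_class_def len)
  \<comment> \<open>\<open>Max\<close> needs a nonempty class. A single generator with any variable
    qualifies, since in an antichain no other generator divides it.\<close>
  have class_ne: "odom_class M \<noteq> {}"
  proof -
    obtain d where d: "d \<in> G" using assms(3) by blast
    let ?x = "undefined :: 'n"
    have dom: "dominant_in {d} d ?x" by (simp add: dominant_in_def)
    have "d = m" if "m \<in> G" "mono_dvd m (mono_lcm {d})" for m
    proof -
      have "mono_lcm {d} = d" by (rule poly_mapping_eqI) (simp add: lookup_mono_lcm)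
      then show ?thesis using assms(4) d that unfolding mono_antichain_def by metis
    qed
    then have "[?x] \<in> odom_class M"
      unfolding odom_class_def mem_Collect_eq G using d dom
      by (intro conjI exI[of _ "{d}"] exI[of _ "[d]"])
        (auto simp: dominant_set_def mono_dvd_single lookup_mono_lcm)
    then show ?thesis by blast
  qed
  have "odom M = CARD('n) \<longleftrightarrow> (\<exists>xs\<in>odom_class M. length xs = CARD('n))"
  proof
    assume "odom M = CARD('n)"
    moreover have "Max (length ` odom_class M) \<in> length ` odom_class M"
      using fin class_ne by (intro Max_in) auto
    ultimately show "\<exists>xs\<in>odom_class M. length xs = CARD('n)" unfolding odom_def by auto
  next
    assume "\<exists>xs\<in>odom_class M. length xs = CARD('n)"
    then have "CARD('n) \<in> length ` odom_class M" by (metis imageI)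
    moreover have "k \<le> CARD('n)" if "k \<in> length ` odom_class M" for k
      using that len by (auto simp: odom_class_def)
    ultimately show "odom M = CARD('n)" unfolding odom_def by (intro Max_eqI fin) auto
  qed
  also have "\<dots> \<longleftrightarrow>
    (\<exists>D\<subseteq>G. dominant_set D \<and> card D = CARD('n) \<and> \<not> (\<exists>m\<in>G. mono_strongly_dvd m (mono_lcm D)))"
  proof
    assume "\<exists>xs\<in>odom_class M. length xs = CARD('n)"
    then obtain xs D where xs: "length xs = CARD('n)" "D \<subseteq> G" "dominant_set D" "card D = length xs"
      and dvd: "\<And>m. m \<in> G \<Longrightarrow> mono_dvd m (mono_lcm D) \<Longrightarrow>
        \<exists>x\<in>set xs. mono_dvd (Poly_Mapping.single x (Poly_Mapping.lookup (mono_lcm D) x)) m"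
      unfolding odom_class_def mem_Collect_eq G by blast
    have D: "card D = CARD('n)" "0 \<notin> D" using xs assms(2) by auto
    have pos: "\<forall>x. Poly_Mapping.lookup (mono_lcm D) x > 0"
      by (rule full_dominant_set[OF xs(3) D])
    have "\<not> mono_strongly_dvd m (mono_lcm D)" if m: "m \<in> G" for m
    proof
      assume "mono_strongly_dvd m (mono_lcm D)"
      then have lt: "Poly_Mapping.lookup m x < Poly_Mapping.lookup (mono_lcm D) x" for x
        unfolding mono_strongly_dvd_iff[OF pos] by blast
      then have "mono_dvd m (mono_lcm D)" unfolding mono_dvd_def by (simp add: less_imp_le)
      from dvd[OF m this] obtain x where "Poly_Mapping.lookup (mono_lcm D) x \<le> Poly_Mapping.lookup m x"
        unfolding mono_dvd_single by blast
      then show False using lt[of x] by simp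
    qed
    then show "\<exists>D\<subseteq>G. dominant_set D \<and> card D = CARD('n) \<and> \<not> (\<exists>m\<in>G. mono_strongly_dvd m (mono_lcm D))"
      using xs(2,3) D(1) by blast
  next
    assume "\<exists>D\<subseteq>G. dominant_set D \<and> card D = CARD('n) \<and> \<not> (\<exists>m\<in>G. mono_strongly_dvd m (mono_lcm D))"
    then obtain D where D: "D \<subseteq> G" "dominant_set D" "card D = CARD('n)"
      and str: "\<not> (\<exists>m\<in>G. mono_strongly_dvd m (mono_lcm D))" by blast
    have "0 \<notin> D" using D(1) assms(2) by blast
    from full_dominant_set[OF D(2,3) this] obtain g where g: "bij_betw g UNIV D"
      and dom: "\<forall>x. dominant_in D (g x) x" and pos: "\<forall>x. Poly_Mapping.lookup (mono_lcm D) x > 0" .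
    define xs where "xs = sorted_list_of_set (UNIV :: 'n set)"
    have xs: "set xs = UNIV" "sorted_wrt (<) xs" "length xs = CARD('n)"
      by (simp_all add: xs_def)
    have "xs \<in> odom_class M"
      unfolding odom_class_def mem_Collect_eq G
    proof (intro conjI exI[of _ D] exI[of _ "map g xs"] allI impI ballI)
      show "xs \<noteq> []" using xs(1) by auto
      show "D = set (map g xs)" using bij_betw_imp_surj_on[OF g] xs(1) by simp
      show "dominant_in D (map g xs ! j) (xs ! j)" if "j < length xs" for j using dom that by simp
      show "\<exists>x\<in>set xs. mono_dvd (Poly_Mapping.single x (Poly_Mapping.lookup (mono_lcm D) x)) m"
        if "m \<in> G" "mono_dvd m (mono_lcm D)" for m
        using str that(1) unfolding mono_strongly_dvd_iff[OF pos] mono_dvd_single xs(1) by (meson UNIV_I not_le)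
    qed (use D xs in simp_all)
    then show "\<exists>xs\<in>odom_class M. length xs = CARD('n)" using xs(3) by blast
  qed
  finally show ?thesis .
qed

section \<open>Polarization and nets\<close>

lemma lookup_polarize:
  "Poly_Mapping.lookup (polarize m) (i, j) = (if 1 \<le> j \<and> j \<le> Poly_Mapping.lookup m i then 1 else 0)"
proof -
  have "Poly_Mapping.lookup (polarize m) (i, j) = (\<Sum>i'\<in>Poly_Mapping.keys m.
      if i' = i then (\<Sum>j'=1..Poly_Mapping.lookup m i. if j' = j then 1 else 0) else 0)"
    unfolding polarize_def lookup_sum
    by (intro sum.cong refl) (auto simp: lookup_single when_def)
  also have "\<dots> = (if i \<in> Poly_Mapping.keys m then (\<Sum>j'=1..Poly_Mapping.lookup m i. if j' = j then 1 else 0) else 0)"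
    by (simp add: sum.delta)
  also have "\<dots> = (if 1 \<le> j \<and> j \<le> Poly_Mapping.lookup m i then 1 else 0)"
    by (auto simp: in_keys_iff sum.delta)
  finally show ?thesis .
qed

lemma mono_dvd_polarize: "mono_dvd (polarize a) (polarize b) \<Longrightarrow> mono_dvd a b"
  unfolding mono_dvd_def
proof
  fix i assume dvd: "\<forall>k. Poly_Mapping.lookup (polarize a) k \<le> Poly_Mapping.lookup (polarize b) k"
  \<comment> \<open>Tested at the last variable of block \<open>i\<close> in the polarization of
    \<open>a\<close>.\<close>
  show "Poly_Mapping.lookup a i \<le> Poly_Mapping.lookup b i"
    using dvd[rule_format, of "(i, Poly_Mapping.lookup a i)"] unfolding lookup_polarize
    by (cases "Poly_Mapping.lookup a i = 0") (auto split: if_splits)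
qed

text \<open>Polarization reflects divisibility, so the polarized generators form an antichain and
  are the minimal generators of \<open>pol_ideal M\<close>.\<close>

lemma pol_ideal_nets:
  fixes M :: "(('n \<Rightarrow>\<^sub>0 nat) \<Rightarrow>\<^sub>0 'k::field) set"
  assumes G: "min_gens UNIV M = G" "mono_antichain G"
  shows "is_net (pol_vars M) (pol_ideal M) X \<longleftrightarrow>
    (\<forall>(i, j)\<in>X. 1 \<le> j \<and> (\<exists>m\<in>G. j \<le> Poly_Mapping.lookup m i)) \<and>
    (\<forall>m\<in>G. \<exists>(i, j)\<in>X. 1 \<le> j \<and> j \<le> Poly_Mapping.lookup m i)"
proof -
  have sub: "polarize ` G \<subseteq> monomials_in (pol_vars M)"
    using G(1) by (auto simp: monomials_in_def pol_vars_def)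
  have anti: "mono_antichain (polarize ` G)"
    using G(2) mono_dvd_polarize unfolding mono_antichain_def by blast
  have gens: "min_gens (pol_vars M) (pol_ideal M) = polarize ` G"
    unfolding pol_ideal_def G(1) by (rule min_gens_antichain[OF sub anti])
  have vars: "(i, j) \<in> pol_vars M \<longleftrightarrow> 1 \<le> j \<and> (\<exists>m\<in>G. j \<le> Poly_Mapping.lookup m i)" for i j
    unfolding pol_vars_def G(1) by (auto simp: in_keys_iff lookup_polarize split: if_splits)
  have cov: "mono_dvd (Poly_Mapping.single (i, j) 1) (polarize m) \<longleftrightarrow> 1 \<le> j \<and> j \<le> Poly_Mapping.lookup m i" for i :: 'n and j m
    unfolding mono_dvd_single lookup_polarize by simp
  show ?thesis
    unfolding is_net_def gens
  proof (intro arg_cong2[of _ _ _ _ "(\<and>)"])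
    show "(X \<subseteq> pol_vars M) = (\<forall>(i, j)\<in>X. 1 \<le> j \<and> (\<exists>m\<in>G. j \<le> Poly_Mapping.lookup m i))"
      using vars by auto
    show "(\<forall>m\<in>polarize ` G. \<exists>x\<in>X. mono_dvd (Poly_Mapping.single x 1) m) =
        (\<forall>m\<in>G. \<exists>(i, j)\<in>X. 1 \<le> j \<and> j \<le> Poly_Mapping.lookup m i)"
      using cov by (simp add: Bex_def split_paired_Ex case_prod_unfold del: One_nat_def)
  qed
qed

text \<open>Among the multiples of \<open>x\<^sup>u\<close> outside the ideal, those of largest degree are socle monomials. The
  generator \<open>g i\<close> bounds the exponent of the \<open>i\<close>-th variable.\<close>

lemma socle_monomial_exists:
  fixes G :: "('n::finite \<Rightarrow>\<^sub>0 nat) set"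
  assumes u: "\<forall>m\<in>G. \<not> Poly_Mapping.lookup m \<le> u"
    and g: "\<forall>i. g i \<in> G \<and> (\<forall>k. k \<noteq> i \<longrightarrow> Poly_Mapping.lookup (g i) k \<le> u k)"
  shows "\<exists>w. socle_monomial G w"
proof -
  define P where "P w \<longleftrightarrow> u \<le> w \<and> (\<forall>m\<in>G. \<not> Poly_Mapping.lookup m \<le> w)" for w
  define f where "f w = (\<Sum>i\<in>UNIV. w i)" for w :: "'n \<Rightarrow> nat"
  have bound: "w i \<le> Poly_Mapping.lookup (g i) i" if "P w" for w i
  proof (rule ccontr)
    assume "\<not> w i \<le> Poly_Mapping.lookup (g i) i"
    moreover have "Poly_Mapping.lookup (g i) k \<le> w k" if "k \<noteq> i" for k
      using g that \<open>P w\<close> unfolding P_def by (meson le_funD order_trans)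
    ultimately have "Poly_Mapping.lookup (g i) \<le> w"
      by (intro le_funI) (metis less_imp_le not_le)
    then show False using that g unfolding P_def by blast
  qed
  have "f w < Suc (\<Sum>i\<in>UNIV. Poly_Mapping.lookup (g i) i)" if "P w" for w
    unfolding f_def less_Suc_eq_le using bound[OF that] by (intro sum_mono) simp
  moreover have "P u" using u unfolding P_def by simp
  ultimately obtain w where w: "P w" "\<And>y. P y \<Longrightarrow> f y \<le> f w"
    using ex_has_greatest_nat[of P u f] by metis
  have "\<exists>m\<in>G. Poly_Mapping.lookup m \<le> w(x := Suc (w x))" for x
  proof (rule ccontr)
    assume no: "\<not> (\<exists>m\<in>G. Poly_Mapping.lookup m \<le> w(x := Suc (w x)))"
    have "w \<le> w(x := Suc (w x))" by (simp add: le_fun_def)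
    then have "P (w(x := Suc (w x)))" using no w(1) unfolding P_def by (meson order_trans)
    moreover have "f w < f (w(x := Suc (w x)))"
      unfolding f_def by (intro sum_strict_mono_ex1) auto
    ultimately show False using w(2) by (meson not_le)
  qed
  then have "socle_monomial G w" using w(1) unfolding socle_monomial_def P_def by blast
  then show ?thesis by blast
qed

theorem socle_monomial_iff_minimal_net:
  fixes M :: "(('n::finite \<Rightarrow>\<^sub>0 nat) \<Rightarrow>\<^sub>0 'k::field) set"
  assumes G: "min_gens UNIV M = G" "mono_antichain G"
  shows "(\<exists>u. socle_monomial G u) \<longleftrightarrow>
    (\<exists>X. is_minimal_net (pol_vars M) (pol_ideal M) X \<and> card X = CARD('n))"
proof
  note net = pol_ideal_nets[OF G]
  assume "\<exists>u. socle_monomial G u"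
  then obtain u where u: "socle_monomial G u" by blast
  obtain g where g: "\<forall>x. g x \<in> G \<and> Poly_Mapping.lookup (g x) x = Suc (u x) \<and>
    (\<forall>y. y \<noteq> x \<longrightarrow> Poly_Mapping.lookup (g x) y \<le> u y)"
    by (rule socle_monomial_generators[OF u])
  define X where "X = range (\<lambda>i. (i, Suc (u i)))"
  have "is_net (pol_vars M) (pol_ideal M) X"
    unfolding net
  proof (intro conjI ballI)
    fix p assume "p \<in> X"
    then obtain i where "p = (i, Suc (u i))" by (auto simp: X_def)
    then show "case p of (i, j) \<Rightarrow> 1 \<le> j \<and> (\<exists>m\<in>G. j \<le> Poly_Mapping.lookup m i)"
      using g[rule_format, of i] by (auto intro!: bexI[of _ "g i"])
  next
    fix m assume "m \<in> G"
    then have "\<not> Poly_Mapping.lookup m \<le> u" using u unfolding socle_monomial_def by blast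
    then obtain i where "Suc (u i) \<le> Poly_Mapping.lookup m i" by (auto simp: le_fun_def not_le Suc_le_eq)
    then show "\<exists>(i, j)\<in>X. 1 \<le> j \<and> j \<le> Poly_Mapping.lookup m i"
      by (intro bexI[of _ "(i, Suc (u i))"]) (auto simp: X_def)
  qed
  moreover have "\<not> is_net (pol_vars M) (pol_ideal M) Y" if Y: "Y \<subset> X" for Y
  proof
    assume "is_net (pol_vars M) (pol_ideal M) Y"
    then have cov: "\<forall>m\<in>G. \<exists>(i, j)\<in>Y. 1 \<le> j \<and> j \<le> Poly_Mapping.lookup m i" unfolding net by blast
    \<comment> \<open>The only element of \<open>X\<close> dividing the polarization of
      \<open>g i\<close> is the one for variable \<open>i\<close>, so without it \<open>g i\<close>
      is not covered.\<close>
    obtain i where i: "(i, Suc (u i)) \<notin> Y" using Y by (auto simp: X_def)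
    obtain k j where kj: "(k, j) \<in> Y" "j \<le> Poly_Mapping.lookup (g i) k" using cov g by blast
    have j: "j = Suc (u k)" using kj(1) Y by (auto simp: X_def)
    then have "k \<noteq> i" using kj(1) i by blast
    then show False using g kj(2) j by (metis not_less_eq_eq)
  qed
  moreover have "card X = CARD('n)" unfolding X_def by (rule card_image) (auto intro: injI)
  ultimately show "\<exists>X. is_minimal_net (pol_vars M) (pol_ideal M) X \<and> card X = CARD('n)"
    unfolding is_minimal_net_def by blast
next
  note net = pol_ideal_nets[OF G]
  assume "\<exists>X. is_minimal_net (pol_vars M) (pol_ideal M) X \<and> card X = CARD('n)"
  then obtain X where N: "is_net (pol_vars M) (pol_ideal M) X"
    and min: "\<And>Y. Y \<subset> X \<Longrightarrow> \<not> is_net (pol_vars M) (pol_ideal M) Y" and card: "card X = CARD('n)"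
    unfolding is_minimal_net_def by blast
  have vars: "1 \<le> j" "\<exists>m\<in>G. j \<le> Poly_Mapping.lookup m i" if "(i, j) \<in> X" for i j
    using N that unfolding net by blast+
  have cov: "\<exists>i j. (i, j) \<in> X \<and> 1 \<le> j \<and> j \<le> Poly_Mapping.lookup m i" if "m \<in> G" for m
    using N that unfolding net by blast
  \<comment> \<open>By minimality each element of the net has a generator that it alone
    covers.\<close>
  have essential: "\<exists>m\<in>G. \<forall>k l. (k, l) \<in> X \<longrightarrow> (k, l) \<noteq> (i, j) \<longrightarrow> Poly_Mapping.lookup m k < l"
    if "(i, j) \<in> X" for i j
  proof (rule ccontr)
    assume no: "\<not> ?thesis"
    have "is_net (pol_vars M) (pol_ideal M) (X - {(i, j)})"
      unfolding net
    proof (intro conjI ballI)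
      fix p assume "p \<in> X - {(i, j)}"
      then show "case p of (i, j) \<Rightarrow> 1 \<le> j \<and> (\<exists>m\<in>G. j \<le> Poly_Mapping.lookup m i)"
        using vars by (cases p) auto
    next
      fix m assume "m \<in> G"
      then obtain k l where "(k, l) \<in> X" "(k, l) \<noteq> (i, j)" "l \<le> Poly_Mapping.lookup m k"
        using no by (meson not_le)
      then show "\<exists>(i, j)\<in>X - {(i, j)}. 1 \<le> j \<and> j \<le> Poly_Mapping.lookup m i"
        using vars(1) by (intro bexI[of _ "(k, l)"]) auto
    qed
    then show False using min[of "X - {(i, j)}"] that by blast
  qed
  \<comment> \<open>For \<open>j < j'\<close>, a polarization divisible by the variable
    \<open>(i, j')\<close> is divisible by \<open>(i, j)\<close> too, so \<open>(i, j')\<close>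
    would not be essential.\<close>
  have unique: "j = j'" if "(i, j) \<in> X" "(i, j') \<in> X" for i j j'
  proof (rule ccontr)
    have False if "(i, j) \<in> X" "(i, j') \<in> X" "j < j'" for j j'
    proof -
      obtain m where m: "m \<in> G" "\<forall>k l. (k, l) \<in> X \<longrightarrow> (k, l) \<noteq> (i, j') \<longrightarrow> Poly_Mapping.lookup m k < l"
        using essential[OF \<open>(i, j') \<in> X\<close>] by blast
      obtain k l where kl: "(k, l) \<in> X" "l \<le> Poly_Mapping.lookup m k" using cov[OF m(1)] by blast
      then have "(k, l) = (i, j')" using m(2) by (meson not_le)
      then show False using m(2)[rule_format, OF that(1)] that(3) kl(2) by simp
    qed
    moreover assume "j \<noteq> j'"
    ultimately show False using that by (metis linorder_neqE_nat)
  qed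
  have "inj_on fst X" using unique by (auto intro!: inj_onI)
  then have "card (fst ` X) = CARD('n)" using card by (simp add: card_image)
  then have "fst ` X = UNIV" by (intro card_subset_eq) auto
  then have "\<forall>i. \<exists>j. (i, j) \<in> X" by force
  from choice[OF this] obtain \<beta> where \<beta>: "\<And>i. (i, \<beta> i) \<in> X" by blast
  have X: "j = \<beta> i" if "(i, j) \<in> X" for i j using unique[OF that \<beta>] .
  \<comment> \<open>The monomial \<open>x^u\<close> is outside the ideal because the net meets every
    generator, but it need not be a socle monomial. The essential generators bound its multiples
    outside the ideal, as \<open>socle_monomial_exists\<close> requires.\<close>
  define u where "u i = \<beta> i - 1" for i
  have \<beta>u: "\<beta> i = Suc (u i)" for i using vars(1)[OF \<beta>, of i] by (simp add: u_def)
  have "\<not> Poly_Mapping.lookup m \<le> u" if m: "m \<in> G" for m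
  proof
    assume le: "Poly_Mapping.lookup m \<le> u"
    obtain i j where ij: "(i, j) \<in> X" "j \<le> Poly_Mapping.lookup m i" using cov[OF m] by blast
    then show False using X[OF ij(1)] \<beta>u[of i] le_funD[OF le, of i] by simp
  qed
  moreover have "\<exists>m. m \<in> G \<and> (\<forall>k. k \<noteq> i \<longrightarrow> Poly_Mapping.lookup m k \<le> u k)" for i
  proof -
    obtain m where m: "m \<in> G" "\<forall>k l. (k, l) \<in> X \<longrightarrow> (k, l) \<noteq> (i, \<beta> i) \<longrightarrow> Poly_Mapping.lookup m k < l"
      using essential[OF \<beta>] by blast
    have "Poly_Mapping.lookup m k \<le> u k" if "k \<noteq> i" for k
      using m(2)[rule_format, OF \<beta>, of k] that \<beta>u[of k] by simp
    then show ?thesis using m(1) by blast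
  qed
  then obtain g where "\<forall>i. g i \<in> G \<and> (\<forall>k. k \<noteq> i \<longrightarrow> Poly_Mapping.lookup (g i) k \<le> u k)"
    using choice by metis
  ultimately show "\<exists>u. socle_monomial G u" using socle_monomial_exists by blast
qed

theorem theorem5p1:
  fixes M :: "(('n::{finite,linorder} \<Rightarrow>\<^sub>0 nat) \<Rightarrow>\<^sub>0 'k::field) set"
    and S :: "(('n \<Rightarrow>\<^sub>0 nat) \<Rightarrow>\<^sub>0 'k) ring"
    and n :: nat
    and G :: "('n \<Rightarrow>\<^sub>0 nat) set"
  assumes n: "n = CARD('n)"
    and S: "S = mpoly_ring UNIV"
    and M: "monomial_ideal UNIV M"
    and nonzero: "M \<noteq> {0}"
    and proper: "M \<noteq> carrier S"
    and G: "G = min_gens UNIV M"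
  defines "i \<equiv> proj_dim S (quot_module S M) = enat n"
    and "ii \<equiv> \<forall>i. betti M i \<ge> n choose i"
    and "iii \<equiv> \<exists>D\<subseteq>G. dominant_set D \<and> card D = n \<and> \<not> (\<exists>m\<in>G. mono_strongly_dvd m (mono_lcm D))"
    and "iv \<equiv> odom M = n"
    and "v \<equiv> \<exists>X. is_minimal_net (pol_vars M) (pol_ideal M) X \<and> card X = n"
  shows "(i \<longleftrightarrow> ii) \<and> (i \<longleftrightarrow> iii) \<and> (i \<longleftrightarrow> iv) \<and> (i \<longleftrightarrow> v)"
proof -
  have UN: "A \<subseteq> monomials_in UNIV" for A :: "('n \<Rightarrow>\<^sub>0 nat) set" by (simp add: monomials_in_def)
  obtain A where A: "M = generated_by_monomials UNIV A" using M unfolding monomial_ideal_def by blast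
  \<comment> \<open>Passing to an antichain with the same ideal makes \<open>min_gens\<close>
    explicit.\<close>
  obtain B where B: "B \<subseteq> A" "mono_antichain B" "\<And>a. a \<in> A \<Longrightarrow> \<exists>b\<in>B. mono_dvd b a"
    by (rule antichain_generators_exist[of A]) (rule that)
  have "(\<exists>a\<in>A. mono_dvd a m) \<longleftrightarrow> (\<exists>b\<in>B. mono_dvd b m)" for m
    using B(1,3) mono_dvd_trans by blast
  then have MB: "M = generated_by_monomials UNIV B"
    unfolding A generated_by_monomials_eq[OF UN] by simp
  have "min_gens UNIV M = B" unfolding MB by (rule min_gens_antichain[OF UN B(2)])
  then have GB: "G = B" using G by simp
  have anti: "mono_antichain G" and MG: "M = generated_by_monomials UNIV G" using B(2) MB GB by simp_all
  have mem: "p \<in> M \<longleftrightarrow> (\<forall>m\<in>Poly_Mapping.keys p. \<exists>g\<in>G. mono_dvd g m)" for p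
    unfolding MG generated_by_monomials_eq[OF UN] by simp
  have ne: "G \<noteq> {}"
  proof
    assume "G = {}"
    then have "p \<in> M \<longleftrightarrow> p = 0" for p unfolding mem by (auto simp flip: keys_eq_empty)
    then show False using nonzero by blast
  qed
  have zero: "0 \<notin> G"
  proof
    assume "0 \<in> G"
    moreover have "mono_dvd 0 m" for m :: "'n \<Rightarrow>\<^sub>0 nat" by (simp add: mono_dvd_def)
    ultimately have "M = UNIV" using mem by blast
    then show False using proper S by simp
  qed
  have idl: "ideal M (mpoly_ring UNIV)" unfolding MG by (rule generated_by_monomials_ideal[OF UN])
  define U where "U = {a. \<exists>g\<in>G. Poly_Mapping.lookup g \<le> a}"
  have soc: "u \<notin> U \<and> (\<forall>x. u(x := Suc (u x)) \<in> U) \<longleftrightarrow> socle_monomial G u" for u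
    unfolding U_def socle_monomial_def by blast
  have U: "p \<in> M \<longleftrightarrow> (\<forall>m\<in>Poly_Mapping.keys p. Poly_Mapping.lookup m \<in> U)" for p
    unfolding mem U_def mono_dvd_def le_fun_def by simp
  have up: "c \<in> U" if "a \<in> U" "a \<le> c" for a c using that unfolding U_def by (auto intro: order_trans)
  have U0: "(\<lambda>_. 0) \<notin> U"
  proof
    assume "(\<lambda>_. 0) \<in> U"
    then obtain g where "g \<in> G" "\<forall>x. Poly_Mapping.lookup g x = 0" unfolding U_def le_fun_def by auto
    then have "g = 0" by (intro poly_mapping_eqI) simp
    then show False using zero \<open>g \<in> G\<close> by simp
  qed
  show ?thesis
  proof (rule monomial_resolution[OF idl U up U0])
    fix b deg d \<epsilon>
    assume F: "minimal_free_resolution M b deg d \<epsilon>" and above: "\<And>i. CARD('n) < i \<Longrightarrow> b i = 0"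
      and top: "0 < b CARD('n) \<Longrightarrow> \<exists>u. u \<notin> U \<and> (\<forall>x. u(x := Suc (u x)) \<in> U)"
      and choose: "\<And>u i. u \<notin> U \<Longrightarrow> (\<And>x. u(x := Suc (u x)) \<in> U) \<Longrightarrow> CARD('n) choose i \<le> b i"
    have choose': "\<forall>i. CARD('n) choose i \<le> b i" if "socle_monomial G u" for u
      using choose[of u] soc[of u] that by blast
    have betti: "betti M i = b i" for i by (rule betti_eq_rank[OF idl F])
    have i_top: "i \<longleftrightarrow> 0 < b CARD('n)"
      unfolding i_def S n by (rule proj_dim_eq_iff[OF idl F _ above]) simp_all
    have ii_soc: "ii \<longleftrightarrow> (\<exists>u. socle_monomial G u)"
    proof
      assume ii
      then have "CARD('n) choose CARD('n) \<le> b CARD('n)" unfolding ii_def n betti by blast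
      then have "0 < b CARD('n)" by simp
      then show "\<exists>u. socle_monomial G u" using top soc by blast
    next
      assume "\<exists>u. socle_monomial G u"
      then show ii unfolding ii_def n betti using choose' by blast
    qed
    have i_soc: "i \<longleftrightarrow> (\<exists>u. socle_monomial G u)"
    proof
      assume i
      then show "\<exists>u. socle_monomial G u" using i_top top soc by blast
    next
      assume "\<exists>u. socle_monomial G u"
      then have "CARD('n) choose CARD('n) \<le> b CARD('n)" using choose' by blast
      then show i unfolding i_top by simp
    qed
    have iii_soc: "iii \<longleftrightarrow> (\<exists>u. socle_monomial G u)"
      unfolding iii_def n by (rule socle_monomial_iff_dominant_set[OF zero, symmetric])
    have iv_iii: "iv \<longleftrightarrow> iii"
      unfolding iv_def iii_def n by (rule odom_eq_iff[OF G[symmetric] zero ne anti])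
    have v_soc: "v \<longleftrightarrow> (\<exists>u. socle_monomial G u)"
      unfolding v_def n by (rule socle_monomial_iff_minimal_net[OF G[symmetric] anti, symmetric])
    show ?thesis unfolding iv_iii unfolding i_soc ii_soc iii_soc v_soc by simp
  qed
qed

end
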